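(* Let $r \ge 2$ be a fixed integer. For every natural number $k\ge 2$ there exists a natural number $t$ (which may depend on $k$ and $r$) such that $$\mathrm{ex}_r(n, \Theta_{k,t}^{B}) = \Omega_{k,r}\left(n^{1+\frac{1}{k}}\right),$$ that is, there exist a constant $c>0$ and an integer $n_0$, depending only on $k$ and $r$, such that $\mathrm{ex}_r(n,\Theta_{k,t}^{B})\ge c\,n^{1+\frac1k}$ for all $n\ge n_0$.
   Context: All graphs and hypergraphs are finite and simple (no repeated edges). An $r$-uniform hypergraph is one in which every hyperedge has exactly $r$ vertices. The theta graph $\Theta_{k,t}$ is the simple ($2$-uniform) graph formed by $t$ internally vertex-disjoint paths of length $k$ (i.e. with $k$ edges) between a fixed pair of distinct vertices. For a graph $F$, a hypergraph $H$ is called a Berge-$F$ if $V(F)\subseteq V(H)$ (after identifying $F$ with an isomorphic copy) and there is a bijection $\phi:E(F)\to E(H)$ such that $e\subseteq \phi(e)$ for all $e\in E(F)$. For fixed uniformity $r$, $F^{B}=F^{B,r}$ denotes the family of all $r$-uniform hypergraphs that are a Berge-$F$; in particular $\Theta_{k,t}^{B}$ is the family of all $r$-uniform Berge-$\Theta_{k,t}$ hypergraphs. For a family $\mathcal{F}$ of $r$-uniform hypergraphs, $\mathrm{ex}_r(n,\mathcal{F})$ denotes the maximum number of hyperedges in an $n$-vertex $r$-uniform hypergraph that contains no member of $\mathcal{F}$ as a subhypergraph. *)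

theory Defs
  imports Complex_Main
begin

type_synonym 'a hypergraph = "'a set \<times> 'a set set"

abbreviation verts :: "'a hypergraph \<Rightarrow> 'a set" where "verts \<equiv> fst"

abbreviation edges :: "'a hypergraph \<Rightarrow> 'a set set" where "edges \<equiv> snd"

definition uniform_hypergraph :: "nat \<Rightarrow> 'a hypergraph \<Rightarrow> bool" where
  "uniform_hypergraph r H \<longleftrightarrow>
     finite (verts H) \<and> (\<forall>e\<in>edges H. e \<subseteq> verts H \<and> card e = r)"

(* Containment as a not necessarily induced subhypergraph, up to isomorphism. *)
definition contains_copy :: "'a hypergraph \<Rightarrow> 'b hypergraph \<Rightarrow> bool" where
  "contains_copy H G \<longleftrightarrow>
     (\<exists>f. inj_on f (verts G) \<and> f ` verts G \<subseteq> verts H \<and> (\<lambda>e. f ` e) ` edges G \<subseteq> edges H)"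

datatype theta_vertex = Source | Target | Inner nat nat

(* The j-th vertex (0 \<le> j \<le> k) on the i-th path of length k from Source to Target. *)
definition theta_path :: "nat \<Rightarrow> nat \<Rightarrow> nat \<Rightarrow> theta_vertex" where
  "theta_path k i j = (if j = 0 then Source else if j = k then Target else Inner i j)"

definition theta_graph :: "nat \<Rightarrow> nat \<Rightarrow> theta_vertex hypergraph" where
  "theta_graph k t =
     ({Source, Target} \<union> {theta_path k i j | i j. i < t \<and> j \<le> k},
      {{theta_path k i j, theta_path k i (Suc j)} | i j. i < t \<and> j < k})"

(* The injection f identifies F with an isomorphic copy on vertices of H. *)
definition is_berge :: "'a hypergraph \<Rightarrow> 'b hypergraph \<Rightarrow> bool" where
  "is_berge F H \<longleftrightarrow>
     (\<exists>f \<phi>. inj_on f (verts F) \<and> f ` verts F \<subseteq> verts H \<and>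
        bij_betw \<phi> (edges F) (edges H) \<and> (\<forall>e\<in>edges F. f ` e \<subseteq> \<phi> e))"

(* Vertices are natural numbers; up to isomorphism this covers all finite hypergraphs. *)
definition berge_family :: "nat \<Rightarrow> 'a hypergraph \<Rightarrow> nat hypergraph set" where
  "berge_family r F = {H. uniform_hypergraph r H \<and> is_berge F H}"

definition free_hypergraphs :: "nat \<Rightarrow> nat \<Rightarrow> 'a hypergraph set \<Rightarrow> nat hypergraph set" where
  "free_hypergraphs r n \<F> =
     {H. uniform_hypergraph r H \<and> card (verts H) = n \<and> (\<forall>G\<in>\<F>. \<not> contains_copy H G)}"

definition ex_num :: "nat \<Rightarrow> nat \<Rightarrow> 'a hypergraph set \<Rightarrow> nat" where
  "ex_num r n \<F> = Max {card (edges H) | H. H \<in> free_hypergraphs r n \<F>}"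

(* The two facts below show that the maximum in the definition of ex_num ranges over a finite
   set, which is nonempty for the families of Berge theta hypergraphs. *)
lemma finite_free_edge_counts: "finite {card (edges H) | H. H \<in> free_hypergraphs r n \<F>}"
proof (rule finite_subset)
  show "{card (edges H) | H. H \<in> free_hypergraphs r n \<F>} \<subseteq> {..2 ^ n}"
  proof
    fix m assume "m \<in> {card (edges H) | H. H \<in> free_hypergraphs r n \<F>}"
    then obtain H where H: "H \<in> free_hypergraphs r n \<F>" and m: "m = card (edges H)" by blast
    from H have "finite (verts H)" "card (verts H) = n" "edges H \<subseteq> Pow (verts H)"
      by (auto simp: free_hypergraphs_def uniform_hypergraph_def)
    then show "m \<in> {..2 ^ n}"
      using card_mono[of "Pow (verts H)" "edges H"] by (simp add: card_Pow m)
  qed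
qed simp

lemma free_hypergraphs_berge_theta_nonempty:
  assumes "t \<ge> 1" "k \<ge> 1"
  shows "free_hypergraphs r n (berge_family r (theta_graph k t)) \<noteq> {}"
proof -
  have "{theta_path k 0 0, theta_path k 0 (Suc 0)} \<in> edges (theta_graph k t)"
    using assms by (fastforce simp: theta_graph_def)
  then have "edges (theta_graph k t) \<noteq> {}" by blast
  then have "edges G \<noteq> {}" if "G \<in> berge_family r (theta_graph k t)" for G
    using that by (auto simp: berge_family_def is_berge_def bij_betw_def)
  then have "({..<n}, {}) \<in> free_hypergraphs r n (berge_family r (theta_graph k t))"
    by (auto simp: free_hypergraphs_def uniform_hypergraph_def contains_copy_def)
  then show ?thesis by blast
qed

end

theory Submission
  imports Defs "HOL-Algebra.Algebraic_Closure_Type" "HOL-Library.Z2"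
begin

text \<open>
  Start with \<open>K\<^bsub>q,q\<^esub>\<close>, whose vertices are coloured by the field \<open>F\<close> with \<open>q = 2\<^sup>m\<close> elements, and lift
  \<open>k - 1\<close> times with voltages in \<open>F\<close> given by polynomials of bounded degree on the edges. The result
  has \<open>2 q\<^sup>k\<close> vertices and is \<open>q\<close>-regular. A non-backtracking walk of length \<open>l\<close> is a sequence of \<open>l\<close>
  colours, and fixing its two ends in the \<open>j\<close>-th lift should leave a set of dimension \<open>l - 1 - j\<close>, hence
  a bounded set in the last lift if \<open>l \<le> k\<close>. Dimension is measured by the growth of the Hilbert
  function in a bounded range of degrees: split the set into boundedly many pieces that are
  irreducible up to a bounded degree. Either most voltages are non-constant on such a piece, so that
  prescribing the end of the lifted walk lowers its dimension by one, or the edges traversed an odd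
  number of times are almost constant on the piece, and then its walks decompose into shorter
  ones. As only points over \<open>F\<close> and polynomials of bounded degree occur, no estimate of
  Lang--Weil type is needed.

  For the hypergraph, replace every vertex on one side by \<open>r - 1\<close> copies. A Berge path projects to
  a trail that may stay at a vertex, and its moving steps form a non-backtracking walk of length at
  most \<open>k\<close>; so there are few possible second vertices, and few internally disjoint Berge paths.
\<close>

section \<open>Finite fields of characteristic two\<close>

text \<open>In characteristic two the voltage of an edge is the same in both directions, so a step
  and its reversal cancel, and the voltage of a walk sees only the edges crossed an odd number of
  times. The obstacle is that walks may repeat edges: the voltages of a whole family of walks can
  then be forced to agree, whatever the voltage assignment. Odd edges measure this. If a piece
  contains \<open>M\<close> walks, each with an odd edge met by none of the earlier ones, then
  functions separating edges make the \<open>M\<close> voltages independent, and a given constant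
  value on the piece has probability at most \<open>card F\<close> to the power \<open>-M\<close>.
  There are about \<open>card F ^ (2 * k)\<close> pairs of ends, each with boundedly many pieces, so
  a fixed \<open>M\<close> lets a single voltage assignment serve all of them. Cutting by a
  polynomial of degree \<open>e\<close> uses up part of the range of degrees in which dimension is
  controlled. The dimension constant and the degrees of all lifts are therefore fixed before any
  range, and the ranges are found backwards from the last lift.\<close>

locale finite_subfield2 =
  fixes F :: "'a::field set"
  assumes finite_F: "finite F"
    and zero_F [simp]: "0 \<in> F" and one_F [simp]: "1 \<in> F"
    and add_F [simp]: "x \<in> F \<Longrightarrow> y \<in> F \<Longrightarrow> x + y \<in> F"
    and mult_F [simp]: "x \<in> F \<Longrightarrow> y \<in> F \<Longrightarrow> x * y \<in> F"
    and inverse_F [simp]: "x \<in> F \<Longrightarrow> inverse x \<in> F"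
    and char2: "(x::'a) + x = 0"
begin

lemma add_self_left [simp]: "x + (x + y) = (y::'a)"
  by (metis add.assoc add_0 char2)

lemma add_eq_0 [simp]: "x + y = 0 \<longleftrightarrow> x = (y::'a)"
  by (metis add_self_left add.right_neutral char2)

lemma of_nat_char2: "(of_nat n :: 'a) = (if even n then 0 else 1)"
  by (induction n) (auto simp: char2)

lemma card_F_ge_2: "card F \<ge> 2"
proof -
  have "card {0, 1::'a} \<le> card F"
    by (rule card_mono) (auto simp: finite_F)
  then show ?thesis by simp
qed

end

text \<open>The field is the set of roots of \<open>X ^ q + X\<close> in one algebraically closed
  field, so that the fields of all sizes \<open>2 ^ m\<close> live in the same type. The polynomial
  splits there and its derivative is 1, so its roots are simple and there are exactly
  \<open>q\<close> of them.\<close>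

lemma finite_subfield2_exists:
  "\<exists>F :: bit alg_closure set. finite_subfield2 F \<and> card F = 2 ^ m" if "m \<ge> 1"
proof -
  define q where "q = (2::nat) ^ m"
  have q: "q \<ge> 2" using that by (simp add: q_def self_le_power)
  have two: "(1 + 1 :: bit alg_closure) = 0"
  proof -
    have "(1 + 1 :: bit alg_closure) = to_ac (1 + 1 :: bit)" by (simp only: to_ac_add to_ac_1)
    also have "\<dots> = 0" by simp
    finally show ?thesis .
  qed
  have ch: "x + x = 0" for x :: "bit alg_closure"
    using arg_cong[OF two, of "\<lambda>c. x * c"] by (simp only: distrib_left mult_1_right mult_zero_right)
  have frob1: "(x + y)\<^sup>2 = x\<^sup>2 + y\<^sup>2" for x y :: "bit alg_closure"
    using ch[of "x*y"] by (simp add: power2_eq_square algebra_simps)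
  have frob: "(x + y) ^ q = x ^ q + y ^ q" for x y :: "bit alg_closure"
  proof -
    have "(x + y) ^ (2 ^ m) = x ^ (2 ^ m) + y ^ (2 ^ m)"
    proof (induction m)
      case (Suc m)
      then show ?case by (simp add: power_mult[of _ 2] frob1 mult.commute[of 2] power_mult)
    qed simp
    then show ?thesis by (simp add: q_def)
  qed
  define p :: "bit alg_closure poly" where "p = monom 1 q + monom 1 1"
  define F where "F = {x :: bit alg_closure. x ^ q = x}"
  have pl: "poly p x = x ^ q + x" for x by (simp add: p_def poly_monom)
  have Fp: "F = {x. poly p x = 0}"
    unfolding F_def pl using ch by (metis (no_types, lifting) add_right_cancel)
  have cf: "coeff p q = 1" using q by (simp add: p_def)
  have deg: "degree p = q"
  proof (rule antisym)
    show "degree p \<le> q"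
      unfolding p_def using q by (intro degree_add_le) (auto intro: order_trans[OF degree_monom_le])
    show "q \<le> degree p" using cf by (simp add: le_degree)
  qed
  have p0: "p \<noteq> 0" using cf by auto
  have "finite F" unfolding Fp by (rule poly_roots_finite[OF p0])
  have evq: "(of_nat q :: bit alg_closure) = 0"
  proof -
    have "of_nat (2::nat) = (0 :: bit alg_closure)" using two by simp
    then show ?thesis using that by (simp add: q_def power_0_left)
  qed
  have pd: "pderiv p = 1"
    using evq by (simp add: p_def pderiv_add pderiv_monom)
  have ord1: "order x p \<le> 1" for x
  proof (rule ccontr)
    assume "\<not> order x p \<le> 1"
    then have "[:-x, 1:] ^ 2 dvd p"
      by (intro order_divides[THEN iffD2]) simp
    then obtain r where "p = [:-x, 1:] ^ 2 * r" ..
    then have "p = [:-x, 1:] * ([:-x, 1:] * r)" by (simp only: power2_eq_square mult.assoc)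
    moreover have "poly [:-x, 1:] x = 0" by simp
    ultimately have "poly (pderiv p) x = 0"
      by (simp only: pderiv_mult poly_add poly_mult mult_zero_left mult_zero_right add_0)
    then show False by (simp add: pd)
  qed
  obtain A where A: "size A = degree p" "p = smult (lead_coeff p) (\<Prod>x\<in>#A. [:-x, 1:])"
    using alg_closed_imp_factorization[OF p0] by metis
  have setA: "set_mset A = F"
    unfolding Fp using p0 by (subst A(2)) (auto simp: poly_prod_mset prod_mset_zero_iff)
  have cnt: "count A x \<le> 1" for x
  proof (cases "x \<in># A")
    case True
    have "[:-x, 1:] ^ count A x dvd p"
    proof -
      have "[:-x, 1:] ^ count A x dvd (\<Prod>x\<in>#A. [:-x, 1:])"
      proof -
        have "replicate_mset (count A x) x \<subseteq># A"
          by (simp add: count_le_replicate_mset_subset_eq [symmetric])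
        then have "image_mset (\<lambda>x. [:-x, 1:]) (replicate_mset (count A x) x) \<subseteq># image_mset (\<lambda>x. [:-x, 1:]) A"
          by (rule image_mset_subseteq_mono)
        then have "prod_mset (image_mset (\<lambda>x. [:-x, 1:]) (replicate_mset (count A x) x)) dvd (\<Prod>x\<in>#A. [:-x, 1:])"
          by (rule prod_mset_subset_imp_dvd)
        then show ?thesis by simp
      qed
      then show ?thesis by (subst A(2)) (rule dvd_smult)
    qed
    then have "count A x \<le> order x p"
      using p0 by (simp add: order_divides)
    then show ?thesis using ord1[of x] by simp
  next
    case False
    then show ?thesis by (simp add: not_in_iff)
  qed
  have "size A = card F"
  proof -
    have "size A = (\<Sum>x\<in>set_mset A. count A x)" by (simp add: size_multiset_overloaded_eq)
    also have "\<dots> = (\<Sum>x\<in>set_mset A. 1)"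
    proof (rule sum.cong)
      fix x assume "x \<in> set_mset A"
      then have "count A x > 0" by simp
      with cnt[of x] show "count A x = 1" by linarith
    qed simp
    finally show ?thesis by (simp add: setA)
  qed
  with A(1) deg have cardF: "card F = 2 ^ m" by (simp add: q_def)
  have "finite_subfield2 F"
  proof
    show "finite F" by fact
    show "0 \<in> F" "1 \<in> F" using q by (auto simp: F_def)
    show "x + y \<in> F" "x * y \<in> F" if "x \<in> F" "y \<in> F" for x y
      using that by (auto simp: F_def frob power_mult_distrib)
    show "inverse x \<in> F" if "x \<in> F" for x
      using that by (auto simp: F_def power_inverse)
    show "x + x = 0" for x :: "bit alg_closure" by (rule ch)
  qed
  with cardF show ?thesis by blast
qed

section \<open>Hilbert functions of finite point sets\<close>

context finite_subfield2
begin

section \<open>Polynomial functions of bounded degree\<close>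

definition seqs :: "(nat \<Rightarrow> 'a) set" where
  "seqs = {a. \<forall>i. a i \<in> F}"

text \<open>Functions that agree on \<open>F\<close>-points with a polynomial over \<open>F\<close>
  of degree at most \<open>D\<close> in countably many variables. Rule \<open>agree\<close> forgets
  the values off \<open>seqs\<close>, so that functions read off from walks, which make sense only
  for colours in \<open>F\<close>, can count as polynomials.\<close>

inductive pol :: "nat \<Rightarrow> ((nat \<Rightarrow> 'a) \<Rightarrow> 'a) \<Rightarrow> bool" where
  const: "c \<in> F \<Longrightarrow> pol D (\<lambda>_. c)"
| add: "pol D f \<Longrightarrow> pol D g \<Longrightarrow> pol D (\<lambda>a. f a + g a)"
| var: "pol D f \<Longrightarrow> pol (Suc D) (\<lambda>a. a i * f a)"
| agree: "pol D f \<Longrightarrow> (\<And>a. a \<in> seqs \<Longrightarrow> g a = f a) \<Longrightarrow> pol D g"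

lemma pol_in_F: "pol D f \<Longrightarrow> a \<in> seqs \<Longrightarrow> f a \<in> F"
  by (induction rule: pol.induct) (auto simp: seqs_def)

lemma pol_Suc: "pol D f \<Longrightarrow> pol (Suc D) f"
  by (induction rule: pol.induct) (auto intro: pol.intros)

lemma pol_mono: "pol D f \<Longrightarrow> D \<le> E \<Longrightarrow> pol E f"
  by (induction E) (auto simp: le_Suc_eq intro: pol_Suc)

lemma pol_scale: "pol D f \<Longrightarrow> c \<in> F \<Longrightarrow> pol D (\<lambda>a. c * f a)"
proof (induction rule: pol.induct)
  case (add D f g)
  then show ?case by (simp add: distrib_left pol.add)
next
  case (var D f i)
  have "(\<lambda>a. c * (a i * f a)) = (\<lambda>a. a i * (c * f a))" by (auto simp: mult_ac)
  then show ?case using var by (simp add: pol.var)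
next
  case (agree D f g)
  show ?case by (rule pol.agree[OF agree.IH[OF agree.prems]]) (simp add: agree.hyps)
qed (auto intro: pol.const)

lemma pol_mult: "pol D f \<Longrightarrow> pol E g \<Longrightarrow> pol (D + E) (\<lambda>a. f a * g a)"
proof (induction rule: pol.induct)
  case (const c D)
  then show ?case using pol_mono[OF pol_scale[OF const(2,1)]] by simp
next
  case (add D f h)
  then show ?case by (simp add: distrib_right pol.add)
next
  case (var D f i)
  have "(\<lambda>a. a i * f a * g a) = (\<lambda>a. a i * (f a * g a))" by (auto simp: mult_ac)
  then show ?case using var by (simp add: pol.var)
next
  case (agree D f h)
  show ?case by (rule pol.agree[OF agree.IH[OF agree.prems]]) (simp add: agree.hyps)
qed

lemma pol_coord: "pol (Suc D) (\<lambda>a. a i)"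
  using pol.var[OF pol.const[OF one_F]] by simp

lemma pol_sum: "(\<And>i. i \<in> I \<Longrightarrow> pol D (f i)) \<Longrightarrow> pol D (\<lambda>a. \<Sum>i\<in>I. f i a)"
  by (induction I rule: infinite_finite_induct) (auto intro: pol.intros)

lemma pol_subst:
  assumes "pol D f" and s: "\<And>i. pol 1 (\<lambda>a. s a i)"
  shows "pol D (\<lambda>a. f (s a))"
proof -
  have s_seqs: "s a \<in> seqs" if "a \<in> seqs" for a
    using pol_in_F[OF s that] by (simp add: seqs_def)
  show ?thesis using assms(1)
  proof (induction rule: pol.induct)
    case (var D f i)
    show ?case using pol_mult[OF s[of i] var.IH] by simp
  next
    case (agree D f g)
    show ?case by (rule pol.agree[OF agree.IH]) (simp add: agree.hyps s_seqs)
  qed (auto intro: pol.intros)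
qed

text \<open>A product of affine functions, one for each point of \<open>Q\<close>, taken in a
  coordinate where that point differs from \<open>p\<close>.\<close>

lemma pol_separate:
  assumes "finite Q" "Q \<subseteq> seqs" "p \<in> seqs" "p \<notin> Q"
  shows "\<exists>f. pol (card Q) f \<and> f p = 1 \<and> (\<forall>q\<in>Q. f q = 0)"
  using assms
proof (induction Q rule: finite_induct)
  case empty
  show ?case by (rule exI[of _ "\<lambda>_. 1"]) (auto intro: pol.const)
next
  case (insert q Q)
  then obtain f where f: "pol (card Q) f" "f p = 1" "\<forall>q\<in>Q. f q = 0" by auto
  from insert obtain i where i: "p i \<noteq> q i" by (auto simp: fun_eq_iff)
  define c where "c = inverse (p i + q i)"
  have ne: "p i + q i \<noteq> 0" using i by simp
  have F: "p i \<in> F" "q i \<in> F" using insert.prems by (auto simp: seqs_def)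
  have "pol 1 (\<lambda>a. c * (a i + q i))"
    unfolding c_def One_nat_def using F by (intro pol_scale pol.add pol_coord pol.const inverse_F add_F) auto
  from pol_mult[OF this f(1)] have "pol (card (insert q Q)) (\<lambda>a. c * (a i + q i) * f a)"
    using insert.hyps by simp
  then show ?case using f ne by (intro exI[of _ "\<lambda>a. c * (a i + q i) * f a"]) (auto simp: c_def char2)
qed

section \<open>Determining sets and bounds on Hilbert functions\<close>

definition determines :: "nat \<Rightarrow> (nat \<Rightarrow> 'a) set \<Rightarrow> (nat \<Rightarrow> 'a) set \<Rightarrow> bool" where
  "determines D P W \<longleftrightarrow> (\<forall>f. pol D f \<longrightarrow> (\<forall>a\<in>P. f a = 0) \<longrightarrow> (\<forall>a\<in>W. f a = 0))"

text \<open>The Hilbert function of \<open>W\<close> at \<open>D\<close> is the dimension of the space of restrictions to \<open>W\<close> of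
  polynomials of degree at most \<open>D\<close>; a set \<open>P\<close> of at most \<open>b\<close> determining points bounds it by \<open>b\<close>.\<close>

definition hilbert_le :: "nat \<Rightarrow> (nat \<Rightarrow> 'a) set \<Rightarrow> nat \<Rightarrow> bool" where
  "hilbert_le D W b \<longleftrightarrow> (\<exists>P \<subseteq> seqs. finite P \<and> card P \<le> b \<and> determines D P W)"

lemma hilbert_le_mono: "hilbert_le D W b \<Longrightarrow> W' \<subseteq> W \<Longrightarrow> b \<le> b' \<Longrightarrow> hilbert_le D W' b'"
  unfolding hilbert_le_def determines_def by (meson order_trans subsetD)

lemma hilbert_le_singleton: "a \<in> seqs \<Longrightarrow> hilbert_le D {a} 1"
  unfolding hilbert_le_def determines_def by (rule exI[of _ "{a}"]) auto

text \<open>Tensor argument: with the second argument fixed in \<open>P2\<close>, vanishing on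
  \<open>P1\<close> spreads to \<open>U1\<close>; with the first then fixed in \<open>U1\<close>,
  vanishing on \<open>P2\<close> spreads to \<open>U2\<close>. For this \<open>s\<close> has to be
  affine only in each argument separately.\<close>

lemma hilbert_le_prod:
  assumes U1: "hilbert_le D U1 b1" "U1 \<subseteq> seqs" and U2: "hilbert_le D U2 b2" "U2 \<subseteq> seqs"
    and s1: "\<And>u2 i. u2 \<in> seqs \<Longrightarrow> pol 1 (\<lambda>u1. s u1 u2 i)"
    and s2: "\<And>u1 i. u1 \<in> seqs \<Longrightarrow> pol 1 (\<lambda>u2. s u1 u2 i)"
    and W: "\<And>w. w \<in> W \<Longrightarrow> \<exists>u1\<in>U1. \<exists>u2\<in>U2. w = s u1 u2"
  shows "hilbert_le D W (b1 * b2)"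
proof -
  obtain P1 where P1: "P1 \<subseteq> seqs" "finite P1" "card P1 \<le> b1" "determines D P1 U1"
    using U1 unfolding hilbert_le_def by blast
  obtain P2 where P2: "P2 \<subseteq> seqs" "finite P2" "card P2 \<le> b2" "determines D P2 U2"
    using U2 unfolding hilbert_le_def by blast
  define P where "P = (\<lambda>(u1, u2). s u1 u2) ` (P1 \<times> P2)"
  have "P \<subseteq> seqs"
  proof -
    have "s u1 u2 i \<in> F" if "u1 \<in> P1" "u2 \<in> P2" for u1 u2 i
      using that pol_in_F[OF s1, of u2 u1] P1 P2 by blast
    then show ?thesis by (auto simp: P_def seqs_def)
  qed
  moreover have "finite P" using P1 P2 by (simp add: P_def)
  moreover have "card P \<le> b1 * b2"
  proof -
    have "card P \<le> card (P1 \<times> P2)" unfolding P_def using P1 P2 by (intro card_image_le) simp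
    also have "\<dots> \<le> b1 * b2" using P1 P2 by (simp add: card_cartesian_product mult_le_mono)
    finally show ?thesis .
  qed
  moreover have "determines D P W"
    unfolding determines_def
  proof (intro allI impI ballI)
    fix f w assume f: "pol D f" "\<forall>a\<in>P. f a = 0" and w: "w \<in> W"
    obtain u1 u2 where u: "u1 \<in> U1" "u2 \<in> U2" "w = s u1 u2" using W[OF w] by blast
    have "f (s u1 p2) = 0" if p2: "p2 \<in> P2" for p2
    proof -
      have "pol D (\<lambda>u1. f (s u1 p2))" by (intro pol_subst[OF f(1)] s1 subsetD[OF P2(1) p2])
      moreover have "\<forall>p1\<in>P1. f (s p1 p2) = 0" using f(2) p2 by (auto simp: P_def)
      ultimately show ?thesis using P1(4) u(1) unfolding determines_def by blast
    qed
    moreover have "pol D (\<lambda>u2. f (s u1 u2))" by (intro pol_subst[OF f(1)] s2 subsetD[OF U1(2) u(1)])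
    ultimately show "f w = 0" using P2(4) u unfolding determines_def by blast
  qed
  ultimately show ?thesis unfolding hilbert_le_def by blast
qed

lemma hilbert_le_line:
  assumes "D < card F"
  shows "hilbert_le D {\<lambda>_. c | c. c \<in> F} (D + 1)"
proof -
  obtain C where C: "C \<subseteq> F" "card C = D + 1"
    using assms by (metis Suc_eq_plus1 Suc_leI obtain_subset_with_card_n)
  have "finite C" using C finite_F finite_subset by blast
  have univ: "\<exists>p. degree p \<le> D \<and> (\<forall>c\<in>F. f (\<lambda>_. c) = poly p c)" if "pol D f" for D f
    using that
  proof (induction rule: pol.induct)
    case (const c D)
    show ?case by (rule exI[of _ "[:c:]"]) auto
  next
    case (add D f g)
    then obtain p q where "degree p \<le> D" "\<forall>c\<in>F. f (\<lambda>_. c) = poly p c"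
      "degree q \<le> D" "\<forall>c\<in>F. g (\<lambda>_. c) = poly q c" by blast
    then show ?case by (intro exI[of _ "p + q"]) (auto intro: degree_add_le)
  next
    case (var D f i)
    then obtain p where "degree p \<le> D" "\<forall>c\<in>F. f (\<lambda>_. c) = poly p c" by blast
    then show ?case by (intro exI[of _ "pCons 0 p"]) (auto simp: degree_pCons_eq_if)
  next
    case (agree D f g)
    then show ?case by (auto simp: seqs_def)
  qed
  have "determines D ((\<lambda>c _. c) ` C) {\<lambda>_. c | c. c \<in> F}"
    unfolding determines_def
  proof (intro allI impI ballI)
    fix f and a :: "nat \<Rightarrow> 'a"
    assume f: "pol D f" "\<forall>a\<in>(\<lambda>c _. c) ` C. f a = 0" and a: "a \<in> {\<lambda>_. c | c. c \<in> F}"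
    obtain p where p: "degree p \<le> D" "\<forall>c\<in>F. f (\<lambda>_. c) = poly p c" using univ[OF f(1)] by blast
    have "p = 0"
    proof (rule ccontr)
      assume "p \<noteq> 0"
      then have "card {x. poly p x = 0} \<le> degree p" by (rule card_poly_roots_bound)
      moreover have "C \<subseteq> {x. poly p x = 0}" using p f(2) C by force
      then have "card C \<le> card {x. poly p x = 0}"
        using \<open>p \<noteq> 0\<close> by (intro card_mono poly_roots_finite)
      ultimately show False using C p by simp
    qed
    then show "f a = 0" using p a by auto
  qed
  moreover have "(\<lambda>c _. c) ` C \<subseteq> seqs" using C by (auto simp: seqs_def)
  moreover have "card ((\<lambda>c _::nat. c) ` C) \<le> D + 1" using C card_image_le[OF \<open>finite C\<close>] by metis
  ultimately show ?thesis unfolding hilbert_le_def using \<open>finite C\<close> by blast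
qed

text \<open>The affine subspace is built one coordinate at a time as a product with a line, on which
  \<open>D + 1\<close> points determine; \<open>D < card F\<close> supplies these points. A factor
  \<open>D + 1\<close> per free coordinate is the model for dimension \<open>card I\<close>.\<close>

lemma hilbert_le_grid:
  assumes "D < card F" "b \<in> seqs" "finite I"
  shows "hilbert_le D {a \<in> seqs. \<forall>i. i \<notin> I \<longrightarrow> a i = b i} ((D + 1) ^ card I)"
  using assms(3)
proof (induction I rule: finite_induct)
  case empty
  have "{a \<in> seqs. \<forall>i. i \<notin> {} \<longrightarrow> a i = b i} = {b}" using assms by auto
  then show ?case using hilbert_le_singleton[OF assms(2)] by simp
next
  case (insert j I)
  have "hilbert_le D {a \<in> seqs. \<forall>i. i \<notin> insert j I \<longrightarrow> a i = b i} ((D + 1) ^ card I * (D + 1))"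
  proof (rule hilbert_le_prod[OF insert.IH _ hilbert_le_line[OF assms(1)]])
    show "{a \<in> seqs. \<forall>i. i \<notin> I \<longrightarrow> a i = b i} \<subseteq> seqs" by auto
    show "{\<lambda>_. c | c. c \<in> F} \<subseteq> seqs" by (auto simp: seqs_def)
    show "pol 1 (\<lambda>u1. (u1(j := u2 j)) i)" if "u2 \<in> seqs" for u2 :: "nat \<Rightarrow> 'a" and i
      using that pol_coord[of 0] by (cases "i = j") (auto simp: seqs_def intro: pol.const)
    show "pol 1 (\<lambda>u2. (u1(j := u2 j)) i)" if "u1 \<in> seqs" for u1 :: "nat \<Rightarrow> 'a" and i
      using that pol_coord[of 0] by (cases "i = j") (auto simp: seqs_def intro: pol.const)
    fix w assume w: "w \<in> {a \<in> seqs. \<forall>i. i \<notin> insert j I \<longrightarrow> a i = b i}"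
    have "w(j := b j) \<in> {a \<in> seqs. \<forall>i. i \<notin> I \<longrightarrow> a i = b i}"
      using w assms by (auto simp: seqs_def)
    moreover have "(\<lambda>_. w j) \<in> {\<lambda>_. c | c. c \<in> F}" using w by (auto simp: seqs_def)
    moreover have "w = (w(j := b j))(j := (\<lambda>_. w j) j)" by simp
    ultimately show "\<exists>u1\<in>{a \<in> seqs. \<forall>i. i \<notin> I \<longrightarrow> a i = b i}. \<exists>u2\<in>{\<lambda>_. c | c. c \<in> F}. w = u1(j := u2 j)"
      by (intro bexI[of _ "w(j := b j)"] bexI[of _ "\<lambda>_. w j"])
  qed
  then show ?case using insert.hyps by (simp add: mult.commute)
qed

section \<open>Dimension through counting\<close>

definition res :: "nat \<Rightarrow> (nat \<Rightarrow> 'a) set \<Rightarrow> ((nat \<Rightarrow> 'a) \<Rightarrow> 'a) set" where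
  "res D W = (\<lambda>f. restrict f W) ` {f. pol D f}"

lemma res_subset: "W \<subseteq> seqs \<Longrightarrow> res D W \<subseteq> W \<rightarrow>\<^sub>E F"
  by (auto simp: res_def pol_in_F subsetD)

lemma finite_res: "finite W \<Longrightarrow> W \<subseteq> seqs \<Longrightarrow> finite (res D W)"
  by (rule finite_subset[OF res_subset]) (auto intro: finite_PiE finite_F)

lemma res_nonempty: "res D W \<noteq> {}"
  using pol.const[OF zero_F] by (auto simp: res_def)

lemma card_res_pos: "finite W \<Longrightarrow> W \<subseteq> seqs \<Longrightarrow> card (res D W) > 0"
  using finite_res res_nonempty by (simp add: card_gt_0_iff)

lemma card_res_mono_degree: "finite W \<Longrightarrow> W \<subseteq> seqs \<Longrightarrow> D \<le> E \<Longrightarrow> card (res D W) \<le> card (res E W)"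
  by (intro card_mono finite_res) (auto simp: res_def intro: pol_mono)

text \<open>Values on a determining set fix the restriction to \<open>W\<close>. As
  \<open>res D W\<close> is a vector space over \<open>F\<close>, powers of \<open>card F\<close>
  stand for dimensions throughout, and counting injections replaces linear algebra;
  \<open>hilbert_le_of_card_res\<close> translates back.\<close>

lemma card_res_le:
  assumes "hilbert_le D W b" "finite W" "W \<subseteq> seqs"
  shows "card (res D W) \<le> card F ^ b"
proof -
  obtain P where P: "P \<subseteq> seqs" "finite P" "card P \<le> b" "determines D P W"
    using assms unfolding hilbert_le_def by blast
  define l where "l h = (SOME f. pol D f \<and> h = restrict f W)" for h
  have l: "pol D (l h)" "h = restrict (l h) W" if "h \<in> res D W" for h
    using someI_ex[of "\<lambda>f. pol D f \<and> h = restrict f W"] that unfolding l_def res_def by auto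
  have "inj_on (\<lambda>h. restrict (l h) P) (res D W)"
  proof (rule inj_onI)
    fix h h' assume h: "h \<in> res D W" "h' \<in> res D W" "restrict (l h) P = restrict (l h') P"
    have "\<forall>a\<in>P. l h a + l h' a = 0" using h(3) by (metis add_eq_0 restrict_apply')
    moreover have "pol D (\<lambda>a. l h a + l h' a)" using l h by (intro pol.add) auto
    ultimately have "\<forall>a\<in>W. l h a + l h' a = 0" using P(4) unfolding determines_def by blast
    then have "restrict (l h) W = restrict (l h') W" by (intro restrict_ext) auto
    then show "h = h'"
      by (rule box_equals[OF _ l(2)[OF h(1), symmetric] l(2)[OF h(2), symmetric]])
  qed
  moreover have "(\<lambda>h. restrict (l h) P) ` res D W \<subseteq> P \<rightarrow>\<^sub>E F"
    using pol_in_F[OF l(1)] subsetD[OF P(1)] by auto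
  ultimately have "card (res D W) \<le> card (P \<rightarrow>\<^sub>E F)"
    using P finite_F by (intro card_inj_on_le) (auto intro: finite_PiE)
  also have "\<dots> = card F ^ card P" using P by (simp add: card_funcsetE)
  also have "\<dots> \<le> card F ^ b" using P card_F_ge_2 by (intro power_increasing) auto
  finally show ?thesis .
qed

definition interpolates :: "nat \<Rightarrow> (nat \<Rightarrow> 'a) set \<Rightarrow> bool" where
  "interpolates D P \<longleftrightarrow> (\<forall>t. (\<forall>p\<in>P. t p \<in> F) \<longrightarrow> (\<exists>f. pol D f \<and> (\<forall>p\<in>P. f p = t p)))"

lemma card_res_ge:
  assumes "interpolates D P" "P \<subseteq> W" "finite W" "W \<subseteq> seqs"
  shows "card F ^ card P \<le> card (res D W)"
proof -
  have "finite P" using assms finite_subset by blast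
  have "P \<rightarrow>\<^sub>E F \<subseteq> (\<lambda>h. restrict h P) ` res D W"
  proof
    fix t assume t: "t \<in> P \<rightarrow>\<^sub>E F"
    then obtain f where f: "pol D f" "\<forall>p\<in>P. f p = t p" using assms(1) unfolding interpolates_def by blast
    have "t = restrict (restrict f W) P"
    proof (rule ext)
      fix x show "t x = restrict (restrict f W) P x"
        using f(2) PiE_arb[OF t] subsetD[OF assms(2)] by (cases "x \<in> P") auto
    qed
    moreover have "restrict f W \<in> res D W" using f by (auto simp: res_def)
    ultimately show "t \<in> (\<lambda>h. restrict h P) ` res D W" by (rule image_eqI)
  qed
  then have "card (P \<rightarrow>\<^sub>E F) \<le> card (res D W)"
    using assms finite_res by (intro surj_card_le) auto
  then show ?thesis using \<open>finite P\<close> by (simp add: card_funcsetE)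
qed

text \<open>A maximal interpolating subset \<open>P\<close> of \<open>W\<close> plays the part of a
  basis. Counting bounds its size by \<open>b\<close>; and if some \<open>f\<close> vanished on
  \<open>P\<close> but not at \<open>w \<in> W\<close>, corrections by multiples of \<open>f\<close>
  would make \<open>insert w P\<close> interpolating.\<close>

lemma hilbert_le_of_card_res:
  assumes "card (res D W) \<le> card F ^ b" "finite W" "W \<subseteq> seqs"
  shows "hilbert_le D W b"
proof -
  define S where "S = {P. P \<subseteq> W \<and> interpolates D P}"
  have "finite S" unfolding S_def using assms by simp
  have "{} \<in> S" using pol.const[OF zero_F] by (auto simp: S_def interpolates_def)
  obtain P where P: "P \<in> S" "\<forall>Q\<in>S. P \<subseteq> Q \<longrightarrow> Q = P"
    using finite_has_maximal[OF \<open>finite S\<close>] \<open>{} \<in> S\<close> by (metis empty_iff)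
  have fP: "finite P" using P assms finite_subset by (auto simp: S_def)
  have "card F ^ card P \<le> card F ^ b"
    using card_res_ge[of D P W] P assms by (auto simp: S_def)
  then have "card P \<le> b" using card_F_ge_2 by (simp add: power_le_imp_le_exp)
  moreover have "determines D P W"
    unfolding determines_def
  proof (intro allI impI ballI, rule ccontr)
    fix f w assume f: "pol D f" "\<forall>a\<in>P. f a = 0" and w: "w \<in> W" "f w \<noteq> 0"
    have "interpolates D (insert w P)"
      unfolding interpolates_def
    proof (intro allI impI)
      fix t assume t: "\<forall>p\<in>insert w P. t p \<in> F"
      then obtain g where g: "pol D g" "\<forall>p\<in>P. g p = t p"
        using P by (auto simp: S_def interpolates_def)
      define c where "c = (t w + g w) * inverse (f w)"
      have "w \<in> seqs" using w assms by blast
      then have "c \<in> F" unfolding c_def using t pol_in_F[OF f(1)] pol_in_F[OF g(1)] by simp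
      then have "pol D (\<lambda>a. g a + c * f a)" using f g by (intro pol.add pol_scale)
      moreover have "c * f w = g w + t w" using w by (simp add: c_def add.commute)
      then have "\<forall>p\<in>insert w P. g p + c * f p = t p"
        using f g by auto
      ultimately show "\<exists>f. pol D f \<and> (\<forall>p\<in>insert w P. f p = t p)" by blast
    qed
    then have "insert w P \<in> S" using P w by (auto simp: S_def)
    then have "w \<in> P" using P by blast
    then show False using f w by blast
  qed
  ultimately show ?thesis unfolding hilbert_le_def using fP P assms by (auto simp: S_def)
qed

text \<open>Lagrange interpolation with the separating products as basis functions.\<close>

lemma interpolates_few_points:
  assumes "finite P" "P \<subseteq> seqs" "card P \<le> D + 1"
  shows "interpolates D P"
  unfolding interpolates_def
proof (intro allI impI)
  fix t :: "_ \<Rightarrow> 'a" assume t: "\<forall>p\<in>P. t p \<in> F"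
  have "\<exists>f. pol D f \<and> f p = 1 \<and> (\<forall>q\<in>P - {p}. f q = 0)" if p: "p \<in> P" for p
  proof -
    obtain f where f: "pol (card (P - {p})) f" "f p = 1" "\<forall>q\<in>P - {p}. f q = 0"
      using pol_separate[of "P - {p}" p] p assms(1) assms(2) by blast
    have "card (P - {p}) \<le> D" using p assms by (simp add: card_Diff_singleton)
    with f show ?thesis using pol_mono by blast
  qed
  then obtain f where f: "\<And>p. p \<in> P \<Longrightarrow> pol D (f p) \<and> f p p = 1 \<and> (\<forall>q\<in>P - {p}. f p q = 0)"
    by metis
  have "pol D (\<lambda>a. \<Sum>p\<in>P. t p * f p a)" using f t by (intro pol_sum pol_scale) auto
  moreover have "(\<Sum>p\<in>P. t p * f p q) = t q" if q: "q \<in> P" for q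
  proof -
    have "(\<Sum>p\<in>P. t p * f p q) = (\<Sum>p\<in>P. if p = q then t q else 0)"
      using f q by (intro sum.cong) auto
    then show ?thesis using q assms by simp
  qed
  ultimately show "\<exists>f. pol D f \<and> (\<forall>p\<in>P. f p = t p)" by blast
qed

text \<open>Any \<open>b + 1\<close> points impose independent conditions on polynomials of degree
  at most \<open>D \<ge> b\<close>, so \<open>W\<close> cannot contain that many. This is how
  dimension zero becomes a bound on cardinality.\<close>

lemma card_le_of_hilbert_le:
  assumes "hilbert_le D W b" "W \<subseteq> seqs" "b \<le> D"
  shows "finite W \<and> card W \<le> b"
proof (rule ccontr)
  assume "\<not> (finite W \<and> card W \<le> b)"
  then obtain Q where Q: "Q \<subseteq> W" "card Q = b + 1" "finite Q"
    by (metis Suc_eq_plus1 Suc_leI infinite_arbitrarily_large linorder_not_le obtain_subset_with_card_n)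
  have "interpolates D Q" using Q assms by (intro interpolates_few_points) auto
  then have "card F ^ (b + 1) \<le> card (res D Q)" using Q assms card_res_ge[of D Q Q] by auto
  also have "\<dots> \<le> card F ^ b" using Q assms by (intro card_res_le) (auto intro: hilbert_le_mono)
  finally have "b + 1 \<le> b" using card_F_ge_2 by (metis One_nat_def Suc_1 Suc_le_lessD power_le_imp_le_exp)
  then show False by simp
qed

section \<open>Irreducibility up to a degree, hypersurface sections, decomposition\<close>

definition irred :: "nat \<Rightarrow> (nat \<Rightarrow> 'a) set \<Rightarrow> bool" where
  "irred \<Delta> W \<longleftrightarrow> (\<forall>f g. pol \<Delta> f \<longrightarrow> pol \<Delta> g \<longrightarrow> (\<forall>a\<in>W. f a * g a = 0) \<longrightarrow>
     (\<forall>a\<in>W. f a = 0) \<or> (\<forall>a\<in>W. g a = 0))"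

lemma irred_mono: "irred \<Delta> W \<Longrightarrow> \<Delta>' \<le> \<Delta> \<Longrightarrow> irred \<Delta>' W"
  unfolding irred_def by (meson pol_mono)

text \<open>A function on the section lifts to \<open>W\<close>, and the lift may be changed by
  \<open>g\<close> times a polynomial of degree at most \<open>D\<close>. All results differ on
  \<open>W\<close>, because irreducibility allows \<open>g\<close> to be cancelled. In exponents:
  the Hilbert function of \<open>W\<close> at \<open>D + e\<close> is at least that of the section
  at \<open>D + e\<close> plus that of \<open>W\<close> at \<open>D\<close>.\<close>

lemma card_res_hyperplane:
  assumes W: "finite W" "W \<subseteq> seqs" and g: "pol e g" "a0 \<in> W" "g a0 \<noteq> 0"
    and irr: "irred (D + e) W"
  shows "card (res (D + e) {a\<in>W. g a = 0}) * card (res D W) \<le> card (res (D + e) W)"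
proof -
  let ?W = "{a\<in>W. g a = 0}"
  define l where "l h = (SOME f. pol (D + e) f \<and> h = restrict f ?W)" for h
  have l: "pol (D + e) (l h)" "h = restrict (l h) ?W" if "h \<in> res (D + e) ?W" for h
    using someI_ex[of "\<lambda>f. pol (D + e) f \<and> h = restrict f ?W"] that unfolding l_def res_def by auto
  define m where "m h = (SOME f. pol D f \<and> h = restrict f W)" for h
  have m: "pol D (m h)" "h = restrict (m h) W" if "h \<in> res D W" for h
    using someI_ex[of "\<lambda>f. pol D f \<and> h = restrict f W"] that unfolding m_def res_def by auto
  define \<Phi> where "\<Phi> = (\<lambda>(\<psi>, \<phi>). restrict (\<lambda>a. l \<psi> a + g a * m \<phi> a) W)"
  have "inj_on \<Phi> (res (D + e) ?W \<times> res D W)"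
  proof (rule inj_onI, clarify)
    fix \<psi> \<phi> \<psi>' \<phi>'
    assume h: "\<psi> \<in> res (D + e) ?W" "\<phi> \<in> res D W" "\<psi>' \<in> res (D + e) ?W" "\<phi>' \<in> res D W"
      and eq: "\<Phi> (\<psi>, \<phi>) = \<Phi> (\<psi>', \<phi>')"
    have eq': "l \<psi> a + g a * m \<phi> a = l \<psi>' a + g a * m \<phi>' a" if "a \<in> W" for a
      using fun_cong[OF eq, of a] that by (simp add: \<Phi>_def)
    have "restrict (l \<psi>) ?W = restrict (l \<psi>') ?W"
    proof (rule restrict_ext)
      fix a assume "a \<in> ?W"
      then show "l \<psi> a = l \<psi>' a" using eq'[of a] by simp
    qed
    then have psi: "\<psi> = \<psi>'"
      by (rule box_equals[OF _ l(2)[OF h(1), symmetric] l(2)[OF h(3), symmetric]])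
    then have "g a * (m \<phi> a + m \<phi>' a) = 0" if "a \<in> W" for a
      using eq'[OF that] by (simp add: distrib_left)
    moreover have "pol (D + e) (\<lambda>a. m \<phi> a + m \<phi>' a)"
      using m h by (intro pol_mono[OF pol.add]) auto
    moreover have "pol (D + e) g" by (rule pol_mono[OF g(1)]) simp
    ultimately have "(\<forall>a\<in>W. g a = 0) \<or> (\<forall>a\<in>W. m \<phi> a + m \<phi>' a = 0)"
      using irr unfolding irred_def by blast
    then have "\<forall>a\<in>W. m \<phi> a = m \<phi>' a" using g by auto
    then have "restrict (m \<phi>) W = restrict (m \<phi>') W" by (intro restrict_ext) auto
    then have "\<phi> = \<phi>'"
      by (rule box_equals[OF _ m(2)[OF h(2), symmetric] m(2)[OF h(4), symmetric]])
    with psi show "\<psi> = \<psi>' \<and> \<phi> = \<phi>'" by simp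
  qed
  moreover have "\<Phi> ` (res (D + e) ?W \<times> res D W) \<subseteq> res (D + e) W"
  proof clarify
    fix \<psi> \<phi> assume h: "\<psi> \<in> res (D + e) ?W" "\<phi> \<in> res D W"
    have "pol (D + e) (\<lambda>a. l \<psi> a + g a * m \<phi> a)"
      using l h g m pol_mult[OF g(1) m(1)[OF h(2)]] by (intro pol.add) (auto simp: add.commute)
    then show "\<Phi> (\<psi>, \<phi>) \<in> res (D + e) W" by (auto simp: \<Phi>_def res_def)
  qed
  ultimately have "card (res (D + e) ?W \<times> res D W) \<le> card (res (D + e) W)"
    using finite_res[OF W] by (intro card_inj_on_le)
  then show ?thesis by (simp add: card_cartesian_product)
qed

text \<open>Each of the \<open>n\<close> increments of the degree by \<open>e\<close> contributes
  another copy of the section, whose Hilbert function does not decrease with the degree.\<close>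

lemma card_res_hyperplane_power:
  assumes W: "finite W" "W \<subseteq> seqs" and g: "pol e g" "a0 \<in> W" "g a0 \<noteq> 0"
    and irr: "irred (D + n * e) W"
  shows "card (res D {a\<in>W. g a = 0}) ^ n \<le> card (res (D + n * e) W)"
  using irr
proof (induction n)
  case 0
  then show ?case using card_res_pos[OF W] by (simp add: Suc_le_eq)
next
  case (Suc n)
  let ?W = "{a\<in>W. g a = 0}"
  have "card (res D ?W) ^ Suc n \<le> card (res (D + Suc n * e) ?W) * card (res (D + n * e) W)"
  proof (simp, rule mult_le_mono)
    show "card (res D ?W) \<le> card (res (D + (e + n * e)) ?W)"
      using W by (intro card_res_mono_degree) auto
    show "card (res D ?W) ^ n \<le> card (res (D + n * e) W)"
      by (rule Suc.IH[OF irred_mono[OF Suc.prems]]) simp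
  qed
  also have "\<dots> \<le> card (res (D + Suc n * e) W)"
    using card_res_hyperplane[OF W g, of "D + n * e"] Suc.prems by (simp add: algebra_simps)
  finally show ?case .
qed

text \<open>Growth of order \<open>d\<close> of the Hilbert function. Every finite set has a bounded
  Hilbert function, so the notion has content only because \<open>C\<close> and
  \<open>\<Delta>\<close> are chosen independently of \<open>card F\<close>.\<close>

definition dim_le :: "nat \<Rightarrow> nat \<Rightarrow> nat \<Rightarrow> (nat \<Rightarrow> 'a) set \<Rightarrow> bool" where
  "dim_le C \<Delta> d W \<longleftrightarrow> W \<subseteq> seqs \<and> (\<forall>D\<le>\<Delta>. hilbert_le D W (C * (D + 1) ^ d))"

lemma dim_le_mono:
  assumes "dim_le C \<Delta> d W" "W' \<subseteq> W" "C \<le> C'" "\<Delta>' \<le> \<Delta>" "d \<le> d'"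
  shows "dim_le C' \<Delta>' d' W'"
proof -
  have "hilbert_le D W' (C' * (D + 1) ^ d')" if "D \<le> \<Delta>'" for D
  proof (rule hilbert_le_mono)
    show "hilbert_le D W (C * (D + 1) ^ d)" using assms that by (simp add: dim_le_def)
    show "C * (D + 1) ^ d \<le> C' * (D + 1) ^ d'"
      using assms by (intro mult_le_mono power_increasing) auto
  qed (rule assms)
  then show ?thesis using assms by (auto simp: dim_le_def)
qed

text \<open>On a \<open>\<Delta>\<close>-irreducible set, multiplication by \<open>g\<close> is injective on polynomials of small degree,
  so cutting with \<open>g = 0\<close> lowers the dimension by one.\<close>

lemma dim_le_hyperplane:
  assumes W: "finite W" and dim: "dim_le C \<Delta> (Suc d) W" and irr: "irred \<Delta> W"
    and g: "pol e g" "a0 \<in> W" "g a0 \<noteq> 0" and \<Delta>: "\<Delta>' + (\<Delta>' + 1) * e \<le> \<Delta>"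
  shows "dim_le (C * (e + 1) ^ Suc d) \<Delta>' d {a\<in>W. g a = 0}"
proof -
  have Ws: "W \<subseteq> seqs" using dim by (simp add: dim_le_def)
  have "hilbert_le D {a\<in>W. g a = 0} (C * (e + 1) ^ Suc d * (D + 1) ^ d)" if D: "D \<le> \<Delta>'" for D
  proof (rule hilbert_le_of_card_res)
    \<comment> \<open>With \<open>D + 1\<close> copies of the section, \<open>?E + 1\<close> factors
      as \<open>(D + 1) * (e + 1)\<close>. Taking the root of order \<open>D + 1\<close> at the end
      removes one power of \<open>D + 1\<close>, which is the drop in dimension.\<close>
    let ?E = "D + (D + 1) * e" and ?N = "card (res D {a\<in>W. g a = 0})"
    have "(D + 1) * e \<le> (\<Delta>' + 1) * e" using D by (intro mult_le_mono1) simp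
    with D \<Delta> have E: "?E \<le> \<Delta>" by linarith
    have "?N ^ (D + 1) \<le> card (res ?E W)"
      using card_res_hyperplane_power[OF W Ws g, of D "D + 1"] irr E by (blast intro: irred_mono)
    also have "\<dots> \<le> card F ^ (C * (?E + 1) ^ Suc d)"
      using dim E Ws W by (intro card_res_le) (auto simp: dim_le_def)
    also have "?E + 1 = (D + 1) * (e + 1)" by simp
    also have "C * ((D + 1) * (e + 1)) ^ Suc d = (C * (e + 1) ^ Suc d * (D + 1) ^ d) * (D + 1)"
      by (simp only: power_mult_distrib power_Suc mult_ac)
    finally have "?N ^ (D + 1) \<le> (card F ^ (C * (e + 1) ^ Suc d * (D + 1) ^ d)) ^ (D + 1)"
      by (simp only: power_mult)
    then show "?N \<le> card F ^ (C * (e + 1) ^ Suc d * (D + 1) ^ d)"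
      by (simp only: power_mono_iff[of _ _ "D + 1"] zero_le)
  qed (use W Ws in auto)
  then show ?thesis using Ws by (auto simp: dim_le_def)
qed

text \<open>The \<open>card F\<close> multiples of \<open>f\<close> vanish on the section and differ
  at \<open>a0\<close>, so every lift from the section can be shifted in \<open>card F\<close> ways:
  a proper section loses at least one dimension.\<close>

lemma card_res_proper:
  assumes W: "finite W" "W \<subseteq> seqs" and f: "pol D f" "a0 \<in> W" "f a0 \<noteq> 0"
  shows "card (res D {a\<in>W. f a = 0}) * card F \<le> card (res D W)"
proof -
  let ?W = "{a\<in>W. f a = 0}"
  define l where "l h = (SOME f. pol D f \<and> h = restrict f ?W)" for h
  have l: "pol D (l h)" "h = restrict (l h) ?W" if "h \<in> res D ?W" for h
    using someI_ex[of "\<lambda>f. pol D f \<and> h = restrict f ?W"] that unfolding l_def res_def by auto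
  define \<Phi> where "\<Phi> = (\<lambda>(\<psi>, c). restrict (\<lambda>a. l \<psi> a + c * f a) W)"
  have "inj_on \<Phi> (res D ?W \<times> F)"
  proof (rule inj_onI, clarify)
    fix \<psi> c \<psi>' c'
    assume h: "\<psi> \<in> res D ?W" "\<psi>' \<in> res D ?W" and eq: "\<Phi> (\<psi>, c) = \<Phi> (\<psi>', c')"
    have eq': "l \<psi> a + c * f a = l \<psi>' a + c' * f a" if "a \<in> W" for a
      using fun_cong[OF eq, of a] that by (simp add: \<Phi>_def)
    have "restrict (l \<psi>) ?W = restrict (l \<psi>') ?W"
    proof (rule restrict_ext)
      fix a assume "a \<in> ?W"
      then show "l \<psi> a = l \<psi>' a" using eq'[of a] by simp
    qed
    then have psi: "\<psi> = \<psi>'"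
      by (rule box_equals[OF _ l(2)[OF h(1), symmetric] l(2)[OF h(2), symmetric]])
    with eq'[OF f(2)] f(3) show "\<psi> = \<psi>' \<and> c = c'" by simp
  qed
  moreover have "\<Phi> ` (res D ?W \<times> F) \<subseteq> res D W"
  proof clarify
    fix \<psi> c assume h: "\<psi> \<in> res D ?W" "c \<in> F"
    have "pol D (\<lambda>a. l \<psi> a + c * f a)" using l h f by (intro pol.add pol_scale)
    then show "\<Phi> (\<psi>, c) \<in> res D W" by (auto simp: \<Phi>_def res_def)
  qed
  ultimately have "card (res D ?W \<times> F) \<le> card (res D W)"
    using finite_res[OF W] by (intro card_inj_on_le)
  then show ?thesis by (simp add: card_cartesian_product)
qed

text \<open>A reducible set is the union of two proper sections, each of which loses a dimension by
  \<open>card_res_proper\<close>; so the binary tree of splittings has depth at most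
  \<open>b\<close>. At \<open>b = 0\<close> every polynomial of degree at most
  \<open>\<Delta>\<close> vanishes on the set.\<close>

lemma irred_decomposition:
  assumes "finite W" "W \<subseteq> seqs" "card (res \<Delta> W) \<le> card F ^ b"
  shows "\<exists>\<U>. finite \<U> \<and> card \<U> \<le> 2 ^ b \<and> \<Union>\<U> = W \<and> (\<forall>U\<in>\<U>. irred \<Delta> U)"
  using assms
proof (induction b arbitrary: W)
  case 0
  have "irred \<Delta> W"
    unfolding irred_def
  proof (intro allI impI, rule ccontr)
    fix f g assume "pol \<Delta> f" "\<not> ((\<forall>a\<in>W. f a = 0) \<or> (\<forall>a\<in>W. g a = 0))"
    then obtain a where "a \<in> W" "f a \<noteq> 0" by blast
    from card_res_proper[OF 0(1,2) \<open>pol \<Delta> f\<close> this]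
    have "card (res \<Delta> {a \<in> W. f a = 0}) * card F \<le> 1" using 0 by simp
    moreover have "card (res \<Delta> {a \<in> W. f a = 0}) > 0" using 0 by (intro card_res_pos) auto
    moreover have "card (res \<Delta> {a \<in> W. f a = 0}) * 2 \<le> card (res \<Delta> {a \<in> W. f a = 0}) * card F"
      using card_F_ge_2 by simp
    ultimately show False by linarith
  qed
  then show ?case by (intro exI[of _ "{W}"]) auto
next
  case (Suc b)
  show ?case
  proof (cases "irred \<Delta> W")
    case True
    then show ?thesis by (intro exI[of _ "{W}"]) auto
  next
    case False
    then obtain f g where fg: "pol \<Delta> f" "pol \<Delta> g" "\<forall>a\<in>W. f a * g a = 0"
      "\<not> (\<forall>a\<in>W. f a = 0)" "\<not> (\<forall>a\<in>W. g a = 0)" unfolding irred_def by blast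
    have *: "\<exists>\<U>. finite \<U> \<and> card \<U> \<le> 2 ^ b \<and> \<Union>\<U> = {a\<in>W. h a = 0} \<and> (\<forall>U\<in>\<U>. irred \<Delta> U)"
      if h: "pol \<Delta> h" "\<not> (\<forall>a\<in>W. h a = 0)" for h
    proof (rule Suc.IH)
      from h(2) obtain a where "a \<in> W" "h a \<noteq> 0" by blast
      from order_trans[OF card_res_proper[OF Suc.prems(1,2) h(1) this] Suc.prems(3)]
      have "card (res \<Delta> {a \<in> W. h a = 0}) * card F \<le> card F ^ b * card F"
        by (simp add: mult.commute)
      then show "card (res \<Delta> {a \<in> W. h a = 0}) \<le> card F ^ b" using card_F_ge_2 by simp
    qed (use Suc.prems in auto)
    obtain \<U>1 where U1: "finite \<U>1" "card \<U>1 \<le> 2 ^ b" "\<Union>\<U>1 = {a\<in>W. f a = 0}" "\<forall>U\<in>\<U>1. irred \<Delta> U"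
      using *[OF fg(1,4)] by blast
    obtain \<U>2 where U2: "finite \<U>2" "card \<U>2 \<le> 2 ^ b" "\<Union>\<U>2 = {a\<in>W. g a = 0}" "\<forall>U\<in>\<U>2. irred \<Delta> U"
      using *[OF fg(2,5)] by blast
    have "\<Union>(\<U>1 \<union> \<U>2) = W"
      unfolding Union_Un_distrib U1(3) U2(3) using fg(3) by auto
    moreover have "card (\<U>1 \<union> \<U>2) \<le> 2 ^ Suc b"
      using card_Un_le[of \<U>1 \<U>2] U1 U2 by simp
    ultimately show ?thesis using U1 U2 by (intro exI[of _ "\<U>1 \<union> \<U>2"]) auto
  qed
qed

section \<open>Covers by boundedly many sets of bounded dimension\<close>

definition covered :: "nat \<Rightarrow> nat \<Rightarrow> nat \<Rightarrow> nat \<Rightarrow> (nat \<Rightarrow> 'a) set \<Rightarrow> bool" where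
  "covered R C \<Delta> d S \<longleftrightarrow>
     (\<exists>\<W>. finite \<W> \<and> card \<W> \<le> R \<and> S \<subseteq> \<Union>\<W> \<and> (\<forall>W\<in>\<W>. dim_le C \<Delta> d W))"

lemma covered_mono:
  assumes "covered R C \<Delta> d S" "S' \<subseteq> S" "R \<le> R'" "C \<le> C'" "\<Delta>' \<le> \<Delta>" "d \<le> d'"
  shows "covered R' C' \<Delta>' d' S'"
proof -
  obtain \<W> where W: "finite \<W>" "card \<W> \<le> R" "S \<subseteq> \<Union>\<W>" "\<forall>W\<in>\<W>. dim_le C \<Delta> d W"
    using assms(1) unfolding covered_def by blast
  have "\<forall>W\<in>\<W>. dim_le C' \<Delta>' d' W" using W(4) dim_le_mono assms(4-6) by blast
  then show ?thesis unfolding covered_def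
    by (intro exI[of _ \<W>]) (use W assms in auto)
qed

lemma covered_UN:
  assumes "finite I" "card I \<le> m" "\<And>i. i \<in> I \<Longrightarrow> covered R C \<Delta> d (S i)"
  shows "covered (m * R) C \<Delta> d (\<Union>i\<in>I. S i)"
proof -
  have "\<forall>i\<in>I. \<exists>\<W>. finite \<W> \<and> card \<W> \<le> R \<and> S i \<subseteq> \<Union>\<W> \<and> (\<forall>W\<in>\<W>. dim_le C \<Delta> d W)"
    using assms(3) unfolding covered_def by blast
  then obtain w where w: "\<And>i. i \<in> I \<Longrightarrow> finite (w i) \<and> card (w i) \<le> R \<and> S i \<subseteq> \<Union>(w i) \<and>
      (\<forall>W\<in>w i. dim_le C \<Delta> d W)" by metis
  have "card (\<Union>i\<in>I. w i) \<le> (\<Sum>i\<in>I. card (w i))" using assms(1) by (rule card_UN_le)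
  also have "\<dots> \<le> card I * R" using sum_bounded_above[of I "\<lambda>i. card (w i)" R] w by simp
  also have "\<dots> \<le> m * R" using assms(2) by simp
  finally have "card (\<Union>i\<in>I. w i) \<le> m * R" .
  moreover have "(\<Union>i\<in>I. S i) \<subseteq> \<Union>(\<Union>i\<in>I. w i)" using w by fastforce
  moreover have "finite (\<Union>i\<in>I. w i)" "\<forall>W\<in>(\<Union>i\<in>I. w i). dim_le C \<Delta> d W" using w assms(1) by auto
  ultimately show ?thesis unfolding covered_def by blast
qed

lemma covered_Un:
  assumes "covered R C \<Delta> d S" "covered R' C \<Delta> d S'"
  shows "covered (R + R') C \<Delta> d (S \<union> S')"
proof -
  obtain \<W> where W: "finite \<W>" "card \<W> \<le> R" "S \<subseteq> \<Union>\<W>" "\<forall>W\<in>\<W>. dim_le C \<Delta> d W"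
    using assms(1) unfolding covered_def by blast
  obtain \<W>' where W': "finite \<W>'" "card \<W>' \<le> R'" "S' \<subseteq> \<Union>\<W>'" "\<forall>W\<in>\<W>'. dim_le C \<Delta> d W"
    using assms(2) unfolding covered_def by blast
  have "card (\<W> \<union> \<W>') \<le> R + R'" using card_Un_le[of \<W> \<W>'] W W' by linarith
  then show ?thesis unfolding covered_def
    by (intro exI[of _ "\<W> \<union> \<W>'"]) (use W W' in auto)
qed

text \<open>At degree \<open>C\<close> a piece of dimension zero has Hilbert function at most
  \<open>C\<close>, hence at most \<open>C\<close> points; this is why the range of degrees must
  reach \<open>C\<close>.\<close>

lemma covered_finite:
  assumes "covered R C \<Delta> 0 S" "C \<le> \<Delta>"
  shows "finite S" "card S \<le> R * C"
proof -
  obtain \<W> where W: "finite \<W>" "card \<W> \<le> R" "S \<subseteq> \<Union>\<W>" "\<forall>W\<in>\<W>. dim_le C \<Delta> 0 W"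
    using assms(1) unfolding covered_def by blast
  have WC: "finite W \<and> card W \<le> C" if "W \<in> \<W>" for W
    using W(4) that assms(2) by (intro card_le_of_hilbert_le[of C]) (auto simp: dim_le_def)
  then have fin: "finite (\<Union>\<W>)" using W by blast
  then show "finite S" using W finite_subset by blast
  have "card S \<le> card (\<Union>\<W>)" using W fin by (intro card_mono)
  also have "\<dots> \<le> (\<Sum>W\<in>\<W>. card W)" using card_Union_le_sum_card .
  also have "\<dots> \<le> card \<W> * C" using sum_bounded_above[of \<W> card C] WC by simp
  also have "\<dots> \<le> R * C" using W by simp
  finally show "card S \<le> R * C" .
qed

text \<open>Each covering set is multiplied by the grid with free coordinates in \<open>I\<close>.
  In the applications these coordinates are the colours of a walk on which no constraint is
  used.\<close>

lemma covered_prod: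
  assumes S1: "covered R C \<Delta> d S1" and \<Delta>: "\<Delta> < card F"
    and I: "finite I" and b: "b \<in> seqs"
    and s1: "\<And>u2 i. u2 \<in> seqs \<Longrightarrow> pol 1 (\<lambda>u1. s u1 u2 i)"
    and s2: "\<And>u1 i. u1 \<in> seqs \<Longrightarrow> pol 1 (\<lambda>u2. s u1 u2 i)"
    and S: "\<And>w. w \<in> S \<Longrightarrow> \<exists>u1\<in>S1. \<exists>u2\<in>seqs. (\<forall>i. i \<notin> I \<longrightarrow> u2 i = b i) \<and> w = s u1 u2"
  shows "covered R C \<Delta> (d + card I) S"
proof -
  obtain \<W> where W: "finite \<W>" "card \<W> \<le> R" "S1 \<subseteq> \<Union>\<W>" "\<forall>W\<in>\<W>. dim_le C \<Delta> d W"
    using S1 unfolding covered_def by blast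
  let ?G = "{a \<in> seqs. \<forall>i. i \<notin> I \<longrightarrow> a i = b i}"
  define w where "w W = {s u1 u2 | u1 u2. u1 \<in> W \<and> u2 \<in> ?G}" for W
  have "dim_le C \<Delta> (d + card I) (w W)" if "W \<in> \<W>" for W
    unfolding dim_le_def
  proof (intro conjI allI impI)
    have Ws: "W \<subseteq> seqs" using W that by (auto simp: dim_le_def)
    have "s u1 u2 \<in> seqs" if "u1 \<in> seqs" "u2 \<in> seqs" for u1 u2
      unfolding seqs_def using pol_in_F[OF s1[OF that(2)] that(1)] by simp
    then show "w W \<subseteq> seqs" using Ws by (auto simp: w_def)
    fix D assume D: "D \<le> \<Delta>"
    have "hilbert_le D (w W) ((C * (D + 1) ^ d) * (D + 1) ^ card I)"
    proof (rule hilbert_le_prod[OF _ Ws _ _ s1 s2])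
      show "hilbert_le D W (C * (D + 1) ^ d)" using W that D by (auto simp: dim_le_def)
      show "hilbert_le D ?G ((D + 1) ^ card I)" using D \<Delta> by (intro hilbert_le_grid[OF _ b I]) simp
    qed (auto simp: w_def)
    then show "hilbert_le D (w W) (C * (D + 1) ^ (d + card I))"
      by (simp only: power_add mult.assoc)
  qed
  moreover have "S \<subseteq> \<Union>(w ` \<W>)"
  proof
    fix a assume "a \<in> S"
    then obtain u1 u2 where u: "u1 \<in> S1" "u2 \<in> ?G" "a = s u1 u2" using S by blast
    then obtain W' where "W' \<in> \<W>" "u1 \<in> W'" using W by blast
    then show "a \<in> \<Union>(w ` \<W>)" using u unfolding w_def by blast
  qed
  moreover have "card (w ` \<W>) \<le> R" using card_image_le[OF W(1), of w] W(2) by linarith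
  ultimately show ?thesis unfolding covered_def using W(1) by blast
qed

lemma covered_image:
  assumes "covered R C \<Delta> d S1" "\<Delta> < card F"
    and s: "\<And>i. pol 1 (\<lambda>u. s u i)" and S: "S \<subseteq> s ` S1"
  shows "covered R C \<Delta> d S"
proof -
  have z: "(\<lambda>_. 0) \<in> seqs" by (simp add: seqs_def)
  have "covered R C \<Delta> (d + card ({}::nat set)) S"
  proof (rule covered_prod[OF assms(1,2) _ z, of _ "\<lambda>u _. s u"])
    show "pol 1 (\<lambda>u2. s u1 i)" if "u1 \<in> seqs" for u1 i
      using pol_in_F[OF s that] by (rule pol.const)
  qed (use s S z in auto)
  then show ?thesis by simp
qed

end

section \<open>Edge-coloured graphs and non-backtracking walks\<close>

primrec walk :: "('v \<Rightarrow> 'a \<Rightarrow> 'v) \<Rightarrow> 'v \<Rightarrow> (nat \<Rightarrow> 'a) \<Rightarrow> nat \<Rightarrow> 'v" where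
  "walk nbr x a 0 = x"
| "walk nbr x a (Suc i) = nbr (walk nbr x a i) (a i)"

lemma walk_agree: "(\<And>i. i < l \<Longrightarrow> a i = b i) \<Longrightarrow> walk nbr x a l = walk nbr x b l"
  by (induction l) auto

lemma walk_add: "walk nbr x a (m + i) = walk nbr (walk nbr x a m) (\<lambda>i. a (m + i)) i"
  by (induction i) auto

text \<open>If no vertex of the palindromic ends is revisited, the ends can be lengthened: the edge
  crossed at time \<open>s\<close> is crossed again, and this can only happen at the mirror
  position, as every other possibility makes the walk backtrack. The palindrome then reaches the
  middle, where it forces a backtrack for even \<open>l\<close> and a loop for odd \<open>l\<close>.
  The last clause holds for the least suitable \<open>s\<close>, since otherwise
  \<open>s - 1\<close> and \<open>\<tau> - 1\<close> would do.\<close>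

lemma closed_walk_revisit:
  fixes v :: "nat \<Rightarrow> 'v"
  assumes l: "0 < l" and closed: "v l = v 0"
    and nb: "\<And>i. i + 2 \<le> l \<Longrightarrow> v (i + 2) \<noteq> v i"
    and loop: "\<And>i. i < l \<Longrightarrow> v (Suc i) \<noteq> v i"
    and twice: "\<And>i. i < l \<Longrightarrow> \<exists>i'<l. i' \<noteq> i \<and> {v i', v (Suc i')} = {v i, v (Suc i)}"
  shows "\<exists>s \<tau>. s < \<tau> \<and> \<tau> < l - s \<and> v \<tau> = v s \<and> (\<forall>i\<le>s. v (l - i) = v i) \<and>
           (0 < s \<longrightarrow> v (\<tau> - 1) \<noteq> v (s - 1))"
proof -
  define pal where "pal s \<longleftrightarrow> (\<forall>i\<le>s. v (l - i) = v i)" for s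
  define rev where "rev s \<longleftrightarrow> (\<exists>\<tau>. s < \<tau> \<and> \<tau> < l - s \<and> v \<tau> = v s)" for s
  have "\<exists>s. pal s \<and> rev s"
  proof (rule ccontr)
    assume none: "\<nexists>s. pal s \<and> rev s"
    have pals: "pal s" if "2 * s < l" for s
      using that
    proof (induction s)
      case 0
      then show ?case using closed by (simp add: pal_def)
    next
      case (Suc s)
      then have ps: "pal s" by simp
      have norev: "\<not> rev r" if "r \<le> s" for r
      proof -
        have "pal r" using ps that by (auto simp: pal_def)
        then show ?thesis using none by blast
      qed
      \<comment> \<open>An occurrence of \<open>v s\<close> strictly between the two mirror
        positions is a revisit for \<open>s\<close>, one before \<open>s\<close> is a revisit for
        \<open>p\<close>, and one after \<open>l - s\<close> is mirrored to the latter case.\<close>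
      have pos: "p = s \<or> p = l - s" if p: "v p = v s" "p \<le> l" for p
      proof (rule ccontr)
        assume "\<not> (p = s \<or> p = l - s)"
        then consider "s < p" "p < l - s" | "p < s" | "l - s < p" by linarith
        then show False
        proof cases
          case 1
          then show ?thesis using norev[of s] p by (auto simp: rev_def)
        next
          case 2
          then have "rev p" unfolding rev_def using p Suc.prems by (intro exI[of _ s]) auto
          then show ?thesis using norev 2 by simp
        next
          case 3
          define r where "r = l - p"
          have r: "r < s" "p = l - r" using 3 p by (auto simp: r_def)
          then have "v r = v s" using ps p by (auto simp: pal_def)
          then have "rev r" unfolding rev_def using r Suc.prems by (intro exI[of _ s]) auto
          then show ?thesis using norev r by simp
        qed
      qed
      have sl: "s < l" using Suc.prems by simp
      obtain i' where i': "i' < l" "i' \<noteq> s" "{v i', v (Suc i')} = {v s, v (Suc s)}"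
        using twice[OF sl] by blast
      from i'(3) loop[OF sl] consider "v i' = v s" "v (Suc i') = v (Suc s)"
        | "v (Suc i') = v s" "v i' = v (Suc s)" by (auto simp: doubleton_eq_iff)
      then have "v (l - Suc s) = v (Suc s)"
      proof cases
        case 1
        then have i's: "i' = l - s" using pos[of i'] i' by auto
        then have s0: "s > 0" using i' by (cases s) auto
        have "Suc i' = l - (s - 1)" using i's s0 sl by auto
        moreover have "v (l - (s - 1)) = v (s - 1)" using ps by (simp add: pal_def)
        ultimately have "v ((s - 1) + 2) = v (s - 1)" using 1 s0 by simp
        then show ?thesis using nb[of "s - 1"] Suc.prems s0 by simp
      next
        case 2
        then have "Suc i' = s \<or> Suc i' = l - s" using pos[of "Suc i'"] i' by auto
        then show ?thesis
        proof
          assume "Suc i' = s"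
          then have "v (i' + 2) = v i'" using 2 by auto
          then show ?thesis using nb[of i'] Suc.prems \<open>Suc i' = s\<close> by simp
        next
          assume "Suc i' = l - s"
          then have "i' = l - Suc s" by simp
          then show ?thesis using 2 by simp
        qed
      qed
      then show ?case using ps by (auto simp: pal_def le_Suc_eq)
    qed
    show False
    proof (cases "even l")
      case True
      then obtain m where m: "l = 2 * m" by blast
      with l have m0: "m > 0" by simp
      have "pal (m - 1)" using m m0 by (intro pals) simp
      then have "v (l - (m - 1)) = v (m - 1)" by (simp add: pal_def)
      moreover have "l - (m - 1) = (m - 1) + 2" using m m0 by simp
      ultimately show False using nb[of "m - 1"] m m0 by simp
    next
      case False
      then obtain m where m: "l = 2 * m + 1" using oddE by blast
      have "pal m" using m by (intro pals) simp
      then have "v (l - m) = v m" by (simp add: pal_def)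
      then show False using loop[of m] m by simp
    qed
  qed
  then obtain s where s: "pal s" "rev s" and least: "\<And>r. r < s \<Longrightarrow> \<not> (pal r \<and> rev r)"
    using exists_least_iff[of "\<lambda>s. pal s \<and> rev s"] by auto
  obtain \<tau> where \<tau>: "s < \<tau>" "\<tau> < l - s" "v \<tau> = v s" using s by (auto simp: rev_def)
  have "v (\<tau> - 1) \<noteq> v (s - 1)" if "0 < s"
  proof
    assume eq: "v (\<tau> - 1) = v (s - 1)"
    have "rev (s - 1)" unfolding rev_def using eq \<tau> that by (intro exI[of _ "\<tau> - 1"]) auto
    moreover have "pal (s - 1)" using s by (auto simp: pal_def)
    ultimately show False using least[of "s - 1"] that by simp
  qed
  then show ?thesis using \<tau> s by (auto simp: pal_def)
qed

text \<open>A walk is encoded by the colours of its successive vertices.\<close>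

locale coloured_graph = finite_subfield2 F
  for F :: "'a::field set" +
  fixes V :: "'v set" and nbr :: "'v \<Rightarrow> 'a \<Rightarrow> 'v" and col :: "'v \<Rightarrow> 'a" and side :: "'v \<Rightarrow> bool"
  assumes finite_V: "finite V"
    and nbr_V [simp]: "v \<in> V \<Longrightarrow> a \<in> F \<Longrightarrow> nbr v a \<in> V"
    and col_F [simp]: "v \<in> V \<Longrightarrow> col v \<in> F"
    and col_nbr [simp]: "v \<in> V \<Longrightarrow> a \<in> F \<Longrightarrow> col (nbr v a) = a"
    and side_nbr [simp]: "v \<in> V \<Longrightarrow> a \<in> F \<Longrightarrow> side (nbr v a) = (\<not> side v)"
    and nbr_nbr [simp]: "v \<in> V \<Longrightarrow> a \<in> F \<Longrightarrow> nbr (nbr v a) (col v) = v"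
begin

section \<open>Walks with given ends as sets of points, and their dimensions\<close>

lemma walk_V [simp]: "x \<in> V \<Longrightarrow> a \<in> seqs \<Longrightarrow> walk nbr x a i \<in> V"
  by (induction i) (auto simp: seqs_def)

lemma walk_col [simp]: "x \<in> V \<Longrightarrow> a \<in> seqs \<Longrightarrow> col (walk nbr x a (Suc i)) = a i"
  by (simp add: seqs_def)

lemma walk_side: "x \<in> V \<Longrightarrow> a \<in> seqs \<Longrightarrow> side (walk nbr x a i) = (side x = even i)"
proof (induction i)
  case (Suc i)
  then have "a i \<in> F" by (simp add: seqs_def)
  with Suc show ?case by auto
qed simp

lemma walk_back: "x \<in> V \<Longrightarrow> a \<in> seqs \<Longrightarrow>
    nbr (walk nbr x a (Suc i)) (col (walk nbr x a i)) = walk nbr x a i"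
  by (simp add: seqs_def)

lemma walk_loop: "x \<in> V \<Longrightarrow> a \<in> seqs \<Longrightarrow> walk nbr x a (Suc i) \<noteq> walk nbr x a i"
  using walk_side[of x a i] walk_side[of x a "Suc i"] by auto

text \<open>Padding with zeros from time \<open>l\<close> on makes each walk exactly one point, so
  that bounds on the point set count walks.\<close>

definition walks :: "'v \<Rightarrow> 'v \<Rightarrow> nat \<Rightarrow> (nat \<Rightarrow> 'a) set" where
  "walks x y l = {a \<in> seqs. (\<forall>i\<ge>l. a i = 0) \<and> walk nbr x a l = y \<and>
     (\<forall>i. i + 2 \<le> l \<longrightarrow> walk nbr x a (i + 2) \<noteq> walk nbr x a i)}"

lemma finite_walks: "finite (walks x y l)"
proof -
  have "walks x y l \<subseteq> {a. \<forall>i. (i \<in> {..<l} \<longrightarrow> a i \<in> F) \<and> (i \<notin> {..<l} \<longrightarrow> a i = 0)}"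
    by (auto simp: walks_def seqs_def)
  then show ?thesis by (rule finite_subset) (intro finite_set_of_finite_funs finite_F finite_lessThan)
qed

lemma walks_seqs: "walks x y l \<subseteq> seqs"
  by (auto simp: walks_def)

text \<open>A walk of length \<open>l\<close> has \<open>l - 1\<close> free colours, since the last
  one is \<open>col y\<close>, and each of the \<open>j\<close> lifts is to remove one more.
  Truncated subtraction puts all walks with \<open>l \<le> j + 1\<close> into the zero-dimensional
  case.\<close>

definition walks_covered :: "nat \<Rightarrow> nat \<Rightarrow> nat \<Rightarrow> nat \<Rightarrow> nat \<Rightarrow> bool" where
  "walks_covered k j R C \<Delta> \<longleftrightarrow>
     (\<forall>l\<le>k. \<forall>x\<in>V. \<forall>y\<in>V. covered R C \<Delta> (l - 1 - j) (walks x y l))"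

lemma walks_coveredD:
  "walks_covered k j R C \<Delta> \<Longrightarrow> l \<le> k \<Longrightarrow> x \<in> V \<Longrightarrow> y \<in> V \<Longrightarrow> covered R C \<Delta> (l - 1 - j) (walks x y l)"
  by (simp add: walks_covered_def)

lemma pol_if: "(c \<Longrightarrow> pol D f) \<Longrightarrow> (\<not> c \<Longrightarrow> pol D g) \<Longrightarrow> pol D (\<lambda>a. if c then f a else g a)"
  by (cases c) auto

lemma walks_prefix:
  assumes "a \<in> walks x y l" "\<tau> \<le> l"
  shows "(\<lambda>i. if i < \<tau> then a i else 0) \<in> walks x (walk nbr x a \<tau>) \<tau>"
proof -
  let ?b = "\<lambda>i. if i < \<tau> then a i else 0"
  have "walk nbr x ?b i = walk nbr x a i" if "i \<le> \<tau>" for i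
    using that by (intro walk_agree) auto
  then show ?thesis using assms by (auto simp: walks_def seqs_def)
qed

lemma walks_suffix:
  assumes "a \<in> walks x y l" "\<tau> \<le> l"
  shows "(\<lambda>i. a (\<tau> + i)) \<in> walks (walk nbr x a \<tau>) y (l - \<tau>)"
proof -
  have "walk nbr x a (\<tau> + (i + 2)) \<noteq> walk nbr x a (\<tau> + i)" if "i + 2 \<le> l - \<tau>" for i
    using assms that by (auto simp: walks_def dest: spec[of _ "\<tau> + i"])
  then show ?thesis using assms
    by (auto simp: walks_def seqs_def simp flip: walk_add)
qed

text \<open>If \<open>\<tau> > j\<close>, the first part of the walk has dimension
  \<open>\<tau> - 1 - j\<close> and the colours at times \<open>\<tau>\<close> to
  \<open>l - 2\<close> are left free, which adds up to \<open>l - 2 - j\<close>. If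
  \<open>\<tau> \<le> j\<close>, there are at most \<open>R * C\<close> first parts, and the second
  part alone has dimension \<open>l - \<tau> - 1 - j\<close>, at most \<open>l - 2 - j\<close>. The
  two cases account for the summands \<open>R\<close> and \<open>R * C * R\<close>.\<close>

lemma covered_through_vertex:
  assumes H: "walks_covered k j R C \<Delta>" and \<tau>: "0 < \<tau>" "\<tau> < l" "l \<le> k"
    and V: "x \<in> V" "y \<in> V" "u \<in> V" and C: "C \<le> \<Delta>" and \<Delta>: "\<Delta> < card F"
  shows "covered (R + R * C * R) C \<Delta> (l - 2 - j) {a \<in> walks x y l. walk nbr x a \<tau> = u}"
    (is "covered _ _ _ _ ?S")
proof (cases "j + 1 \<le> \<tau>")
  case True
  let ?s = "\<lambda>u1 u2 i. if i < \<tau> then u1 i else if i < l - 1 then u2 i else if i = l - 1 then col y else (0::'a)"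
  have "covered R C \<Delta> (\<tau> - 1 - j + card {\<tau>..<l - 1}) ?S"
  proof (rule covered_prod[of _ _ _ _ "walks x u \<tau>" _ "\<lambda>_. 0" ?s])
    show "covered R C \<Delta> (\<tau> - 1 - j) (walks x u \<tau>)"
      using walks_coveredD[OF H, of \<tau> x u] \<tau> V by simp
    show "pol 1 (\<lambda>u1. ?s u1 u2 i)" if "u2 \<in> seqs" for u2 i
      using that V pol_coord[of 0 i] by (intro pol_if) (auto simp: seqs_def intro: pol.const)
    show "pol 1 (\<lambda>u2. ?s u1 u2 i)" if "u1 \<in> seqs" for u1 i
      using that V pol_coord[of 0 i] by (intro pol_if) (auto simp: seqs_def intro: pol.const)
    fix a assume a: "a \<in> ?S"
    then have as: "a \<in> seqs" "\<forall>i\<ge>l. a i = 0" and ay: "walk nbr x a l = y" by (auto simp: walks_def)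
    let ?u1 = "\<lambda>i. if i < \<tau> then a i else 0" and ?u2 = "\<lambda>i. if i \<in> {\<tau>..<l - 1} then a i else 0"
    have "?u1 \<in> walks x u \<tau>" using walks_prefix[of a x y l \<tau>] a \<tau> by auto
    moreover have "?u2 \<in> seqs" using as by (auto simp: seqs_def)
    moreover have "a (l - 1) = col y" using walk_col[OF V(1) as(1), of "l - 1"] \<tau> ay by simp
    then have "a = ?s ?u1 ?u2" using as by (auto simp: fun_eq_iff)
    ultimately show "\<exists>u1\<in>walks x u \<tau>. \<exists>u2\<in>seqs. (\<forall>i. i \<notin> {\<tau>..<l - 1} \<longrightarrow> u2 i = 0) \<and> a = ?s u1 u2"
      by (intro bexI[of _ ?u1] bexI[of _ ?u2]) auto
  qed (use \<Delta> in \<open>auto simp: seqs_def\<close>)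
  then show ?thesis by (rule covered_mono) (use True \<tau> in auto)
next
  case False
  let ?T = "walks x u \<tau>"
  have "\<tau> - 1 - j = 0" using False by simp
  then have "covered R C \<Delta> 0 ?T" using walks_coveredD[OF H, of \<tau> x u] \<tau> V by simp
  from covered_finite[OF this C] have T: "finite ?T" "card ?T \<le> R * C" .
  let ?s = "\<lambda>\<alpha> u2 i. if i < \<tau> then \<alpha> i else u2 (i - \<tau>)"
  have "covered (R * C * R) C \<Delta> (l - 2 - j) (\<Union>\<alpha>\<in>?T. {a\<in>?S. \<forall>i<\<tau>. a i = \<alpha> i})"
  proof (rule covered_UN[OF T])
    fix \<alpha> assume \<alpha>: "\<alpha> \<in> ?T"
    have "covered R C \<Delta> (l - \<tau> - 1 - j) (walks u y (l - \<tau>))"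
      using walks_coveredD[OF H, of "l - \<tau>" u y] \<tau> V by simp
    then have "covered R C \<Delta> (l - \<tau> - 1 - j) {a\<in>?S. \<forall>i<\<tau>. a i = \<alpha> i}"
    proof (rule covered_image[OF _ \<Delta>])
      show "pol 1 (\<lambda>u2. ?s \<alpha> u2 i)" for i
        using \<alpha> pol_coord[of 0 "i - \<tau>"]
        by (intro pol_if) (auto simp: walks_def seqs_def intro: pol.const)
      show "{a\<in>?S. \<forall>i<\<tau>. a i = \<alpha> i} \<subseteq> ?s \<alpha> ` walks u y (l - \<tau>)"
      proof
        fix a assume a: "a \<in> {a\<in>?S. \<forall>i<\<tau>. a i = \<alpha> i}"
        have "(\<lambda>i. a (\<tau> + i)) \<in> walks u y (l - \<tau>)" using walks_suffix[of a x y l \<tau>] a \<tau> by auto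
        moreover have "a = ?s \<alpha> (\<lambda>i. a (\<tau> + i))" using a by (auto simp: fun_eq_iff)
        ultimately show "a \<in> ?s \<alpha> ` walks u y (l - \<tau>)" by (intro image_eqI)
      qed
    qed
    then show "covered R C \<Delta> (l - 2 - j) {a\<in>?S. \<forall>i<\<tau>. a i = \<alpha> i}"
      by (rule covered_mono) (use \<tau> in auto)
  qed
  then show ?thesis
  proof (rule covered_mono)
    show "?S \<subseteq> (\<Union>\<alpha>\<in>?T. {a\<in>?S. \<forall>i<\<tau>. a i = \<alpha> i})"
    proof
      fix a assume a: "a \<in> ?S"
      have "(\<lambda>i. if i < \<tau> then a i else 0) \<in> ?T" using walks_prefix[of a x y l \<tau>] a \<tau> by auto
      then show "a \<in> (\<Union>\<alpha>\<in>?T. {a\<in>?S. \<forall>i<\<tau>. a i = \<alpha> i})"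
        using a by (intro UN_I[of "\<lambda>i. if i < \<tau> then a i else 0"]) auto
    qed
  qed auto
qed

text \<open>\<open>fold\<close> replaces everything after time \<open>\<tau>\<close> by the reversal
  of the first \<open>s\<close> steps. The result is a non-backtracking closed walk of length
  \<open>\<tau> + s < l\<close>, so it is covered in dimension \<open>\<tau> + s - 1 - j\<close>;
  the \<open>l - s - 1 - \<tau>\<close> colours of the middle are left free and the remaining ones
  repeat early ones, for a total of \<open>l - 2 - j\<close>. If \<open>\<tau> + s \<le> j\<close>,
  there are few folded walks, hence few vertices at time \<open>\<tau>\<close>, and
  \<open>covered_through_vertex\<close> applies to each.\<close>

lemma covered_palindromic:
  assumes H: "walks_covered k j R C \<Delta>" and s: "0 < s" "s < \<tau>" "\<tau> < l - s" "l \<le> k"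
    and x: "x \<in> V" and C: "C \<le> \<Delta>" and \<Delta>: "\<Delta> < card F"
  shows "covered (R + R * C * (R + R * C * R)) C \<Delta> (l - 2 - j)
    {a \<in> walks x x l. walk nbr x a \<tau> = walk nbr x a s \<and>
       (\<forall>i\<le>s. walk nbr x a (l - i) = walk nbr x a i) \<and>
       walk nbr x a (\<tau> - 1) \<noteq> walk nbr x a (s - 1)}"
    (is "covered _ _ _ _ ?S")
proof -
  define fold where "fold a i = (if i < \<tau> then a i
    else if i < \<tau> + s then col (walk nbr x a (s - 1 - (i - \<tau>))) else 0)" for a i
  have fold_le: "walk nbr x (fold a) i = walk nbr x a i" if "i \<le> \<tau>" for a i
    using that by (intro walk_agree) (auto simp: fold_def)
  have fold_ge: "walk nbr x (fold a) (\<tau> + i) = walk nbr x a (s - i)" if a: "a \<in> ?S" "i \<le> s" for a i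
    using a(2)
  proof (induction i)
    case 0
    then show ?case using a(1) fold_le[of \<tau> a] by simp
  next
    case (Suc i)
    have si: "s - i = Suc (s - Suc i)" using Suc.prems by simp
    have "walk nbr x (fold a) (\<tau> + Suc i) = nbr (walk nbr x a (s - i)) (col (walk nbr x a (s - Suc i)))"
    proof -
      have "fold a (\<tau> + i) = col (walk nbr x a (s - Suc i))" using Suc.prems by (simp add: fold_def)
      then show ?thesis using Suc by simp
    qed
    then show ?case unfolding si using a x by (subst (asm) walk_back) (auto simp: walks_def)
  qed
  have fold: "fold a \<in> walks x x (\<tau> + s)" if a: "a \<in> ?S" for a
  proof -
    have as: "a \<in> seqs" using a by (auto simp: walks_def)
    have nb: "walk nbr x a (i + 2) \<noteq> walk nbr x a i" if "i + 2 \<le> l" for i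
      using a that by (auto simp: walks_def)
    have "walk nbr x (fold a) (i + 2) \<noteq> walk nbr x (fold a) i" if i: "i + 2 \<le> \<tau> + s" for i
    proof -
      \<comment> \<open>Before, at and after the turn. Only the turn uses that the vertices at times
        \<open>\<tau> - 1\<close> and \<open>s - 1\<close> differ.\<close>
      consider "i + 2 \<le> \<tau>" | "i + 1 = \<tau>" | r where "i = \<tau> + r" "r + 2 \<le> s"
      proof -
        consider "i + 2 \<le> \<tau>" | "i + 1 = \<tau>" | "\<tau> \<le> i" by linarith
        then show ?thesis using that i by cases (auto dest: le_Suc_ex)
      qed
      then show ?thesis
      proof cases
        case 1
        then show ?thesis using nb[of i] fold_le[of "i + 2" a] fold_le[of i a] s by simp
      next
        case 2
        then have "i + 2 = \<tau> + 1" "i = \<tau> - 1" by auto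
        then show ?thesis using fold_ge[OF a, of 1] fold_le[of "\<tau> - 1" a] s a by auto
      next
        case 3
        have "s - (r + 2) + 2 \<le> l" "s - r = s - (r + 2) + 2" using 3 s by auto
        then have "walk nbr x a (s - r) \<noteq> walk nbr x a (s - (r + 2))" using nb by metis
        moreover have "walk nbr x (fold a) (i + 2) = walk nbr x a (s - (r + 2))"
          using fold_ge[OF a 3(2)] 3(1) by (simp only: add.assoc)
        moreover have "walk nbr x (fold a) i = walk nbr x a (s - r)"
          using fold_ge[OF a, of r] 3 by simp
        ultimately show ?thesis by metis
      qed
    qed
    moreover have "fold a \<in> seqs" using as x unfolding seqs_def fold_def
      by (auto simp: seqs_def intro!: col_F walk_V)
    ultimately show ?thesis using fold_ge[OF a, of s] by (auto simp: walks_def fold_def)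
  qed
  let ?T = "walks x x (\<tau> + s)"
  have H': "covered R C \<Delta> (\<tau> + s - 1 - j) ?T"
    using walks_coveredD[OF H, of "\<tau> + s" x x] s x by simp
  show ?thesis
  proof (cases "j + 1 \<le> \<tau> + s")
    case True
    \<comment> \<open>On the retraced end, \<open>a i\<close> is the colour of the vertex at time
      \<open>i + 1\<close>, which is the vertex at time \<open>l - 1 - i\<close> and has colour
      \<open>a (l - 2 - i)\<close>. For \<open>i = l - 1\<close> it is \<open>x\<close>
      itself.\<close>
    let ?s = "\<lambda>u1 u2 i. if i < \<tau> then u1 i else if i < l - s - 1 then u2 i
      else if i < l - 1 then u1 (l - 2 - i) else if i = l - 1 then col x else (0::'a)"
    have "covered R C \<Delta> (\<tau> + s - 1 - j + card {\<tau>..<l - s - 1}) ?S"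
    proof (rule covered_prod[OF H' \<Delta>, of _ "\<lambda>_. 0" ?s])
      show "pol 1 (\<lambda>u1. ?s u1 u2 i)" if "u2 \<in> seqs" for u2 i
        using that x pol_coord[of 0] by (intro pol_if) (auto simp: seqs_def intro: pol.const)
      show "pol 1 (\<lambda>u2. ?s u1 u2 i)" if "u1 \<in> seqs" for u1 i
        using that x pol_coord[of 0] by (intro pol_if) (auto simp: seqs_def intro: pol.const)
      fix a assume a: "a \<in> ?S"
      then have as: "a \<in> seqs" "\<forall>i\<ge>l. a i = 0" by (auto simp: walks_def)
      let ?u2 = "\<lambda>i. if i \<in> {\<tau>..<l - s - 1} then a i else 0"
      have "?u2 \<in> seqs" using as by (auto simp: seqs_def)
      moreover have "a = ?s (fold a) ?u2"
      proof
        fix i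
        have e1: "a i = col (walk nbr x a (l - 1 - i))" if i: "l - s - 1 \<le> i" "i < l"
        proof -
          have "l - 1 - i \<le> s" using i s by simp
          then have "walk nbr x a (l - (l - 1 - i)) = walk nbr x a (l - 1 - i)" using a by blast
          moreover have "l - (l - 1 - i) = Suc i" using i by simp
          ultimately show ?thesis using walk_col[OF x as(1), of i] by (simp del: walk.simps)
        qed
        have e2: "col (walk nbr x a (l - 1 - i)) = fold a (l - 2 - i)" if i: "l - s - 1 \<le> i" "i < l - 1"
        proof -
          have "l - 1 - i = Suc (l - 2 - i)" using i by simp
          moreover have "l - 2 - i < \<tau>" using i s by simp
          ultimately show ?thesis using walk_col[OF x as(1), of "l - 2 - i"] by (simp only: fold_def if_True)
        qed
        consider "i < \<tau>" | "\<tau> \<le> i" "i < l - s - 1" | "l - s - 1 \<le> i" "i < l - 1" | "i = l - 1" | "l \<le> i"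
          by linarith
        then show "a i = ?s (fold a) ?u2 i"
        proof cases
          case 1
          then show ?thesis by (simp add: fold_def)
        next
          case 3
          moreover have "\<not> i < \<tau>" "\<not> i < l - s - 1" using 3 s by linarith+
          ultimately show ?thesis using e1 e2 by simp
        next
          case 4
          moreover have "\<not> i < \<tau>" "\<not> i < l - s - 1" "l - s - 1 \<le> i" "i < l" using 4 s by linarith+
          ultimately show ?thesis using e1 by simp
        qed (use as(2) s in auto)
      qed
      ultimately show "\<exists>u1\<in>?T. \<exists>u2\<in>seqs. (\<forall>i. i \<notin> {\<tau>..<l - s - 1} \<longrightarrow> u2 i = 0) \<and> a = ?s u1 u2"
        using fold[OF a] by (intro bexI[of _ "fold a"] bexI[of _ ?u2]) auto
    qed (auto simp: seqs_def)
    then show ?thesis by (rule covered_mono) (use True s in auto)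
  next
    case False
    then have "\<tau> + s - 1 - j = 0" by simp
    with H' have "covered R C \<Delta> 0 ?T" by simp
    from covered_finite[OF this C] have T: "finite ?T" "card ?T \<le> R * C" .
    have "covered (R * C * (R + R * C * R)) C \<Delta> (l - 2 - j)
      (\<Union>b\<in>?T. {a\<in>walks x x l. walk nbr x a \<tau> = walk nbr x b \<tau>})"
    proof (rule covered_UN[OF T])
      fix b assume "b \<in> ?T"
      then show "covered (R + R * C * R) C \<Delta> (l - 2 - j) {a\<in>walks x x l. walk nbr x a \<tau> = walk nbr x b \<tau>}"
        using x s walks_seqs by (intro covered_through_vertex[OF H _ _ _ _ _ _ C \<Delta>] walk_V) auto
    qed
    then show ?thesis
    proof (rule covered_mono)
      show "?S \<subseteq> (\<Union>b\<in>?T. {a\<in>walks x x l. walk nbr x a \<tau> = walk nbr x b \<tau>})"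
      proof
        fix a assume a: "a \<in> ?S"
        have "walk nbr x a \<tau> = walk nbr x (fold a) \<tau>" by (rule fold_le[symmetric]) simp
        then have "a \<in> {a\<in>walks x x l. walk nbr x a \<tau> = walk nbr x (fold a) \<tau>}" using a by blast
        then show "a \<in> (\<Union>b\<in>?T. {a\<in>walks x x l. walk nbr x a \<tau> = walk nbr x b \<tau>})"
          using fold[OF a] by blast
      qed
    qed auto
  qed
qed

section \<open>Edges crossed an odd number of times\<close>

definition edge :: "'v \<Rightarrow> 'v \<Rightarrow> 'v \<times> 'v" where
  "edge v w = (if side v then (v, w) else (w, v))"

definition step :: "'v \<Rightarrow> (nat \<Rightarrow> 'a) \<Rightarrow> nat \<Rightarrow> 'v \<times> 'v" where
  "step x a i = edge (walk nbr x a i) (walk nbr x a (Suc i))"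

definition odd_edges :: "'v \<Rightarrow> (nat \<Rightarrow> 'a) \<Rightarrow> nat \<Rightarrow> ('v \<times> 'v) set" where
  "odd_edges x a l = {e. odd (card {i. i < l \<and> step x a i = e})}"

lemma step_endpoints: "{fst (step x a i), snd (step x a i)} = {walk nbr x a i, walk nbr x a (Suc i)}"
  by (auto simp: step_def edge_def)

text \<open>Grouping the steps by edge gives each edge its multiplicity as a factor, and in
  characteristic two only the parity of the multiplicity survives.\<close>

lemma sum_steps:
  "(\<Sum>i<l. f (step x a i)) = (\<Sum>e\<in>step x a ` {..<l} \<inter> odd_edges x a l. f e :: 'a)"
proof -
  have "(\<Sum>i<l. f (step x a i)) = (\<Sum>e\<in>step x a ` {..<l}. \<Sum>i\<in>{i\<in>{..<l}. step x a i = e}. f (step x a i))"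
    by (rule sum.image_gen) simp
  also have "\<dots> = (\<Sum>e\<in>step x a ` {..<l}. if e \<in> odd_edges x a l then f e else 0)"
  proof (rule sum.cong)
    fix e
    have "(\<Sum>i\<in>{i\<in>{..<l}. step x a i = e}. f (step x a i)) = of_nat (card {i\<in>{..<l}. step x a i = e}) * f e"
      by simp
    also have "\<dots> = (if e \<in> odd_edges x a l then f e else 0)"
      by (simp add: odd_edges_def of_nat_char2)
    finally show "(\<Sum>i\<in>{i\<in>{..<l}. step x a i = e}. f (step x a i)) = \<dots>" .
  qed simp
  also have "\<dots> = (\<Sum>e\<in>step x a ` {..<l} \<inter> odd_edges x a l. f e)"
    by (simp add: sum.inter_restrict)
  finally show ?thesis .
qed

text \<open>The indicator of \<open>x\<close>, summed over both ends of all steps, telescopes to its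
  values at the two ends of the walk, while \<open>sum_steps\<close> makes the sum zero.\<close>

lemma walk_closed_of_no_odd_edges:
  assumes "odd_edges x a l = {}"
  shows "walk nbr x a l = x"
proof -
  define \<chi> where "\<chi> v = (if v = x then 1 else 0 :: 'a)" for v
  have "(\<Sum>i<l. \<chi> (fst (step x a i)) + \<chi> (snd (step x a i))) = 0"
    using sum_steps[of "\<lambda>e. \<chi> (fst e) + \<chi> (snd e)"] assms by simp
  moreover have "\<chi> (fst (step x a i)) + \<chi> (snd (step x a i)) = \<chi> (walk nbr x a i) + \<chi> (walk nbr x a (Suc i))" for i
    by (auto simp: step_def edge_def add.commute)
  moreover have "(\<Sum>i<l. \<chi> (walk nbr x a i) + \<chi> (walk nbr x a (Suc i))) = \<chi> x + \<chi> (walk nbr x a l)"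
  proof (induction l)
    case (Suc l)
    then show ?case by (simp add: add.assoc del: walk.simps(2))
  qed (simp add: char2)
  ultimately have "\<chi> x = \<chi> (walk nbr x a l)" by simp
  then show ?thesis by (auto simp: \<chi>_def split: if_splits)
qed

text \<open>If the odd edges of all walks in \<open>U\<close> lie in a small set, each walk passes through one of few
  vertices, or traverses every edge an even number of times and hence has the shape
  \<open>D u u' D\<^sup>-\<^sup>1\<close> with \<open>D u D\<^sup>-\<^sup>1\<close> a shorter non-backtracking closed walk.\<close>

lemma covered_few_odd_edges:
  assumes H: "walks_covered k j R C \<Delta>" and l: "2 \<le> l" "l \<le> k"
    and V: "x \<in> V" "y \<in> V" and C: "C \<le> \<Delta>" and \<Delta>: "\<Delta> < card F"
    and E: "finite E" "card E \<le> N" "E \<subseteq> V \<times> V"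
    and U: "U \<subseteq> walks x y l" and odd: "\<And>a. a \<in> U \<Longrightarrow> odd_edges x a l \<subseteq> E"
  shows "covered (k * (2 * N + 1) * (R + R * C * R) + k * k * (R + R * C * (R + R * C * R))) C \<Delta> (l - 2 - j) U"
proof -
  let ?P = "\<lambda>(\<tau>, u). {a \<in> walks x y l. walk nbr x a \<tau> = u}"
  \<comment> \<open>Including \<open>x\<close> takes care of the case \<open>s = 0\<close> of
    \<open>closed_walk_revisit\<close>, where the walk returns to its start at an inner time. With
    the ends of the edges in \<open>E\<close> this makes at most \<open>2 * N + 1\<close>
    vertices.\<close>
  let ?I = "{1..<l} \<times> insert x (fst ` E \<union> snd ` E)"
  let ?Q = "\<lambda>(s, \<tau>). {a \<in> walks x x l. walk nbr x a \<tau> = walk nbr x a s \<and>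
       (\<forall>i\<le>s. walk nbr x a (l - i) = walk nbr x a i) \<and>
       walk nbr x a (\<tau> - 1) \<noteq> walk nbr x a (s - 1)}"
  let ?J = "{(s, \<tau>). 0 < s \<and> s < \<tau> \<and> \<tau> < l - s}"
  have "covered (k * (2 * N + 1) * (R + R * C * R)) C \<Delta> (l - 2 - j) (\<Union>p\<in>?I. ?P p)"
  proof (rule covered_UN)
    show "finite ?I" using E by simp
    have "card (insert x (fst ` E \<union> snd ` E)) \<le> Suc (card (fst ` E \<union> snd ` E))"
      using E by (simp add: card_insert_if)
    also have "\<dots> \<le> 2 * N + 1"
      using card_Un_le[of "fst ` E" "snd ` E"] card_image_le[OF E(1), of fst] card_image_le[OF E(1), of snd] E(2)
      by linarith
    finally have "card (insert x (fst ` E \<union> snd ` E)) \<le> 2 * N + 1" .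
    moreover have "card {1..<l} \<le> k" using l by simp
    ultimately show "card ?I \<le> k * (2 * N + 1)"
      unfolding card_cartesian_product by (intro mult_le_mono)
    fix p assume "p \<in> ?I"
    then show "covered (R + R * C * R) C \<Delta> (l - 2 - j) (?P p)"
      using covered_through_vertex[OF H _ _ l(2) V _ C \<Delta>] E V by auto
  qed
  moreover have "covered (k * k * (R + R * C * (R + R * C * R))) C \<Delta> (l - 2 - j) (\<Union>p\<in>?J. ?Q p)"
  proof (rule covered_UN)
    have J: "?J \<subseteq> {..<l} \<times> {..<l}" by auto
    then show "finite ?J" by (rule finite_subset) simp
    have "card ?J \<le> card ({..<l} \<times> {..<l})" using J by (rule card_mono[rotated]) simp
    also have "\<dots> \<le> k * k" using l by (simp add: card_cartesian_product mult_le_mono)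
    finally show "card ?J \<le> k * k" .
    fix p assume "p \<in> ?J"
    then show "covered (R + R * C * (R + R * C * R)) C \<Delta> (l - 2 - j) (?Q p)"
      using covered_palindromic[OF H _ _ _ l(2) V(1) C \<Delta>] by auto
  qed
  ultimately have "covered (k * (2 * N + 1) * (R + R * C * R) + k * k * (R + R * C * (R + R * C * R)))
    C \<Delta> (l - 2 - j) ((\<Union>p\<in>?I. ?P p) \<union> (\<Union>p\<in>?J. ?Q p))"
    by (rule covered_Un)
  then show ?thesis
  proof (rule covered_mono)
    show "U \<subseteq> (\<Union>p\<in>?I. ?P p) \<union> (\<Union>p\<in>?J. ?Q p)"
    proof
      fix a assume "a \<in> U"
      with U have a: "a \<in> walks x y l" by blast
      then have as: "a \<in> seqs" by (auto simp: walks_def)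
      show "a \<in> (\<Union>p\<in>?I. ?P p) \<union> (\<Union>p\<in>?J. ?Q p)"
      proof (cases "odd_edges x a l = {}")
        case False
        then obtain e where e: "e \<in> odd_edges x a l" by blast
        then have "{i. i < l \<and> step x a i = e} \<noteq> {}" by (force simp: odd_edges_def)
        then obtain i where i: "i < l" "step x a i = e" by blast
        have "e \<in> E" using e odd[OF \<open>a \<in> U\<close>] by blast
        have "walk nbr x a i \<in> {fst e, snd e}" "walk nbr x a (Suc i) \<in> {fst e, snd e}"
          using step_endpoints[of x a i] i by blast+
        with \<open>e \<in> E\<close> have w: "walk nbr x a i \<in> fst ` E \<union> snd ` E" "walk nbr x a (Suc i) \<in> fst ` E \<union> snd ` E"
          by auto
        \<comment> \<open>Cutting the walk needs an inner time; if the odd edge is crossed at step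
          0, its far end at time 1 is taken.\<close>
        define \<tau> where "\<tau> = max 1 i"
        have "(\<tau>, walk nbr x a \<tau>) \<in> ?I" using w i l by (cases i) (auto simp: \<tau>_def)
        then show ?thesis using a by blast
      next
        case True
        have yx: "y = x" using walk_closed_of_no_odd_edges[OF True] a by (simp add: walks_def)
        have twice: "\<exists>i'<l. i' \<noteq> i \<and> {walk nbr x a i', walk nbr x a (Suc i')} = {walk nbr x a i, walk nbr x a (Suc i)}"
          if i: "i < l" for i
        proof -
          let ?A = "{i'. i' < l \<and> step x a i' = step x a i}"
          have "step x a i \<notin> odd_edges x a l" using True by simp
          then have "even (card ?A)" by (simp add: odd_edges_def)
          then have "card ?A \<noteq> card {i}" by (metis One_nat_def card.empty card.insert empty_iff finite.emptyI odd_one)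
          then have "?A \<noteq> {i}" by (rule contrapos_nn) (rule arg_cong)
          then obtain i' where "i' < l" "step x a i' = step x a i" "i' \<noteq> i" using i by blast
          then show ?thesis using step_endpoints[of x a i] step_endpoints[of x a i'] by metis
        qed
        then obtain s \<tau> where st: "s < \<tau>" "\<tau> < l - s" "walk nbr x a \<tau> = walk nbr x a s"
          "\<forall>i\<le>s. walk nbr x a (l - i) = walk nbr x a i"
          "0 < s \<longrightarrow> walk nbr x a (\<tau> - 1) \<noteq> walk nbr x a (s - 1)"
        proof -
          have "walk nbr x a l = walk nbr x a 0" using a yx by (simp add: walks_def)
          moreover have "walk nbr x a (i + 2) \<noteq> walk nbr x a i" if "i + 2 \<le> l" for i
            using a that by (simp add: walks_def del: walk.simps add_2_eq_Suc')
          moreover have "0 < l" using l by simp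
          ultimately show ?thesis
            using closed_walk_revisit[of l "walk nbr x a"] walk_loop[OF V(1) as] that twice by blast
        qed
        show ?thesis
        proof (cases "s = 0")
          case True
          then have "walk nbr x a \<tau> = x" using st(3) by simp
          then have "a \<in> ?P (\<tau>, x)" using a by blast
          moreover have "(\<tau>, x) \<in> ?I" using st(1,2) by (intro SigmaI insertI1) simp
          ultimately show ?thesis by (intro UnI1 UN_I)
        next
          case False
          then have "(s, \<tau>) \<in> ?J" using st(1,2) by simp
          moreover have "a \<in> walks x x l" using a yx by simp
          then have "a \<in> ?Q (s, \<tau>)" using st(3-5) False by blast
          ultimately show ?thesis by (intro UnI2 UN_I)
        qed
      qed
    qed
  qed auto
qed

section \<open>Polynomial edge functions and random voltages\<close>

definition edge_set :: "('v \<times> 'v) set" where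
  "edge_set = (\<lambda>(v, a). edge v (nbr v a)) ` (V \<times> F)"

lemma finite_edge_set: "finite edge_set"
  by (simp add: edge_set_def finite_V finite_F)

lemma edge_set_subset: "edge_set \<subseteq> V \<times> V"
  by (auto simp: edge_set_def edge_def split: if_splits)

lemma step_edge_set: "x \<in> V \<Longrightarrow> a \<in> seqs \<Longrightarrow> step x a i \<in> edge_set"
  unfolding edge_set_def step_def by (intro image_eqI[of _ _ "(walk nbr x a i, a i)"]) (auto simp: seqs_def)

text \<open>The degree is measured along walks: from every start, the value on the
  \<open>i\<close>-th edge crossed is a polynomial in the colours. The value 0 off
  \<open>edge_set\<close> makes these functions a finite vector space, in which probabilities are
  ratios of cardinalities.\<close>

definition edge_fun :: "nat \<Rightarrow> ('v \<times> 'v \<Rightarrow> 'a) \<Rightarrow> bool" where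
  "edge_fun D f \<longleftrightarrow> (\<forall>e. f e \<in> F) \<and> (\<forall>e. e \<notin> edge_set \<longrightarrow> f e = 0) \<and>
     (\<forall>x\<in>V. \<forall>i. pol D (\<lambda>a. f (step x a i)))"

lemma finite_edge_fun: "finite {f. edge_fun D f}"
proof -
  have "{f. edge_fun D f} \<subseteq> {f. \<forall>e. (e \<in> edge_set \<longrightarrow> f e \<in> F) \<and> (e \<notin> edge_set \<longrightarrow> f e = 0)}"
    by (auto simp: edge_fun_def)
  then show ?thesis
    by (rule finite_subset) (intro finite_set_of_finite_funs finite_F finite_edge_set)
qed

lemma edge_fun_mono: "edge_fun D f \<Longrightarrow> D \<le> E \<Longrightarrow> edge_fun E f"
  unfolding edge_fun_def using pol_mono by blast

lemma edge_fun_zero: "edge_fun D (\<lambda>_. 0)"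
  by (auto simp: edge_fun_def intro: pol.const)

lemma edge_fun_indicator: "edge_fun D (\<lambda>e. if e \<in> edge_set then 1 else 0)"
  unfolding edge_fun_def
proof (intro conjI ballI allI)
  fix x i assume "x \<in> V"
  show "pol D (\<lambda>a. if step x a i \<in> edge_set then 1 else 0)"
    by (rule pol.agree[OF pol.const[of 1]]) (use \<open>x \<in> V\<close> in \<open>auto simp: step_edge_set\<close>)
qed auto

lemma edge_fun_mult: "edge_fun D f \<Longrightarrow> edge_fun E g \<Longrightarrow> edge_fun (D + E) (\<lambda>e. f e * g e)"
  by (auto simp: edge_fun_def intro: pol_mult)

lemma edge_fun_add_scale:
  "edge_fun D f \<Longrightarrow> edge_fun D g \<Longrightarrow> c \<in> F \<Longrightarrow> edge_fun D (\<lambda>e. f e + c * g e)"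
  by (auto simp: edge_fun_def intro!: pol.add pol_scale)

definition separated :: "nat \<Rightarrow> bool" where
  "separated \<epsilon> \<longleftrightarrow> (\<forall>e\<in>edge_set. \<forall>e'\<in>edge_set. e \<noteq> e' \<longrightarrow> (\<exists>f. edge_fun \<epsilon> f \<and> f e = 1 \<and> f e' = 0))"

lemma edge_fun_separate:
  assumes sep: "separated \<epsilon>" and e: "e \<in> edge_set" and E: "finite E" "E \<subseteq> edge_set" "e \<notin> E"
  shows "\<exists>f. edge_fun (card E * \<epsilon>) f \<and> f e = 1 \<and> (\<forall>e'\<in>E. f e' = 0)"
  using E
proof (induction E rule: finite_induct)
  case empty
  show ?case using edge_fun_indicator[of 0] e by (intro exI[of _ "\<lambda>e. if e \<in> edge_set then 1 else 0"]) auto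
next
  case (insert e' E)
  then obtain f where f: "edge_fun (card E * \<epsilon>) f" "f e = 1" "\<forall>e'\<in>E. f e' = 0" by auto
  obtain g where g: "edge_fun \<epsilon> g" "g e = 1" "g e' = 0"
    using sep e insert.prems unfolding separated_def by (metis insertI1 insert_subset)
  show ?case using edge_fun_mult[OF g(1) f(1)] f g insert.hyps
    by (intro exI[of _ "\<lambda>e. g e * f e"]) auto
qed

definition voltage :: "('v \<times> 'v \<Rightarrow> 'a) \<Rightarrow> 'v \<Rightarrow> (nat \<Rightarrow> 'a) \<Rightarrow> nat \<Rightarrow> 'a" where
  "voltage f x a l = (\<Sum>i<l. f (step x a i))"

lemma pol_voltage: "edge_fun D f \<Longrightarrow> x \<in> V \<Longrightarrow> pol D (\<lambda>a. voltage f x a l)"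
  unfolding voltage_def by (intro pol_sum) (auto simp: edge_fun_def)

text \<open>Read as a probability: a uniformly random edge function of degree \<open>D\<close> has
  constant voltage \<open>c\<close> on \<open>U\<close> with probability at most
  \<open>card F\<close> to the power \<open>-M\<close>.\<close>

definition rich :: "nat \<Rightarrow> nat \<Rightarrow> 'v \<Rightarrow> nat \<Rightarrow> (nat \<Rightarrow> 'a) set \<Rightarrow> bool" where
  "rich D M x l U \<longleftrightarrow> (\<forall>c. card {f. edge_fun D f \<and> (\<forall>a\<in>U. voltage f x a l = c)} * card F ^ M
     \<le> card {f. edge_fun D f})"

text \<open>Walks are picked greedily from \<open>U\<close>, each with an odd edge outside the set
  \<open>E\<close> of edges of the walks picked before. A function that is 1 on this edge and 0 on
  all other edges of \<open>E\<close> and of the new walk changes the voltage of the new walk but of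
  no earlier one; so requiring the value \<open>c\<close> there as well divides the number of
  functions by at least \<open>card F\<close>. After \<open>M\<close> rounds \<open>U\<close> is
  rich; if the choice stops earlier, \<open>E\<close> contains all odd edges. As \<open>E\<close>
  never exceeds \<open>M * l \<le> N\<close> edges, degree \<open>N * \<epsilon>\<close> suffices
  for separation.\<close>

lemma few_odd_edges_or_rich:
  assumes sep: "separated \<epsilon>" and x: "x \<in> V" and U: "U \<subseteq> seqs" and N: "M * l \<le> N"
  shows "(\<exists>E. E \<subseteq> edge_set \<and> card E \<le> N \<and> (\<forall>a\<in>U. odd_edges x a l \<subseteq> E)) \<or> rich (N * \<epsilon>) M x l U"
proof -
  let ?D = "N * \<epsilon>"
  let ?B = "\<lambda>S c. {f. edge_fun ?D f \<and> (\<forall>a\<in>S. voltage f x a l = c)}"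
  have "(\<exists>E. E \<subseteq> edge_set \<and> card E \<le> N \<and> (\<forall>a\<in>U. odd_edges x a l \<subseteq> E)) \<or>
    (\<exists>E S. E \<subseteq> edge_set \<and> card E \<le> n * l \<and> S \<subseteq> U \<and> (\<forall>a\<in>S. \<forall>i<l. step x a i \<in> E) \<and>
       (\<forall>c. card (?B S c) * card F ^ n \<le> card {f. edge_fun ?D f}))" if "n \<le> M" for n
    using that
  proof (induction n)
    case 0
    show ?case by (intro disjI2 exI[of _ "{}"]) auto
  next
    case (Suc n)
    have nN: "Suc n * l \<le> N" using Suc.prems N by (meson mult_le_mono1 order_trans)
    consider "\<exists>E. E \<subseteq> edge_set \<and> card E \<le> N \<and> (\<forall>a\<in>U. odd_edges x a l \<subseteq> E)"
      | E S where "E \<subseteq> edge_set" "card E \<le> n * l" "S \<subseteq> U" "\<forall>a\<in>S. \<forall>i<l. step x a i \<in> E"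
         "\<forall>c. card (?B S c) * card F ^ n \<le> card {f. edge_fun ?D f}"
      using Suc by auto
    then show ?case
    proof cases
      case (2 E S)
      show ?thesis
      proof (cases "\<forall>a\<in>U. odd_edges x a l \<subseteq> E")
        case True
        moreover have "card E \<le> N" using 2(2) nN by simp
        ultimately show ?thesis using 2(1) by blast
      next
        case False
        then obtain a e where a: "a \<in> U" "e \<in> odd_edges x a l" "e \<notin> E" by blast
        let ?E = "E \<union> step x a ` {..<l}"
        have fE: "finite E" using 2(1) finite_edge_set finite_subset by blast
        have as: "a \<in> seqs" using a U by blast
        have odd_e: "odd (card {i. i < l \<and> step x a i = e})" using a(2) by (simp add: odd_edges_def)
        then have "{i. i < l \<and> step x a i = e} \<noteq> {}" by (metis card.empty even_zero)
        then have e: "e \<in> step x a ` {..<l}" by blast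
        have E': "?E \<subseteq> edge_set" using 2(1) step_edge_set[OF x as] by blast
        have cE': "card ?E \<le> Suc n * l"
          using card_Un_le[of E "step x a ` {..<l}"] card_image_le[of "{..<l}" "step x a"] 2(2) by simp
        have "card (?E - {e}) \<le> N"
          using cE' nN by (meson card_Diff1_le order_trans)
        moreover obtain \<delta> where "edge_fun (card (?E - {e}) * \<epsilon>) \<delta>" and \<delta>: "\<delta> e = 1" "\<forall>e'\<in>?E - {e}. \<delta> e' = 0"
          using edge_fun_separate[OF sep, of e "?E - {e}"] E' e fE by blast
        ultimately have \<delta>D: "edge_fun ?D \<delta>" using edge_fun_mono mult_le_mono1 by blast
        have vol_a: "voltage \<delta> x a l = 1"
        proof -
          have "voltage \<delta> x a l = (\<Sum>i<l. if step x a i = e then 1 else 0)"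
            unfolding voltage_def using \<delta> by (intro sum.cong) auto
          also have "\<dots> = of_nat (card {i. i < l \<and> step x a i = e})"
            by (simp add: sum.If_cases lessThan_def Int_def conj_commute)
          also have "\<dots> = 1" using odd_e by (simp add: of_nat_char2)
          finally show ?thesis .
        qed
        have vol_S: "voltage \<delta> x a' l = 0" if "a' \<in> S" for a'
          unfolding voltage_def
        proof (rule sum.neutral, intro ballI)
          fix i assume "i \<in> {..<l}"
          then have "step x a' i \<in> E" using 2(4) that by simp
          then have "step x a' i \<in> ?E - {e}" using a(3) by blast
          then show "\<delta> (step x a' i) = 0" using \<delta> by blast
        qed
        have vol_add: "voltage (\<lambda>e. f e + c * \<delta> e) x a' l = voltage f x a' l + c * voltage \<delta> x a' l" for f c a'
          by (simp add: voltage_def sum.distrib sum_distrib_left)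
        have "card (?B (insert a S) c) * card F ^ Suc n \<le> card {f. edge_fun ?D f}" for c
        proof -
          let ?\<Phi> = "\<lambda>(f, c) e. f e + c * \<delta> e"
          have "inj_on ?\<Phi> (?B (insert a S) c \<times> F)"
          proof (rule inj_onI, clarify)
            fix f c1 g c2
            assume f: "\<forall>a\<in>insert a S. voltage f x a l = c" and g: "\<forall>a\<in>insert a S. voltage g x a l = c"
              and eq: "(\<lambda>e. f e + c1 * \<delta> e) = (\<lambda>e. g e + c2 * \<delta> e)"
            have "voltage f x a l + c1 = voltage g x a l + c2"
              using arg_cong[OF eq, of "\<lambda>h. voltage h x a l"] unfolding vol_add vol_a by simp
            then have c: "c1 = c2" using f g by simp
            have "f e = g e" for e using fun_cong[OF eq, of e] c by simp
            with c show "f = g \<and> c1 = c2" by auto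
          qed
          moreover have "?\<Phi> ` (?B (insert a S) c \<times> F) \<subseteq> ?B S c"
            using edge_fun_add_scale[OF _ \<delta>D] vol_S by (auto simp: vol_add)
          moreover have "finite (?B S c)" by (rule finite_subset[OF _ finite_edge_fun[of ?D]]) auto
          ultimately have "card (?B (insert a S) c \<times> F) \<le> card (?B S c)" by (rule card_inj_on_le)
          then have "card (?B (insert a S) c) * card F * card F ^ n \<le> card (?B S c) * card F ^ n"
            by (simp add: card_cartesian_product)
          also have "\<dots> \<le> card {f. edge_fun ?D f}" using 2(5) by blast
          finally show ?thesis by (simp add: mult.assoc)
        qed
        moreover have "\<forall>a'\<in>insert a S. \<forall>i<l. step x a' i \<in> ?E" using 2(4) by auto
        moreover have "insert a S \<subseteq> U" using a 2(3) by simp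
        ultimately show ?thesis using E' cE' by blast
      qed
    qed blast
  qed
  from this[OF order_refl] show ?thesis
  proof (elim disjE exE conjE)
    fix E S assume S: "S \<subseteq> U" "\<forall>c. card (?B S c) * card F ^ M \<le> card {f. edge_fun ?D f}"
    have "card (?B U c) * card F ^ M \<le> card {f. edge_fun ?D f}" for c
    proof -
      have "card (?B U c) \<le> card (?B S c)"
        using S(1) by (intro card_mono finite_subset[OF _ finite_edge_fun[of ?D]]) auto
      then have "card (?B U c) * card F ^ M \<le> card (?B S c) * card F ^ M" by simp
      also have "\<dots> \<le> card {f. edge_fun ?D f}" using S(2) by blast
      finally show ?thesis .
    qed
    then show ?thesis by (simp add: rich_def)
  qed blast
qed

text \<open>Union bound over the members of the family and the \<open>card F\<close> possible
  constants.\<close>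

lemma exists_nonconstant_voltage:
  assumes fin: "finite \<U>" and rich: "\<And>x l U. (x, l, U) \<in> \<U> \<Longrightarrow> rich D M x l U"
    and card: "card \<U> * card F < card F ^ M"
  shows "\<exists>f. edge_fun D f \<and> (\<forall>(x, l, U)\<in>\<U>. \<forall>c\<in>F. \<exists>a\<in>U. voltage f x a l \<noteq> c)"
proof (rule ccontr)
  assume none: "\<nexists>f. edge_fun D f \<and> (\<forall>(x, l, U)\<in>\<U>. \<forall>c\<in>F. \<exists>a\<in>U. voltage f x a l \<noteq> c)"
  let ?A = "{f. edge_fun D f}"
  define B where "B = (\<lambda>((x, l, U), c). {f. edge_fun D f \<and> (\<forall>a\<in>U. voltage f x a l = c)})"
  have "?A \<subseteq> (\<Union>p\<in>\<U> \<times> F. B p)"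
    using none by (fastforce simp: B_def)
  then have "card ?A \<le> card (\<Union>p\<in>\<U> \<times> F. B p)"
    by (intro card_mono finite_subset[OF _ finite_edge_fun[of D]]) (auto simp: B_def)
  also have "\<dots> \<le> (\<Sum>p\<in>\<U> \<times> F. card (B p))" using fin finite_F by (intro card_UN_le) simp
  finally have "card ?A * card F ^ M \<le> (\<Sum>p\<in>\<U> \<times> F. card (B p)) * card F ^ M" by simp
  also have "\<dots> = (\<Sum>p\<in>\<U> \<times> F. card (B p) * card F ^ M)" by (rule sum_distrib_right)
  also have "\<dots> \<le> card (\<U> \<times> F) * card ?A"
    using sum_bounded_above[of "\<U> \<times> F" "\<lambda>p. card (B p) * card F ^ M" "card ?A"] rich
    by (auto simp: B_def rich_def)
  finally have "card ?A * card F ^ M \<le> card ?A * (card \<U> * card F)"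
    by (simp add: card_cartesian_product mult_ac)
  moreover have "card ?A > 0" using finite_edge_fun[of D] edge_fun_zero[of D] card_gt_0_iff by blast
  ultimately show False using card by simp
qed

text \<open>The Hilbert function at \<open>\<Delta>\<close> of every covering set is at most
  \<open>C * (\<Delta> + 1) ^ k\<close>, so \<open>irred_decomposition\<close> splits each into a
  number of pieces that does not depend on the field.\<close>

lemma irred_cover:
  assumes "covered R C \<Delta> d (walks x y l)" "d \<le> k"
  shows "\<exists>\<I>. finite \<I> \<and> card \<I> \<le> R * 2 ^ (C * (\<Delta> + 1) ^ k) \<and> \<Union>\<I> = walks x y l \<and>
    (\<forall>U\<in>\<I>. irred \<Delta> U \<and> dim_le C \<Delta> d U)"
proof -
  obtain \<W> where W: "finite \<W>" "card \<W> \<le> R" "walks x y l \<subseteq> \<Union>\<W>" "\<forall>W\<in>\<W>. dim_le C \<Delta> d W"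
    using assms(1) unfolding covered_def by blast
  let ?b = "C * (\<Delta> + 1) ^ k"
  have seqs_W: "walks x y l \<inter> W \<subseteq> seqs" for W using walks_seqs[of x y l] by blast
  have "\<exists>\<U>. finite \<U> \<and> card \<U> \<le> 2 ^ ?b \<and> \<Union>\<U> = walks x y l \<inter> W \<and> (\<forall>U\<in>\<U>. irred \<Delta> U)" if "W \<in> \<W>" for W
  proof (rule irred_decomposition)
    have "hilbert_le \<Delta> W (C * (\<Delta> + 1) ^ d)" using W that by (auto simp: dim_le_def)
    then have "hilbert_le \<Delta> (walks x y l \<inter> W) ?b"
      by (rule hilbert_le_mono) (use assms(2) in \<open>auto intro!: mult_le_mono power_increasing\<close>)
    then show "card (res \<Delta> (walks x y l \<inter> W)) \<le> card F ^ ?b"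
      using finite_walks seqs_W by (intro card_res_le) auto
  qed (use finite_walks seqs_W in auto)
  then obtain u where u: "\<And>W. W \<in> \<W> \<Longrightarrow> finite (u W) \<and> card (u W) \<le> 2 ^ ?b \<and>
    \<Union>(u W) = walks x y l \<inter> W \<and> (\<forall>U\<in>u W. irred \<Delta> U)" by metis
  have "card (\<Union>W\<in>\<W>. u W) \<le> (\<Sum>W\<in>\<W>. card (u W))" using W(1) by (rule card_UN_le)
  also have "\<dots> \<le> card \<W> * 2 ^ ?b" using sum_bounded_above[of \<W> "\<lambda>W. card (u W)" "2 ^ ?b"] u by simp
  also have "\<dots> \<le> R * 2 ^ ?b" using W(2) by simp
  finally have "card (\<Union>W\<in>\<W>. u W) \<le> R * 2 ^ ?b" .
  moreover have "\<Union>(\<Union>W\<in>\<W>. u W) = walks x y l"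
  proof -
    have "\<Union>(\<Union>W\<in>\<W>. u W) = (\<Union>W\<in>\<W>. \<Union>(u W))" by blast
    also have "\<dots> = (\<Union>W\<in>\<W>. walks x y l \<inter> W)" using u by simp
    also have "\<dots> = walks x y l" using W(3) by blast
    finally show ?thesis .
  qed
  moreover have "irred \<Delta> U \<and> dim_le C \<Delta> d U" if U: "U \<in> (\<Union>W\<in>\<W>. u W)" for U
  proof -
    obtain W where Wu: "W \<in> \<W>" "U \<in> u W" using U by blast
    then have "U \<subseteq> W" using u[OF Wu(1)] by blast
    then show ?thesis using u[OF Wu(1)] Wu W(4) dim_le_mono by blast
  qed
  ultimately show ?thesis using W(1) u by (intro exI[of _ "\<Union>W\<in>\<W>. u W"]) auto
qed

text \<open>Over all lengths and ends there are at most
  \<open>4 * (k + 1) * card F ^ (2 * k)\<close> families of pieces; by the last assumption the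
  number of pieces, even times the \<open>card F\<close> possible constants, stays below
  \<open>card F ^ M\<close> for \<open>M = 2 * k + 2\<close>. So one voltage is constant on no rich
  piece. On such a piece \<open>voltage f x a l + c\<close> is a polynomial that does not vanish
  identically, and its zeros have one dimension less; a piece that is not rich has few odd edges and
  already lies in a cover of lower dimension. The factor \<open>1 + ...\<close> in the number of
  covering sets adds up the two cases.\<close>

lemma exists_voltage_covered:
  fixes k :: nat
  defines "M \<equiv> 2 * k + 2"
  defines "N \<equiv> M * k"
  assumes H: "walks_covered k j R C \<Delta>" and sep: "separated \<epsilon>" and V: "card V \<le> 2 * card F ^ k"
    and C: "C \<le> \<Delta>" and \<Delta>: "\<Delta>' + (\<Delta>' + 1) * (N * \<epsilon>) \<le> \<Delta>" "\<Delta> < card F"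
    and q: "4 * (k + 1) * (R * 2 ^ (C * (\<Delta> + 1) ^ k)) < card F"
  shows "\<exists>f. edge_fun (N * \<epsilon>) f \<and> (\<forall>l\<le>k. \<forall>x\<in>V. \<forall>y\<in>V. \<forall>c\<in>F.
    covered (R * 2 ^ (C * (\<Delta> + 1) ^ k) *
        (1 + (k * (2 * N + 1) * (R + R * C * R) + k * k * (R + R * C * (R + R * C * R)))))
      (C * (N * \<epsilon> + 1) ^ k) \<Delta>' (l - 1 - Suc j) {a \<in> walks x y l. voltage f x a l = c})"
proof -
  let ?Rn = "k * (2 * N + 1) * (R + R * C * R) + k * k * (R + R * C * (R + R * C * R))"
  let ?Ri = "R * 2 ^ (C * (\<Delta> + 1) ^ k)" and ?e = "N * \<epsilon>" and ?C = "C * (N * \<epsilon> + 1) ^ k"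
  have \<Delta>': "\<Delta>' \<le> \<Delta>" using \<Delta>(1) by simp
  have CC: "C \<le> ?C" by simp
  have "\<forall>p\<in>{..k} \<times> V \<times> V. \<exists>\<I>. case p of (l, x, y) \<Rightarrow> finite \<I> \<and> card \<I> \<le> ?Ri \<and> \<Union>\<I> = walks x y l \<and>
    (\<forall>U\<in>\<I>. irred \<Delta> U \<and> dim_le C \<Delta> (l - 1 - j) U)"
    using irred_cover[OF walks_coveredD[OF H]] by auto
  from bchoice[OF this] obtain fam where fam0: "\<forall>p\<in>{..k} \<times> V \<times> V. case p of (l, x, y) \<Rightarrow>
    finite (fam p) \<and> card (fam p) \<le> ?Ri \<and> \<Union>(fam p) = walks x y l \<and>
    (\<forall>U\<in>fam p. irred \<Delta> U \<and> dim_le C \<Delta> (l - 1 - j) U)" by blast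
  have fam: "finite (fam (l, x, y)) \<and> card (fam (l, x, y)) \<le> ?Ri \<and> \<Union>(fam (l, x, y)) = walks x y l \<and>
    (\<forall>U\<in>fam (l, x, y). irred \<Delta> U \<and> dim_le C \<Delta> (l - 1 - j) U)"
    if "l \<le> k" "x \<in> V" "y \<in> V" for l x y
    using bspec[OF fam0, of "(l, x, y)"] that by simp
  define \<U> where "\<U> = (\<Union>(l, x, y)\<in>{..k} \<times> V \<times> V. (\<lambda>U. (x, l, U)) ` {U \<in> fam (l, x, y). rich ?e M x l U})"
  have fin1: "finite ({..k} \<times> V \<times> V)" using finite_V by simp
  have "finite \<U>" unfolding \<U>_def using fin1 fam by (auto intro!: finite_UN_I[OF fin1])
  moreover have "card \<U> * card F < card F ^ M"
  proof -
    have "card \<U> \<le> (\<Sum>p\<in>{..k} \<times> V \<times> V. card (case p of (l, x, y) \<Rightarrow> (\<lambda>U. (x, l, U)) ` {U \<in> fam (l, x, y). rich ?e M x l U}))"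
      unfolding \<U>_def by (rule card_UN_le[OF fin1])
    also have "\<dots> \<le> card ({..k} \<times> V \<times> V) * ?Ri"
    proof -
      have "card (case p of (l, x, y) \<Rightarrow> (\<lambda>U. (x, l, U)) ` {U \<in> fam (l, x, y). rich ?e M x l U}) \<le> ?Ri"
        if p: "p \<in> {..k} \<times> V \<times> V" for p
      proof -
        obtain l x y where [simp]: "p = (l, x, y)" by (cases p)
        have f: "finite (fam (l, x, y))" "card (fam (l, x, y)) \<le> ?Ri" using fam[of l x y] p by auto
        have "card ((\<lambda>U. (x, l, U)) ` {U \<in> fam (l, x, y). rich ?e M x l U}) \<le> card {U \<in> fam (l, x, y). rich ?e M x l U}"
          using f by (intro card_image_le) simp
        also have "\<dots> \<le> card (fam (l, x, y))" using f by (intro card_mono) auto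
        finally show ?thesis using f by simp
      qed
      then show ?thesis using sum_bounded_above[of "{..k} \<times> V \<times> V" _ ?Ri] by fastforce
    qed
    also have "\<dots> = (k + 1) * (card V * card V) * ?Ri" by (simp add: card_cartesian_product)
    also have "\<dots> \<le> (k + 1) * ((2 * card F ^ k) * (2 * card F ^ k)) * ?Ri"
      using V by (intro mult_le_mono) auto
    also have "\<dots> = card F ^ k * card F ^ k * (4 * (k + 1) * ?Ri)" by (simp add: algebra_simps)
    also have "card F ^ k * card F ^ k = card F ^ (2 * k)" by (simp add: mult_2 power_add)
    finally have "card \<U> * card F \<le> card F ^ (2 * k) * (4 * (k + 1) * ?Ri) * card F" by simp
    also have "\<dots> < card F ^ (2 * k) * card F * card F"
      using q card_F_ge_2 by (intro mult_strict_right_mono mult_strict_left_mono) auto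
    finally show ?thesis by (simp add: M_def power_add power2_eq_square mult_ac)
  qed
  moreover have "rich ?e M x l U" if "(x, l, U) \<in> \<U>" for x l U
    using that by (auto simp: \<U>_def)
  ultimately obtain f where f: "edge_fun ?e f"
    and nc0: "\<forall>(x, l, U)\<in>\<U>. \<forall>c\<in>F. \<exists>a\<in>U. voltage f x a l \<noteq> c"
    using exists_nonconstant_voltage[of \<U> ?e M] by meson
  have nc: "\<exists>a\<in>U. voltage f x a l \<noteq> c" if "(x, l, U) \<in> \<U>" "c \<in> F" for x l U c
    using bspec[OF nc0 that(1)] that(2) by simp
  have "covered (?Ri * (1 + ?Rn)) ?C \<Delta>' (l - 1 - Suc j) {a \<in> walks x y l. voltage f x a l = c}"
    if l: "l \<le> k" and x: "x \<in> V" and y: "y \<in> V" and c: "c \<in> F" for l x y c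
  \<comment> \<open>At dimension zero the old cover is kept: by truncated subtraction the target
    dimension is zero too.\<close>
  proof (cases "l - 1 - j = 0")
    case True
    have "covered R C \<Delta> (l - 1 - j) (walks x y l)" using walks_coveredD[OF H l x y] .
    then show ?thesis
    proof (rule covered_mono)
      have "R * 1 * 1 \<le> ?Ri * (1 + ?Rn)" by (intro mult_le_mono) auto
      then show "R \<le> ?Ri * (1 + ?Rn)" by simp
    qed (use True \<Delta>' CC in auto)
  next
    case False
    define d where "d = l - 2 - j"
    have d: "l - 1 - j = Suc d" "l - 1 - Suc j = d" and l2: "2 \<le> l" using False by (auto simp: d_def)
    note fa = fam[OF l x y]
    have Uw: "U \<subseteq> walks x y l" if "U \<in> fam (l, x, y)" for U using fa that by blast
    have "covered (?Ri * (1 + ?Rn)) ?C \<Delta>' d (\<Union>U\<in>fam (l, x, y). {a \<in> U. voltage f x a l = c})"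
    proof (rule covered_UN)
      fix U assume U: "U \<in> fam (l, x, y)"
      have Us: "U \<subseteq> seqs" "finite U" using Uw[OF U] walks_seqs finite_walks finite_subset by blast+
      show "covered (1 + ?Rn) ?C \<Delta>' d {a \<in> U. voltage f x a l = c}"
      proof (cases "rich ?e M x l U")
        case True
        then have "(x, l, U) \<in> \<U>" using U l x y by (auto simp: \<U>_def intro!: bexI[of _ "(l, x, y)"])
        then obtain a where a: "a \<in> U" "voltage f x a l \<noteq> c" using nc c by blast
        let ?g = "\<lambda>a. voltage f x a l + c"
        have "dim_le (C * (?e + 1) ^ Suc d) \<Delta>' d {a \<in> U. ?g a = 0}"
        proof (rule dim_le_hyperplane[OF Us(2)])
          show "dim_le C \<Delta> (Suc d) U" "irred \<Delta> U" using fa U d by auto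
          show "pol ?e ?g" using f x c by (intro pol.add pol_voltage pol.const)
        qed (use a \<Delta> in auto)
        moreover have "C * (?e + 1) ^ Suc d \<le> ?C"
          using l2 l by (intro mult_le_mono2 power_increasing) (auto simp: d_def)
        moreover have "{a \<in> U. voltage f x a l = c} \<subseteq> {a \<in> U. ?g a = 0}" by auto
        ultimately have "dim_le ?C \<Delta>' d {a \<in> U. voltage f x a l = c}"
          using dim_le_mono by blast
        then show ?thesis unfolding covered_def
          by (intro exI[of _ "{{a \<in> U. voltage f x a l = c}}"]) simp
      next
        case False
        have "M * l \<le> N" using l by (simp add: N_def)
        from few_odd_edges_or_rich[OF sep x Us(1) this] False obtain E where
          E: "E \<subseteq> edge_set" "card E \<le> N" "\<forall>a\<in>U. odd_edges x a l \<subseteq> E" by blast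
        have "covered ?Rn C \<Delta> (l - 2 - j) U"
        proof (rule covered_few_odd_edges[OF H l2 l x y C \<Delta>(2) _ E(2) _ Uw[OF U]])
          show "finite E" using E finite_edge_set finite_subset by blast
          show "E \<subseteq> V \<times> V" using E edge_set_subset by blast
        qed (use E in auto)
        then show ?thesis by (rule covered_mono) (use \<Delta>' CC in \<open>auto simp: d_def\<close>)
      qed
    qed (use fa in auto)
    then show ?thesis unfolding d
      by (rule covered_mono) (use fa in auto)
  qed
  with f show ?thesis by blast
qed

end

section \<open>The tower of lifts\<close>

locale voltage_lift = coloured_graph F V nbr col side
  for F :: "'a::field set" and V :: "'a list set" and nbr col side +
  fixes f :: "'a list \<times> 'a list \<Rightarrow> 'a" and D :: nat
  assumes f: "edge_fun D f"
begin

definition lift_V :: "'a list set" where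
  "lift_V = (\<lambda>(c, v). c # v) ` (F \<times> V)"

text \<open>The head of the list is the fibre coordinate. Colour and side will be read from the
  tail, so that a walk and its lift have the same sequence of colours.\<close>

definition lift_nbr :: "'a list \<Rightarrow> 'a \<Rightarrow> 'a list" where
  "lift_nbr v a = (hd v + f (edge (tl v) (nbr (tl v) a))) # nbr (tl v) a"

lemma f_F [simp]: "f e \<in> F"
  using f by (simp add: edge_fun_def del: split_paired_All)

lemma edge_commute: "v \<in> V \<Longrightarrow> a \<in> F \<Longrightarrow> edge (nbr v a) v = edge v (nbr v a)"
  by (simp add: edge_def)

sublocale L: coloured_graph F lift_V lift_nbr "\<lambda>v. col (tl v)" "\<lambda>v. side (tl v)"
proof
  show "finite lift_V" by (simp add: lift_V_def finite_F finite_V)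
qed (auto simp: lift_V_def lift_nbr_def edge_commute add.assoc char2)

lemma lift_walk: "walk lift_nbr (c # x) a i = (c + voltage f x a i) # walk nbr x a i"
  by (induction i) (auto simp: voltage_def lift_nbr_def step_def add.assoc)

text \<open>The fibre coordinate accumulates the voltage, so fixing both lifted ends prescribes it.
  A backtrack in the base crosses one edge twice in a row, its voltage cancels, and the lift
  backtracks as well; hence non-backtracking passes down from the lift.\<close>

lemma lift_walks: 
  assumes "x \<in> V"
  shows "L.walks (c # x) (c' # y) l \<subseteq> {a \<in> walks x y l. voltage f x a l = c + c'}"
proof
  fix a assume a: "a \<in> L.walks (c # x) (c' # y) l"
  then have as: "a \<in> seqs" "\<forall>i\<ge>l. a i = 0" and nb: "\<And>i. i + 2 \<le> l \<Longrightarrow>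
      walk lift_nbr (c # x) a (i + 2) \<noteq> walk lift_nbr (c # x) a i"
    and "walk lift_nbr (c # x) a l = c' # y" by (auto simp: L.walks_def)
  then have y: "walk nbr x a l = y" "c + voltage f x a l = c'" by (auto simp: lift_walk)
  have "walk nbr x a (i + 2) \<noteq> walk nbr x a i" if i: "i + 2 \<le> l" for i
  proof
    assume eq: "walk nbr x a (i + 2) = walk nbr x a i"
    have "step x a (Suc i) = edge (walk nbr x a (Suc i)) (walk nbr x a i)"
      using eq by (simp add: step_def)
    also have "\<dots> = step x a i"
      using edge_commute[of "walk nbr x a i" "a i"] assms as by (simp add: step_def seqs_def)
    finally have "voltage f x a (i + 2) = voltage f x a i" by (simp add: voltage_def add.assoc char2)
    then show False using nb[OF i] eq unfolding lift_walk by simp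
  qed
  moreover have "voltage f x a l = c + c'" using y(2) by (metis add_self_left)
  ultimately show "a \<in> {a \<in> walks x y l. voltage f x a l = c + c'}"
    using as y by (simp add: walks_def)
qed

lemma lift_edge_set:
  assumes "e \<in> L.edge_set"
  shows "(tl (fst e), tl (snd e)) \<in> edge_set" "hd (fst e) \<in> F"
    "e = (hd (fst e) # tl (fst e), (hd (fst e) + f (tl (fst e), tl (snd e))) # tl (snd e))"
proof -
  obtain c v a where v: "c \<in> F" "v \<in> V" "a \<in> F" and e: "e = L.edge (c # v) (lift_nbr (c # v) a)"
  proof -
    obtain v' a where "v' \<in> lift_V" "a \<in> F" "e = L.edge v' (lift_nbr v' a)"
      using assms unfolding L.edge_set_def by auto
    then show ?thesis using that by (auto simp: lift_V_def)
  qed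
  have "edge v (nbr v a) \<in> edge_set" using v unfolding edge_set_def by (intro image_eqI[of _ _ "(v, a)"]) auto
  moreover have "(tl (fst e), tl (snd e)) = edge v (nbr v a)"
    by (simp add: e L.edge_def edge_def lift_nbr_def)
  ultimately show "(tl (fst e), tl (snd e)) \<in> edge_set" by simp
  show "hd (fst e) \<in> F" using v by (simp add: e L.edge_def lift_nbr_def)
  show "e = (hd (fst e) # tl (fst e), (hd (fst e) + f (tl (fst e), tl (snd e))) # tl (snd e))"
    by (simp add: e L.edge_def edge_def lift_nbr_def add.assoc char2)
qed

lemma lift_step:
  "L.step (c # x) a i = (if side (walk nbr x a i)
    then ((c + voltage f x a i) # walk nbr x a i, (c + voltage f x a (Suc i)) # walk nbr x a (Suc i))
    else ((c + voltage f x a (Suc i)) # walk nbr x a (Suc i), (c + voltage f x a i) # walk nbr x a i))"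
  unfolding L.step_def lift_walk L.edge_def by simp

lemma lift_edge_fun_pullback:
  assumes g: "edge_fun \<epsilon> g"
  shows "L.edge_fun \<epsilon> (\<lambda>e. if e \<in> L.edge_set then g (tl (fst e), tl (snd e)) else 0)"
  unfolding L.edge_fun_def
proof (intro conjI ballI allI)
  fix x' i assume "x' \<in> lift_V"
  then obtain c x where x': "x' = c # x" "c \<in> F" "x \<in> V" by (auto simp: lift_V_def)
  have "(if L.step x' a i \<in> L.edge_set then g (tl (fst (L.step x' a i)), tl (snd (L.step x' a i))) else 0)
      = g (step x a i)" if "a \<in> seqs" for a
    using L.step_edge_set[OF \<open>x' \<in> lift_V\<close> that, of i]
    by (simp add: x' lift_step step_def edge_def)
  moreover have "pol \<epsilon> (\<lambda>a. g (step x a i))" using g x' by (simp add: edge_fun_def)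
  ultimately show "pol \<epsilon> (\<lambda>a. if L.step x' a i \<in> L.edge_set
      then g (tl (fst (L.step x' a i)), tl (snd (L.step x' a i))) else 0)"
    by (rule pol.agree[rotated])
qed (use g in \<open>simp_all add: edge_fun_def del: split_paired_All\<close>)

text \<open>Along a walk the fibre coordinate is a start value plus an accumulated voltage, hence a
  polynomial of degree at most \<open>D\<close>. The parity of the time decides which end of the
  step is the first component of the edge.\<close>

lemma lift_edge_fun_fibre:
  assumes h: "h \<in> F" "r \<in> F"
  shows "L.edge_fun D (\<lambda>e. if e \<in> L.edge_set then (hd (fst e) + h) * r else 0)"
  unfolding L.edge_fun_def
proof (intro conjI ballI allI)
  fix x' i assume "x' \<in> lift_V"
  then obtain c x where x': "x' = c # x" "c \<in> F" "x \<in> V" by (auto simp: lift_V_def)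
  let ?i = "if side x = even i then i else Suc i"
  have "(if L.step x' a i \<in> L.edge_set then (hd (fst (L.step x' a i)) + h) * r else 0)
      = r * (c + voltage f x a ?i + h)" if "a \<in> seqs" for a
    using L.step_edge_set[OF \<open>x' \<in> lift_V\<close> that, of i] walk_side[OF x'(3) that, of i]
    by (simp add: x' lift_step mult.commute)
  moreover have "pol D (\<lambda>a. r * (c + voltage f x a ?i + h))"
    using h x' f by (intro pol_scale pol.add pol.const pol_voltage)
  ultimately show "pol D (\<lambda>a. if L.step x' a i \<in> L.edge_set then (hd (fst (L.step x' a i)) + h) * r else 0)"
    by (rule pol.agree[rotated])
next
  show "(if e \<in> L.edge_set then (hd (fst e) + h) * r else 0) \<in> F" for e
    using h lift_edge_set(2) by simp
qed simp

text \<open>Lifted edges with different projections are separated by a pulled-back function, and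
  edges in one fibre by the fibre coordinate. The latter has the degree of the voltage, so the
  separation degree rises with every lift.\<close>

lemma lift_separated:
  assumes sep: "separated \<epsilon>" and D: "\<epsilon> \<le> D"
  shows "L.separated D"
  unfolding L.separated_def
proof (intro ballI impI)
  fix e1 e2 assume e: "e1 \<in> L.edge_set" "e2 \<in> L.edge_set" "e1 \<noteq> e2"
  let ?p = "\<lambda>e. (tl (fst e), tl (snd e))"
  show "\<exists>g. L.edge_fun D g \<and> g e1 = 1 \<and> g e2 = 0"
  proof (cases "?p e1 = ?p e2")
    case False
    then obtain g where g: "edge_fun \<epsilon> g" "g (?p e1) = 1" "g (?p e2) = 0"
      using sep e lift_edge_set(1) unfolding separated_def by blast
    then show ?thesis
      using L.edge_fun_mono[OF lift_edge_fun_pullback[OF g(1)] D] e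
      by (intro exI[of _ "\<lambda>e. if e \<in> L.edge_set then g (?p e) else 0"]) simp
  next
    case True
    have "hd (fst e1) \<noteq> hd (fst e2)"
    proof
      assume "hd (fst e1) = hd (fst e2)"
      with True lift_edge_set(3)[OF e(1)] lift_edge_set(3)[OF e(2)] have "e1 = e2" by (metis prod.inject)
      with e show False by simp
    qed
    then have "hd (fst e1) + hd (fst e2) \<noteq> 0" by simp
    then show ?thesis
      using e lift_edge_set(2) lift_edge_fun_fibre[of "hd (fst e2)" "inverse (hd (fst e1) + hd (fst e2))"]
      by (intro exI[of _ "\<lambda>e. if e \<in> L.edge_set then (hd (fst e) + hd (fst e2)) * inverse (hd (fst e1) + hd (fst e2)) else 0"])
        (simp add: char2)
  qed
qed

lemma card_lift_side: "card {v \<in> lift_V. P (tl v)} = card F * card {v \<in> V. P v}"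
proof -
  have "{v \<in> lift_V. P (tl v)} = (\<lambda>(c, v). c # v) ` (F \<times> {v \<in> V. P v})"
    by (auto simp: lift_V_def)
  moreover have "inj_on (\<lambda>(c, v). c # v) (F \<times> {v \<in> V. P v})" by (auto simp: inj_on_def)
  ultimately show ?thesis by (simp add: card_image card_cartesian_product)
qed

lemma lift_walks_covered:
  assumes "\<forall>l\<le>k. \<forall>x\<in>V. \<forall>y\<in>V. \<forall>c\<in>F. covered R C \<Delta> (l - 1 - Suc j) {a \<in> walks x y l. voltage f x a l = c}"
  shows "L.walks_covered k (Suc j) R C \<Delta>"
  unfolding L.walks_covered_def
proof (intro allI impI ballI)
  fix l x' y' assume l: "l \<le> k" and "x' \<in> lift_V" "y' \<in> lift_V"
  then obtain c x c' y where xy: "x' = c # x" "c \<in> F" "x \<in> V" "y' = c' # y" "c' \<in> F" "y \<in> V"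
    by (auto simp: lift_V_def)
  then have "covered R C \<Delta> (l - 1 - Suc j) {a \<in> walks x y l. voltage f x a l = c + c'}"
    using assms l by simp
  then show "covered R C \<Delta> (l - 1 - Suc j) (L.walks x' y' l)"
    by (rule covered_mono) (use lift_walks[OF xy(3)] xy in auto)
qed

end

section \<open>The complete bipartite base graph\<close>

context finite_subfield2
begin

definition base_V :: "'a list set" where
  "base_V = {[x, s] | x s. x \<in> F \<and> s \<in> {0, 1}}"

definition base_nbr :: "'a list \<Rightarrow> 'a \<Rightarrow> 'a list" where
  "base_nbr v a = [a, v ! 1 + 1]"

definition base_side :: "'a list \<Rightarrow> bool" where
  "base_side v \<longleftrightarrow> v ! 1 = 0"

sublocale base: coloured_graph F base_V base_nbr hd base_side
proof
  have "base_V = (\<lambda>(x, s). [x, s]) ` (F \<times> {0, 1})" by (auto simp: base_V_def)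
  then show "finite base_V" by (simp add: finite_F)
qed (auto simp: base_V_def base_nbr_def base_side_def add.assoc char2)

text \<open>A single grid suffices: the last colour is that of \<open>y\<close> and the
  \<open>l - 1\<close> colours before it are free.\<close>

lemma base_walks_covered:
  assumes "\<Delta> < card F"
  shows "base.walks_covered k 0 1 1 \<Delta>"
  unfolding base.walks_covered_def
proof (intro allI impI ballI)
  fix l x y assume x: "x \<in> base_V" and y: "y \<in> base_V"
  define b where "b i = (if i = l - 1 \<and> 0 < l then hd y else 0)" for i :: nat
  let ?G = "{a \<in> seqs. \<forall>i. i \<notin> {..<l - 1} \<longrightarrow> a i = b i}"
  have b: "b \<in> seqs" using y by (auto simp: b_def seqs_def base_V_def)
  have "dim_le 1 \<Delta> (l - 1 - 0) ?G"
    unfolding dim_le_def using hilbert_le_grid[OF _ b, of _ "{..<l - 1}"] assms by auto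
  moreover have "base.walks x y l \<subseteq> ?G"
  proof
    fix a assume a: "a \<in> base.walks x y l"
    then have as: "a \<in> seqs" by (auto simp: base.walks_def)
    have "a i = b i" if "\<not> i < l - 1" for i
    proof (cases "i = l - 1 \<and> 0 < l")
      case True
      then show ?thesis using base.walk_col[OF x as, of i] a by (auto simp: base.walks_def b_def)
    next
      case False
      then show ?thesis using a that by (auto simp: base.walks_def b_def)
    qed
    then show "a \<in> ?G" using as by simp
  qed
  ultimately show "covered 1 1 \<Delta> (l - 1 - 0) (base.walks x y l)"
    unfolding covered_def by (intro exI[of _ "{?G}"]) simp
qed

text \<open>An edge is given by two elements of \<open>F\<close>, the colours of its ends. At each
  step of a walk these are consecutive colours of the walk or the colour of its start, so both
  coordinates have degree 1.\<close>

lemma base_separated: "base.separated 1"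
  unfolding base.separated_def
proof (intro ballI impI)
  fix e1 e2 assume e: "e1 \<in> base.edge_set" "e2 \<in> base.edge_set" "e1 \<noteq> e2"
  have edge: "\<exists>p\<in>F. \<exists>l\<in>F. e = ([p, 0], [l, 1])" if e: "e \<in> base.edge_set" for e
  proof -
    obtain v a where "v \<in> base_V" "a \<in> F" "e = base.edge v (base_nbr v a)"
      using e unfolding base.edge_set_def by auto
    then show ?thesis by (auto simp: base.edge_def base_side_def base_nbr_def base_V_def)
  qed
  have fst_fun: "base.edge_fun 1 (\<lambda>e. if e \<in> base.edge_set then (hd (g e) + h) * r else 0)"
    if h: "h \<in> F" "r \<in> F" and g: "g = fst \<or> g = snd" for h r g
    unfolding base.edge_fun_def
  proof (intro conjI ballI allI)
    fix x i assume x: "x \<in> base_V"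
    let ?m = "if (base_side x = even i) = (g = fst) then i else Suc i"
    have fs: "(fst :: 'a list \<times> 'a list \<Rightarrow> _) \<noteq> snd" by (metis fst_conv snd_conv list.distinct(1))
    have hd_eq: "hd (g (base.step x a i)) = hd (walk base_nbr x a ?m)" if a: "a \<in> seqs" for a
      using g fs fs[symmetric] base.walk_side[OF x a, of i] by (auto simp: base.step_def base.edge_def)
    have "pol 1 (\<lambda>a. hd (walk base_nbr x a ?m))"
      using x by (cases ?m) (auto simp: base_nbr_def base_V_def pol_coord intro: pol.const)
    then have "pol 1 (\<lambda>a. r * (hd (walk base_nbr x a ?m) + h))"
      using h by (intro pol_scale pol.add pol.const)
    moreover have "(if base.step x a i \<in> base.edge_set then (hd (g (base.step x a i)) + h) * r else 0)
        = r * (hd (walk base_nbr x a ?m) + h)" if a: "a \<in> seqs" for a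
      using base.step_edge_set[OF x a, of i] by (simp only: hd_eq[OF a] if_True mult.commute)
    ultimately show "pol 1 (\<lambda>a. if base.step x a i \<in> base.edge_set then (hd (g (base.step x a i)) + h) * r else 0)"
      by (rule pol.agree)
  next
    show "(if e \<in> base.edge_set then (hd (g e) + h) * r else 0) \<in> F" for e
      using edge[of e] g h by auto
  qed simp
  obtain p1 l1 p2 l2 where pl: "p1 \<in> F" "l1 \<in> F" "e1 = ([p1, 0], [l1, 1])"
    "p2 \<in> F" "l2 \<in> F" "e2 = ([p2, 0], [l2, 1])" using edge[OF e(1)] edge[OF e(2)] by blast
  show "\<exists>f. base.edge_fun 1 f \<and> f e1 = 1 \<and> f e2 = 0"
  proof (cases "p1 = p2")
    case False
    then show ?thesis using pl e fst_fun[of p2 "inverse (p1 + p2)" fst]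
      by (intro exI[of _ "\<lambda>e. if e \<in> base.edge_set then (hd (fst e) + p2) * inverse (p1 + p2) else 0"])
        (auto simp: char2)
  next
    case True
    then have "l1 \<noteq> l2" using pl e by auto
    then show ?thesis using pl e fst_fun[of l2 "inverse (l1 + l2)" snd]
      by (intro exI[of _ "\<lambda>e. if e \<in> base.edge_set then (hd (snd e) + l2) * inverse (l1 + l2) else 0"])
        (auto simp: char2)
  qed
qed

lemma card_base_side: "card {v \<in> base_V. base_side v = s} = card F"
proof -
  have "{v \<in> base_V. base_side v = s} = (\<lambda>x. [x, if s then 0 else 1]) ` F"
    by (auto simp: base_V_def base_side_def)
  then show ?thesis by (simp add: card_image inj_on_def)
qed

end

section \<open>Iterating the lift\<close>

definition tower_stage where
  "tower_stage k j R C \<Delta> \<epsilon> F V nbr col side \<longleftrightarrow>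
     coloured_graph F V nbr col side \<and> coloured_graph.separated F V nbr side \<epsilon> \<and>
     coloured_graph.walks_covered F V nbr k j R C \<Delta> \<and>
     (\<forall>s. card {v \<in> V. side v = s} = card F ^ Suc j)"

text \<open>The order of quantifiers carries the induction. \<open>C\<close> and
  \<open>\<epsilon>\<close> precede \<open>\<Delta>\<close>, so a range \<open>\<Delta>'\<close>
  wanted at stage \<open>Suc j\<close> is obtained by asking stage \<open>j\<close> for a range long
  enough to leave \<open>\<Delta>'\<close> after a cut of degree \<open>N * \<epsilon>\<close>. The
  number \<open>R\<close> of pieces depends on the range and follows it; this is harmless because
  \<open>C'\<close> and the new separation degree do not involve \<open>R\<close>.\<close>

lemma tower_stage_exists:
  assumes k: "1 \<le> k" and j: "j < k"
  shows "\<exists>C \<epsilon>. \<forall>\<Delta>. \<exists>R q0. \<forall>F :: 'a::field set. finite_subfield2 F \<longrightarrow> q0 \<le> card F \<longrightarrow>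
    (\<exists>(V :: 'a list set) nbr col side. tower_stage k j R C \<Delta> \<epsilon> F V nbr col side)"
  using j
proof (induction j)
  case 0
  have "\<exists>R q0. \<forall>F :: 'a::field set. finite_subfield2 F \<longrightarrow> q0 \<le> card F \<longrightarrow>
    (\<exists>(V :: 'a list set) nbr col side. tower_stage k 0 R 1 \<Delta> 1 F V nbr col side)" for \<Delta>
  proof (intro exI allI impI)
    fix F :: "'a set" assume F: "finite_subfield2 F" "Suc \<Delta> \<le> card F"
    interpret finite_subfield2 F by fact
    show "tower_stage k 0 1 1 \<Delta> 1 F base_V base_nbr hd base_side"
      unfolding tower_stage_def
      using base.coloured_graph_axioms base_separated base_walks_covered F card_base_side by simp
  qed
  then show ?case by blast
next
  case (Suc j)
  then obtain C \<epsilon> where IH: "\<And>\<Delta>. \<exists>R q0. \<forall>F :: 'a::field set. finite_subfield2 F \<longrightarrow> q0 \<le> card F \<longrightarrow>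
    (\<exists>(V :: 'a list set) nbr col side. tower_stage k j R C \<Delta> \<epsilon> F V nbr col side)" by auto
  define N where "N = (2 * k + 2) * k"
  define C' where "C' = C * (N * \<epsilon> + 1) ^ k"
  have "\<exists>R q0. \<forall>F :: 'a::field set. finite_subfield2 F \<longrightarrow> q0 \<le> card F \<longrightarrow>
    (\<exists>(V :: 'a list set) nbr col side. tower_stage k (Suc j) R C' \<Delta>' (N * \<epsilon>) F V nbr col side)" for \<Delta>'
  proof -
    \<comment> \<open>The maximum with \<open>C\<close> keeps \<open>covered_finite\<close>
      applicable at stage \<open>j\<close>.\<close>
    define \<Delta> where "\<Delta> = max C (\<Delta>' + (\<Delta>' + 1) * (N * \<epsilon>))"
    obtain R q0 where R: "\<And>F :: 'a::field set. finite_subfield2 F \<Longrightarrow> q0 \<le> card F \<Longrightarrow>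
      \<exists>(V :: 'a list set) nbr col side. tower_stage k j R C \<Delta> \<epsilon> F V nbr col side"
      using IH by blast
    define R' where "R' = R * 2 ^ (C * (\<Delta> + 1) ^ k) *
        (1 + (k * (2 * N + 1) * (R + R * C * R) + k * k * (R + R * C * (R + R * C * R))))"
    \<comment> \<open>The field must outgrow the range of degrees, so that lines have enough points,
      and the number of pieces in the union bound.\<close>
    define q1 where "q1 = max q0 (max (Suc \<Delta>) (Suc (4 * (k + 1) * (R * 2 ^ (C * (\<Delta> + 1) ^ k)))))"
    have "\<exists>(V :: 'a list set) nbr col side. tower_stage k (Suc j) R' C' \<Delta>' (N * \<epsilon>) F V nbr col side"
      if F: "finite_subfield2 F" "q1 \<le> card F" for F :: "'a set"
    proof -
      obtain V :: "'a list set" and nbr col side where st: "tower_stage k j R C \<Delta> \<epsilon> F V nbr col side"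
        using R[OF F(1)] F(2) by (auto simp: q1_def)
      then interpret coloured_graph F V nbr col side by (simp add: tower_stage_def)
      have sep: "separated \<epsilon>" and wc: "walks_covered k j R C \<Delta>"
        and cs: "\<And>s. card {v \<in> V. side v = s} = card F ^ Suc j"
        using st by (auto simp: tower_stage_def)
      have "card V \<le> 2 * card F ^ k"
      proof -
        have "V = {v \<in> V. side v = True} \<union> {v \<in> V. side v = False}" by blast
        then have "card V \<le> card {v \<in> V. side v = True} + card {v \<in> V. side v = False}"
          by (metis card_Un_le)
        also have "\<dots> = 2 * card F ^ Suc j" unfolding cs by simp
        also have "\<dots> \<le> 2 * card F ^ k"
          using Suc.prems card_F_ge_2 by (intro mult_le_mono2 power_increasing) auto
        finally show ?thesis .
      qed
      moreover have "C \<le> \<Delta>" "\<Delta>' + (\<Delta>' + 1) * (N * \<epsilon>) \<le> \<Delta>" by (auto simp: \<Delta>_def)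
      moreover have "\<Delta> < card F" "4 * (k + 1) * (R * 2 ^ (C * (\<Delta> + 1) ^ k)) < card F"
        using F(2) by (auto simp: q1_def)
      ultimately obtain f where f: "edge_fun (N * \<epsilon>) f" and
        fc: "\<forall>l\<le>k. \<forall>x\<in>V. \<forall>y\<in>V. \<forall>c\<in>F. covered R' C' \<Delta>' (l - 1 - Suc j) {a \<in> walks x y l. voltage f x a l = c}"
        using exists_voltage_covered[OF wc sep, folded N_def, folded C'_def R'_def] by blast
      interpret voltage_lift F V nbr col side f "N * \<epsilon>" by unfold_locales (rule f)
      have "\<epsilon> \<le> N * \<epsilon>" using k by (simp add: N_def)
      then have "tower_stage k (Suc j) R' C' \<Delta>' (N * \<epsilon>) F lift_V lift_nbr (\<lambda>v. col (tl v)) (\<lambda>v. side (tl v))"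
        unfolding tower_stage_def
        using L.coloured_graph_axioms lift_separated[OF sep] lift_walks_covered[OF fc]
          card_lift_side[of "\<lambda>v. side v = s" for s] cs by simp
      then show ?thesis by blast
    qed
    then show ?thesis by blast
  qed
  then show ?case by blast
qed

text \<open>After \<open>k - 1\<close> lifts all walks of length at most \<open>k\<close> have
  dimension zero, and the range \<open>\<Delta> = C\<close> is just long enough to count
  them.\<close>

lemma few_walks:
  assumes "1 \<le> k"
  shows "\<exists>T q0. \<forall>F :: 'a::field set. finite_subfield2 F \<longrightarrow> q0 \<le> card F \<longrightarrow>
    (\<exists>(V :: 'a list set) nbr col side. coloured_graph F V nbr col side \<and>
       (\<forall>s. card {v \<in> V. side v = s} = card F ^ k) \<and>
       (\<forall>l\<le>k. \<forall>x\<in>V. \<forall>y\<in>V. card (coloured_graph.walks F nbr x y l) \<le> T))"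
proof -
  obtain C \<epsilon> where "\<forall>\<Delta>. \<exists>R q0. \<forall>F :: 'a::field set. finite_subfield2 F \<longrightarrow> q0 \<le> card F \<longrightarrow>
    (\<exists>(V :: 'a list set) nbr col side. tower_stage k (k - 1) R C \<Delta> \<epsilon> F V nbr col side)"
    using tower_stage_exists[of k "k - 1"] assms by auto
  then obtain R q0 where R: "\<And>F :: 'a::field set. finite_subfield2 F \<Longrightarrow> q0 \<le> card F \<Longrightarrow>
    \<exists>(V :: 'a list set) nbr col side. tower_stage k (k - 1) R C C \<epsilon> F V nbr col side" by blast
  show ?thesis
  proof (rule exI[of _ "R * C"], rule exI[of _ q0], intro allI impI)
    fix F :: "'a set" assume F: "finite_subfield2 F" "q0 \<le> card F"
    obtain V :: "'a list set" and nbr col side where st: "tower_stage k (k - 1) R C C \<epsilon> F V nbr col side"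
      using R[OF F] by blast
    then interpret coloured_graph F V nbr col side by (simp add: tower_stage_def)
    have wc: "walks_covered k (k - 1) R C C" using st by (simp add: tower_stage_def)
    have "card (walks x y l) \<le> R * C" if "l \<le> k" "x \<in> V" "y \<in> V" for l x y
    proof -
      have "l - 1 - (k - 1) = 0" using that by simp
      then show ?thesis using walks_coveredD[OF wc that] covered_finite(2)[of R C C "walks x y l"] by simp
    qed
    moreover have "\<forall>s. card {v \<in> V. side v = s} = card F ^ k" using st assms by (simp add: tower_stage_def)
    ultimately show "\<exists>(V :: 'a list set) nbr col side. coloured_graph F V nbr col side \<and>
       (\<forall>s. card {v \<in> V. side v = s} = card F ^ k) \<and>
       (\<forall>l\<le>k. \<forall>x\<in>V. \<forall>y\<in>V. card (coloured_graph.walks F nbr x y l) \<le> R * C)"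
      using coloured_graph_axioms by blast
  qed
qed

section \<open>Berge theta graphs\<close>

context coloured_graph
begin

text \<open>Induction prepends one step of the trail. The clause that every step of the walk is an
  edge of the trail is what excludes a backtrack at the new junction: it would make a later edge
  equal to the first, against distinctness. An initial step that stays is dropped, hence the
  condition \<open>u 1 \<noteq> u 0\<close> in the clause that identifies the second vertex.\<close>

lemma trail_contains_walk:
  fixes u v b
  assumes "u 0 \<in> V"
    and "\<And>j. j < k \<Longrightarrow> v j \<in> V \<and> side (v j) \<and> b j \<in> F \<and> {u j, u (Suc j)} \<subseteq> {v j, nbr (v j) (b j)}"
    and "inj_on (\<lambda>j. (v j, b j)) {..<k}"
  shows "\<exists>l\<le>k. \<exists>a\<in>walks (u 0) (u k) l. (\<forall>i<l. \<exists>j<k. step (u 0) a i = (v j, nbr (v j) (b j))) \<and>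
    (0 < k \<longrightarrow> u 1 \<noteq> u 0 \<longrightarrow> walk nbr (u 0) a 1 = u 1)"
  using assms
proof (induction k arbitrary: u v b)
  case 0
  have "(\<lambda>_. 0) \<in> walks (u 0) (u 0) 0" by (simp add: walks_def seqs_def)
  then show ?case by (intro exI[of _ 0]) auto
next
  case (Suc k)
  have e0: "v 0 \<in> V" "side (v 0)" "b 0 \<in> F" "{u 0, u 1} \<subseteq> {v 0, nbr (v 0) (b 0)}"
    using Suc.prems(2)[of 0] by auto
  have "\<exists>l\<le>k. \<exists>a\<in>walks (u (Suc 0)) (u (Suc k)) l.
      (\<forall>i<l. \<exists>j<k. step (u (Suc 0)) a i = (v (Suc j), nbr (v (Suc j)) (b (Suc j)))) \<and>
      (0 < k \<longrightarrow> u (Suc 1) \<noteq> u (Suc 0) \<longrightarrow> walk nbr (u (Suc 0)) a 1 = u (Suc 1))"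
  proof (rule Suc.IH[of "\<lambda>j. u (Suc j)" "\<lambda>j. v (Suc j)" "\<lambda>j. b (Suc j)"])
    show "u (Suc 0) \<in> V" using e0 by auto
    show "inj_on (\<lambda>j. (v (Suc j), b (Suc j))) {..<k}"
      using Suc.prems(3) by (auto simp: inj_on_def)
  qed (use Suc.prems(2) in auto)
  then obtain l a where l: "l \<le> k" and a: "a \<in> walks (u 1) (u (Suc k)) l"
    and st: "\<And>i. i < l \<Longrightarrow> \<exists>j<k. step (u 1) a i = (v (Suc j), nbr (v (Suc j)) (b (Suc j)))" by auto
  show ?case
  proof (cases "u 1 = u 0")
    case True
    have "\<exists>j<Suc k. step (u 0) a i = (v j, nbr (v j) (b j))" if "i < l" for i
      using st[OF that] True by (metis Suc_less_eq)
    then show ?thesis using l a True by (intro exI[of _ l]) auto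
  next
    case False
    define a' where "a' i = (case i of 0 \<Rightarrow> col (u 1) | Suc i \<Rightarrow> a i)" for i
    have uV: "u 0 \<in> V" "u 1 \<in> V" using e0 by auto
    from e0(4) False consider "u 0 = v 0" "u 1 = nbr (v 0) (b 0)" | "u 1 = v 0" "u 0 = nbr (v 0) (b 0)" by auto
    then have "nbr (u 0) (col (u 1)) = u 1 \<and> edge (u 0) (u 1) = (v 0, nbr (v 0) (b 0)) \<and>
        edge (u 1) (u 0) = (v 0, nbr (v 0) (b 0))"
    proof cases
      case 1
      show ?thesis unfolding 1 using e0(1-3) by (simp add: edge_def)
    next
      case 2
      show ?thesis unfolding 2 using e0(1-3) by (simp add: edge_def)
    qed
    then have nu: "nbr (u 0) (col (u 1)) = u 1" and ed: "edge (u 0) (u 1) = (v 0, nbr (v 0) (b 0))"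
      and ed': "edge (u 1) (u 0) = (v 0, nbr (v 0) (b 0))" by blast+
    have w: "walk nbr (u 0) a' (Suc i) = walk nbr (u 1) a i" for i
      by (induction i) (simp_all add: a'_def nu[unfolded One_nat_def])
    have s0: "step (u 0) a' 0 = (v 0, nbr (v 0) (b 0))"
      using ed nu by (simp add: step_def a'_def)
    have sS: "step (u 0) a' (Suc i) = step (u 1) a i" for i
      unfolding step_def w ..
    have as: "a \<in> seqs" "\<forall>i\<ge>l. a i = 0" "walk nbr (u 1) a l = u (Suc k)"
      and nb: "\<And>i. i + 2 \<le> l \<Longrightarrow> walk nbr (u 1) a (i + 2) \<noteq> walk nbr (u 1) a i"
      using a by (auto simp: walks_def)
    have "walk nbr (u 0) a' (i + 2) \<noteq> walk nbr (u 0) a' i" if i: "i + 2 \<le> Suc l" for i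
    proof (cases i)
      case 0
      show ?thesis
      proof
        assume "walk nbr (u 0) a' (i + 2) = walk nbr (u 0) a' i"
        then have "walk nbr (u 1) a (Suc 0) = u 0" using 0 w[of "Suc 0"] by (simp del: walk.simps(2) add: numeral_2_eq_2)
        then have "step (u 1) a 0 = (v 0, nbr (v 0) (b 0))" using ed' by (simp add: step_def)
        moreover obtain j where j: "j < k" "step (u 1) a 0 = (v (Suc j), nbr (v (Suc j)) (b (Suc j)))"
          using st[of 0] i 0 by auto
        ultimately have "v (Suc j) = v 0" "nbr (v 0) (b (Suc j)) = nbr (v 0) (b 0)" by auto
        moreover have "b (Suc j) \<in> F" using Suc.prems(2)[of "Suc j"] j by simp
        ultimately have "(v (Suc j), b (Suc j)) = (v 0, b 0)" using e0 col_nbr by (metis (no_types))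
        then show False using Suc.prems(3) j(1) by (auto dest: inj_onD)
      qed
    next
      case (Suc i')
      then show ?thesis using nb[of i'] i w[of "i' + 2"] w[of i'] by (simp del: walk.simps)
    qed
    moreover have "a' \<in> seqs" using as(1) uV by (auto simp: seqs_def a'_def split: nat.split)
    moreover have "a' i = 0" if "Suc l \<le> i" for i
      using as(2) that by (cases i) (auto simp: a'_def)
    ultimately have "a' \<in> walks (u 0) (u (Suc k)) (Suc l)"
      using as(3) w[of l] by (simp add: walks_def del: walk.simps)
    moreover have "\<exists>j<Suc k. step (u 0) a' i = (v j, nbr (v j) (b j))" if "i < Suc l" for i
    proof (cases i)
      case 0
      then show ?thesis using s0 by auto
    next
      case (Suc i')
      then show ?thesis using st[of i'] sS[of i'] that by auto
    qed
    ultimately show ?thesis using l w[of 0] by (intro exI[of _ "Suc l"]) auto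
  qed
qed

section \<open>The blow-up hypergraph\<close>

definition blowup_verts :: "nat \<Rightarrow> ('v \<times> nat) set" where
  "blowup_verts r = {v \<in> V. side v} \<times> {0} \<union> {v \<in> V. \<not> side v} \<times> {..<r - 1}"

definition blowup_edge :: "nat \<Rightarrow> 'v \<Rightarrow> 'a \<Rightarrow> ('v \<times> nat) set" where
  "blowup_edge r v a = insert (v, 0) ({nbr v a} \<times> {..<r - 1})"

text \<open>\<open>h\<close> will embed the vertices of the blow-up into the \<open>n\<close>
  labels; labels outside its image become isolated vertices, so that \<open>n\<close> can be any
  large number.\<close>

definition blowup :: "nat \<Rightarrow> nat \<Rightarrow> ('v \<times> nat \<Rightarrow> nat) \<Rightarrow> nat hypergraph" where
  "blowup r n h = ({..<n}, {h ` blowup_edge r v a | v a. v \<in> V \<and> side v \<and> a \<in> F})"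

lemma blowup_edge_subset: "v \<in> V \<Longrightarrow> side v \<Longrightarrow> a \<in> F \<Longrightarrow> blowup_edge r v a \<subseteq> blowup_verts r"
  by (auto simp: blowup_edge_def blowup_verts_def)

lemma inj_on_blowup_edge:
  assumes "2 \<le> r"
  shows "inj_on (\<lambda>(v, a). blowup_edge r v a) ({v \<in> V. side v} \<times> F)"
proof (rule inj_onI, clarify)
  fix v a v' a'
  assume v: "v \<in> V" "side v" "a \<in> F" "v' \<in> V" "side v'" "a' \<in> F"
    and eq: "blowup_edge r v a = blowup_edge r v' a'"
  have vv: "v = v'"
  proof -
    have "(v, 0) \<in> blowup_edge r v' a'" unfolding eq[symmetric] by (simp add: blowup_edge_def)
    then show ?thesis using v by (auto simp: blowup_edge_def)
  qed
  have "(nbr v a, 0) \<in> blowup_edge r v' a'"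
    unfolding eq[symmetric] using assms by (simp add: blowup_edge_def)
  then have "nbr v a = nbr v' a'" using v by (auto simp: blowup_edge_def)
  then have "a = a'" using v vv col_nbr by metis
  with vv show "v = v' \<and> a = a'" by simp
qed

lemma card_blowup_verts:
  assumes "\<And>s. card {v \<in> V. side v = s} = m" "2 \<le> r"
  shows "finite (blowup_verts r)" "card (blowup_verts r) = r * m"
proof -
  have fin: "finite {v \<in> V. side v}" "finite {v \<in> V. \<not> side v}" using finite_V by auto
  then show "finite (blowup_verts r)" by (simp add: blowup_verts_def)
  have "card (blowup_verts r) = card ({v \<in> V. side v} \<times> {0::nat}) + card ({v \<in> V. \<not> side v} \<times> {..<r - 1})"
    unfolding blowup_verts_def using fin by (intro card_Un_disjoint) auto
  also have "\<dots> = m + m * (r - 1)"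
    using assms(1)[of True] assms(1)[of False] by (simp add: card_cartesian_product)
  also have "\<dots> = r * m" using assms(2) by (cases r) auto
  finally show "card (blowup_verts r) = r * m" .
qed

lemma card_blowup_edges:
  assumes "\<And>s. card {v \<in> V. side v = s} = m" "2 \<le> r" and h: "inj_on h (blowup_verts r)"
  shows "card (edges (blowup r n h)) = m * card F"
proof -
  have "edges (blowup r n h) = (\<lambda>p. h ` (case p of (v, a) \<Rightarrow> blowup_edge r v a)) ` ({v \<in> V. side v} \<times> F)"
    by (auto simp: blowup_def image_def)
  moreover have "inj_on (\<lambda>p. h ` (case p of (v, a) \<Rightarrow> blowup_edge r v a)) ({v \<in> V. side v} \<times> F)"
  proof (rule inj_onI)
    fix p p' assume p: "p \<in> {v \<in> V. side v} \<times> F" "p' \<in> {v \<in> V. side v} \<times> F"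
      and eq: "h ` (case p of (v, a) \<Rightarrow> blowup_edge r v a) = h ` (case p' of (v, a) \<Rightarrow> blowup_edge r v a)"
    have "(case p of (v, a) \<Rightarrow> blowup_edge r v a) = (case p' of (v, a) \<Rightarrow> blowup_edge r v a)"
      using eq p blowup_edge_subset by (subst (asm) inj_on_image_eq_iff[OF h]) auto
    from inj_onD[OF inj_on_blowup_edge[OF assms(2)] this p] show "p = p'" .
  qed
  ultimately show ?thesis using assms(1)[of True] by (simp add: card_image card_cartesian_product)
qed

lemma uniform_blowup:
  assumes "2 \<le> r" and h: "inj_on h (blowup_verts r)" "h ` blowup_verts r \<subseteq> {..<n}"
  shows "uniform_hypergraph r (blowup r n h)"
  unfolding uniform_hypergraph_def
proof (intro conjI ballI)
  show "finite (verts (blowup r n h))" by (simp add: blowup_def)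
  fix e assume "e \<in> edges (blowup r n h)"
  then obtain v a where v: "v \<in> V" "side v" "a \<in> F" and e: "e = h ` blowup_edge r v a"
    by (auto simp: blowup_def)
  have sub: "blowup_edge r v a \<subseteq> blowup_verts r" using blowup_edge_subset[OF v] .
  then show "e \<subseteq> verts (blowup r n h)" using h e by (auto simp: blowup_def)
  have "v \<noteq> nbr v a" using v by (metis side_nbr)
  then have "card (blowup_edge r v a) = r"
    using assms(1) by (simp add: blowup_edge_def card_insert_if card_cartesian_product)
  then show "card e = r" using e card_image[OF inj_on_subset[OF h(1) sub]] by simp
qed

text \<open>The vertices after \<open>Source\<close> on the \<open>t\<close> paths are distinct, and
  their projections lie in the set \<open>S\<close> of at most \<open>1 + (k + 1) * T\<close>
  vertices. Over each vertex there are at most \<open>r - 1\<close> copies, which bounds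
  \<open>t\<close>.\<close>

lemma blowup_no_berge_theta:
  assumes k: "2 \<le> k" and r: "2 \<le> r" and h: "inj_on h (blowup_verts r)"
    and T: "\<forall>l\<le>k. \<forall>x\<in>V. \<forall>y\<in>V. card (walks x y l) \<le> T"
    and t: "(r - 1) * (1 + (k + 1) * T) < t"
    and G: "G \<in> berge_family r (theta_graph k t)"
  shows "\<not> contains_copy (blowup r n h) G"
proof
  assume "contains_copy (blowup r n h) G"
  then obtain f where f: "inj_on f (verts G)" "(\<lambda>e. f ` e) ` edges G \<subseteq> edges (blowup r n h)"
    unfolding contains_copy_def by blast
  have "is_berge (theta_graph k t) G" using G by (simp add: berge_family_def)
  then obtain g \<phi> where berge: "inj_on g (verts (theta_graph k t)) \<and>
      g ` verts (theta_graph k t) \<subseteq> verts G \<and>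
      bij_betw \<phi> (edges (theta_graph k t)) (edges G) \<and> (\<forall>e\<in>edges (theta_graph k t). g ` e \<subseteq> \<phi> e)"
    unfolding is_berge_def by (elim exE)
  then have g: "inj_on g (verts (theta_graph k t))" "g ` verts (theta_graph k t) \<subseteq> verts G"
    and \<phi>: "bij_betw \<phi> (edges (theta_graph k t)) (edges G)"
    and g\<phi>: "\<And>e. e \<in> edges (theta_graph k t) \<Longrightarrow> g ` e \<subseteq> \<phi> e" by simp_all
  have Gsub: "e \<subseteq> verts G" if "e \<in> edges G" for e
    using G that by (auto simp: berge_family_def uniform_hypergraph_def)
  let ?E = "edges (theta_graph k t)" and ?X = "blowup_verts r"
  define \<psi> where "\<psi> w = f (g w)" for w
  have psi_inj: "inj_on \<psi> (verts (theta_graph k t))"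
    unfolding \<psi>_def using comp_inj_on[OF g(1) inj_on_subset[OF f(1) g(2)]] by (simp add: comp_def)
  have phi_G: "\<phi> e \<in> edges G" if "e \<in> ?E" for e using \<phi> that by (auto simp: bij_betw_def)
  have "\<exists>v a. v \<in> V \<and> side v \<and> a \<in> F \<and> f ` \<phi> e = h ` blowup_edge r v a" if "e \<in> ?E" for e
  proof -
    have "f ` \<phi> e \<in> edges (blowup r n h)" using f(2) phi_G[OF that] by blast
    then show ?thesis by (auto simp: blowup_def)
  qed
  then obtain v a where va: "\<And>e. e \<in> ?E \<Longrightarrow> v e \<in> V \<and> side (v e) \<and> a e \<in> F \<and> f ` \<phi> e = h ` blowup_edge r (v e) (a e)"
    by metis
  have va_inj: "e = e'" if e: "e \<in> ?E" "e' \<in> ?E" "(v e, a e) = (v e', a e')" for e e'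
  proof -
    have "f ` \<phi> e = f ` \<phi> e'" using va[OF e(1)] va[OF e(2)] e(3) by simp
    then have "\<phi> e = \<phi> e'"
      using Gsub phi_G e by (subst (asm) inj_on_image_eq_iff[OF f(1)]) auto
    then show ?thesis using \<phi> e by (auto simp: bij_betw_def dest: inj_onD)
  qed
  \<comment> \<open>The vertex of the blow-up that represents \<open>w\<close>. By
    \<open>sigma\<close> it lies in the blow-up edge assigned to any theta edge containing
    \<open>w\<close>.\<close>
  define \<sigma> where "\<sigma> w = inv_into ?X h (\<psi> w)" for w
  have sigma: "\<sigma> w \<in> blowup_edge r (v e) (a e)" "\<sigma> w \<in> ?X" "h (\<sigma> w) = \<psi> w" if e: "e \<in> ?E" "w \<in> e" for e w
  proof -
    have "\<psi> w \<in> f ` \<phi> e" using g\<phi>[OF e(1)] e(2) by (auto simp: \<psi>_def)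
    then obtain p where p: "p \<in> blowup_edge r (v e) (a e)" "\<psi> w = h p" using va[OF e(1)] by auto
    moreover have "p \<in> ?X" using p va[OF e(1)] blowup_edge_subset by blast
    ultimately have "\<sigma> w = p" using h by (simp add: \<sigma>_def)
    then show "\<sigma> w \<in> blowup_edge r (v e) (a e)" "\<sigma> w \<in> ?X" "h (\<sigma> w) = \<psi> w" using p \<open>p \<in> ?X\<close> by auto
  qed
  define x where "x = fst (\<sigma> Source)"
  define y where "y = fst (\<sigma> Target)"
  define P where "P i j = {theta_path k i j, theta_path k i (Suc j)}" for i j
  have PE: "P i j \<in> ?E" if "i < t" "j < k" for i j using that by (auto simp: theta_graph_def P_def)
  have P_inj: "j = j'" if "j < k" "j' < k" "P i j = P i j'" for i j j'
    using that by (auto simp: P_def theta_path_def doubleton_eq_iff split: if_splits)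
  have t0: "0 < t" using t by simp
  have x: "x \<in> V" and y: "y \<in> V"
  proof -
    have "Source \<in> P 0 0" "Target \<in> P 0 (k - 1)" using k by (auto simp: P_def theta_path_def)
    then have "\<sigma> Source \<in> ?X" "\<sigma> Target \<in> ?X"
      using sigma(2) PE[OF t0, of 0] PE[OF t0, of "k - 1"] k by auto
    then show "x \<in> V" "y \<in> V" by (auto simp: x_def y_def blowup_verts_def)
  qed
  \<comment> \<open>The element \<open>x\<close> accounts for paths whose first step stays over
    \<open>x\<close>; the other paths are caught by the first step of a walk of some length
    \<open>l \<le> k\<close>.\<close>
  define S where "S = insert x (\<Union>l\<in>{..k}. (\<lambda>a. walk nbr x a 1) ` walks x y l)"
  have "finite S" by (simp add: S_def finite_walks)
  have "card S \<le> 1 + (k + 1) * T"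
  proof -
    have "card (\<Union>l\<in>{..k}. (\<lambda>a. walk nbr x a 1) ` walks x y l) \<le> (\<Sum>l\<in>{..k}. card ((\<lambda>a. walk nbr x a 1) ` walks x y l))"
      by (rule card_UN_le) simp
    also have "\<dots> \<le> (\<Sum>l\<in>{..k}. T)"
    proof (rule sum_mono)
      fix l assume "l \<in> {..k}"
      then have "card (walks x y l) \<le> T" using T x y by simp
      then show "card ((\<lambda>a. walk nbr x a 1) ` walks x y l) \<le> T"
        using card_image_le[OF finite_walks, of "\<lambda>a. walk nbr x a 1" x y l] by linarith
    qed
    finally have "card (\<Union>l\<in>{..k}. (\<lambda>a. walk nbr x a 1) ` walks x y l) \<le> (k + 1) * T" by simp
    then show ?thesis unfolding S_def by (intro order_trans[OF card_insert_le_m1]) auto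
  qed
  have inS: "fst (\<sigma> (Inner i 1)) \<in> S" if i: "i < t" for i
  proof -
    let ?u = "\<lambda>j. fst (\<sigma> (theta_path k i j))"
    have u0: "?u 0 = x" "?u k = y" "?u 1 = fst (\<sigma> (Inner i 1))"
      using k by (auto simp: theta_path_def x_def y_def)
    have "\<exists>l\<le>k. \<exists>b\<in>walks (?u 0) (?u k) l.
      (\<forall>i'<l. \<exists>j<k. step (?u 0) b i' = (v (P i j), nbr (v (P i j)) (a (P i j)))) \<and>
      (0 < k \<longrightarrow> ?u 1 \<noteq> ?u 0 \<longrightarrow> walk nbr (?u 0) b 1 = ?u 1)"
    proof (rule trail_contains_walk)
      show "?u 0 \<in> V" using x u0 by simp
      show "v (P i j) \<in> V \<and> side (v (P i j)) \<and> a (P i j) \<in> F \<and>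
         {?u j, ?u (Suc j)} \<subseteq> {v (P i j), nbr (v (P i j)) (a (P i j))}" if j: "j < k" for j
      proof -
        have "\<sigma> w \<in> blowup_edge r (v (P i j)) (a (P i j))" if "w \<in> P i j" for w
          using sigma(1)[OF PE[OF i j] that] .
        then have "fst (\<sigma> w) \<in> {v (P i j), nbr (v (P i j)) (a (P i j))}" if "w \<in> P i j" for w
          using that by (force simp: blowup_edge_def)
        then show ?thesis using va[OF PE[OF i j]] by (simp add: P_def)
      qed
      show "inj_on (\<lambda>j. (v (P i j), a (P i j))) {..<k}"
      proof (rule inj_onI)
        fix j j' assume j: "j \<in> {..<k}" "j' \<in> {..<k}" "(v (P i j), a (P i j)) = (v (P i j'), a (P i j'))"
        then have "P i j = P i j'" by (intro va_inj PE[OF i]) auto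
        then show "j = j'" using P_inj[of j j' i] j by simp
      qed
    qed
    then obtain l b where lb: "l \<le> k" "b \<in> walks (?u 0) (?u k) l"
      "0 < k \<longrightarrow> ?u 1 \<noteq> ?u 0 \<longrightarrow> walk nbr (?u 0) b 1 = ?u 1" by blast
    show ?thesis
    proof (cases "?u 1 = ?u 0")
      case True
      then show ?thesis unfolding u0 S_def by simp
    next
      case False
      then have "walk nbr x b 1 = fst (\<sigma> (Inner i 1))" using lb(3) k unfolding u0 by simp
      moreover have "b \<in> walks x y l" using lb(2) unfolding u0 .
      ultimately show ?thesis using lb(1) unfolding S_def
        by (intro insertI2 UN_I[of l] image_eqI[of _ _ b]) simp_all
    qed
  qed
  have "inj_on (\<lambda>i. \<sigma> (Inner i 1)) {..<t}"
  proof (rule inj_onI)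
    fix i i' assume i: "i \<in> {..<t}" "i' \<in> {..<t}" "\<sigma> (Inner i 1) = \<sigma> (Inner i' 1)"
    \<comment> \<open>Since \<open>k \<ge> 2\<close>, the second vertex of a path is not yet
      \<open>Target\<close>, so it identifies the path.\<close>
    have mem: "Inner i 1 \<in> P i 0" "Inner i 1 \<in> verts (theta_graph k t)" if "i < t" for i
    proof -
      have eq: "Inner i 1 = theta_path k i 1" using k by (simp add: theta_path_def)
      show "Inner i 1 \<in> P i 0" unfolding eq by (simp add: P_def)
      have "1 \<le> k" using k by simp
      then show "Inner i 1 \<in> verts (theta_graph k t)" unfolding eq theta_graph_def fst_conv using that by blast
    qed
    have "h (\<sigma> (Inner i 1)) = \<psi> (Inner i 1)" if "i < t" for i
      using sigma(3)[OF PE[OF that, of 0] mem(1)[OF that]] k by simp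
    then have "\<psi> (Inner i 1) = \<psi> (Inner i' 1)" using i by (metis lessThan_iff)
    then show "i = i'" using inj_onD[OF psi_inj _ mem(2) mem(2)] i by auto
  qed
  moreover have "(\<lambda>i. \<sigma> (Inner i 1)) ` {..<t} \<subseteq> S \<times> {..<r - 1}"
  proof
    fix p assume "p \<in> (\<lambda>i. \<sigma> (Inner i 1)) ` {..<t}"
    then obtain i where i: "i < t" "p = \<sigma> (Inner i 1)" by auto
    have "Inner i 1 \<in> P i 0" using k by (simp add: P_def theta_path_def)
    then have "p \<in> ?X" using sigma(2) PE[OF i(1), of 0] i k by auto
    then have "snd p < r - 1" using r by (auto simp: blowup_verts_def)
    then show "p \<in> S \<times> {..<r - 1}" using inS[OF i(1)] i by (simp add: mem_Times_iff)
  qed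
  ultimately have "card {..<t} \<le> card (S \<times> {..<r - 1})"
    using \<open>finite S\<close> by (intro card_inj_on_le) auto
  also have "\<dots> = (r - 1) * card S" by (simp add: card_cartesian_product)
  also have "\<dots> \<le> (r - 1) * (1 + (k + 1) * T)" using \<open>card S \<le> _\<close> by (intro mult_le_mono2)
  finally show False using t by simp
qed

end

section \<open>The lower bound for the extremal number\<close>

lemma ex_num_ge:
  assumes "H \<in> free_hypergraphs r n \<F>"
  shows "card (edges H) \<le> ex_num r n \<F>"
  unfolding ex_num_def by (rule Max_ge[OF finite_free_edge_counts]) (use assms in blast)

theorem theorem4:
  fixes r :: nat
  assumes "r \<ge> 2"
  shows "\<forall>k::nat\<ge>2. \<exists>t::nat\<ge>1. \<exists>c::real>0. \<exists>n0::nat. \<forall>n\<ge>n0.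
           real (ex_num r n (berge_family r (theta_graph k t))) \<ge> c * real n powr (1 + 1 / real k)"
proof (intro allI impI)
  fix k :: nat assume k: "2 \<le> k"
  obtain T q0 where Tq: "\<And>F :: bit alg_closure set. finite_subfield2 F \<Longrightarrow> q0 \<le> card F \<Longrightarrow>
    \<exists>(V :: bit alg_closure list set) nbr col side. coloured_graph F V nbr col side \<and>
       (\<forall>s. card {v \<in> V. side v = s} = card F ^ k) \<and>
       (\<forall>l\<le>k. \<forall>x\<in>V. \<forall>y\<in>V. card (coloured_graph.walks F nbr x y l) \<le> T)"
    using few_walks[where 'a = "bit alg_closure", of k] k by auto
  define t where "t = (r - 1) * (1 + (k + 1) * T) + 1"
  \<comment> \<open>With \<open>q\<close> the largest power of two such that
    \<open>r * q ^ k \<le> n\<close>, the number \<open>n\<close> stays below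
    \<open>B * q ^ k\<close>; the factor \<open>2 ^ k\<close> is the loss between consecutive powers
    of two.\<close>
  define B where "B = real (r * 2 ^ k)"
  define c where "c = B powr - (1 + 1 / real k)"
  \<comment> \<open>This guarantees \<open>m \<ge> 1\<close>, as the existence of the field
    requires, and \<open>q0 \<le> m < 2 ^ m\<close>.\<close>
  define m0 where "m0 = Suc q0"
  have B: "B > 0" using assms by (simp add: B_def)
  have "c * real n powr (1 + 1 / real k) \<le> real (ex_num r n (berge_family r (theta_graph k t)))"
    if n: "r * (2 ^ m0) ^ k \<le> n" for n
  proof -
    define m where "m = (GREATEST m. r * (2 ^ m) ^ k \<le> n)"
    have bnd: "m \<le> n" if "r * (2 ^ m) ^ k \<le> n" for m
    proof -
      have "m < 2 ^ m" by (rule less_exp)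
      also have "(2::nat) ^ m \<le> (2 ^ m) ^ k" using k by (intro self_le_power) auto
      also have "\<dots> \<le> r * (2 ^ m) ^ k" using assms by simp
      finally show ?thesis using that by simp
    qed
    have m: "r * (2 ^ m) ^ k \<le> n" unfolding m_def
      by (rule GreatestI_nat[of _ m0 n]) (use n bnd in auto)
    have m0m: "m0 \<le> m" unfolding m_def
      by (rule Greatest_le_nat[of _ m0 n]) (use n bnd in auto)
    have mS: "n < r * (2 ^ Suc m) ^ k"
    proof (rule ccontr)
      assume "\<not> n < r * (2 ^ Suc m) ^ k"
      then have "Suc m \<le> m" unfolding m_def
        by (intro Greatest_le_nat[of _ _ n]) (use bnd in \<open>auto simp: m_def\<close>)
      then show False by simp
    qed
    define q where "q = (2::nat) ^ m"
    have "1 \<le> m" using m0m by (simp add: m0_def)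
    then obtain F :: "bit alg_closure set" where F: "finite_subfield2 F" "card F = q"
      using finite_subfield2_exists unfolding q_def by blast
    have "q0 \<le> q"
    proof -
      have "q0 \<le> m" using m0m by (simp add: m0_def)
      also have "m < q" unfolding q_def by (rule less_exp)
      finally show ?thesis by simp
    qed
    obtain V :: "bit alg_closure list set" and nbr col side where G: "coloured_graph F V nbr col side"
      and cs: "\<And>s. card {v \<in> V. side v = s} = q ^ k"
      and w: "\<forall>l\<le>k. \<forall>x\<in>V. \<forall>y\<in>V. card (coloured_graph.walks F nbr x y l) \<le> T"
    proof -
      have "q0 \<le> card F" using F(2) \<open>q0 \<le> q\<close> by simp
      from Tq[OF F(1) this] show ?thesis unfolding F(2) using that by blast
    qed
    interpret coloured_graph F V nbr col side by (rule G)
    have "card (blowup_verts r) \<le> card {..<n}"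
      using card_blowup_verts(2)[OF cs assms] m by (simp add: q_def)
    then obtain h where h: "inj_on h (blowup_verts r)" "h ` blowup_verts r \<subseteq> {..<n}"
      using card_blowup_verts(1)[OF cs assms] by (metis card_le_inj finite_lessThan)
    have "blowup r n h \<in> free_hypergraphs r n (berge_family r (theta_graph k t))"
      unfolding free_hypergraphs_def
      using uniform_blowup[OF assms h] blowup_no_berge_theta[OF k assms h(1) w, of t]
      by (auto simp: blowup_def t_def)
    \<comment> \<open>Each of the \<open>q ^ k\<close> vertices on the side that is not copied lies
      in \<open>q\<close> hyperedges, and \<open>q ^ k * q\<close> is the power
      \<open>1 + 1 / k\<close> of \<open>q ^ k\<close>.\<close>
    from ex_num_ge[OF this] have "q ^ k * q \<le> ex_num r n (berge_family r (theta_graph k t))"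
      by (simp add: card_blowup_edges[OF cs assms h(1)] F)
    then have ex: "real (q ^ k * q) \<le> real (ex_num r n (berge_family r (theta_graph k t)))"
      by (rule of_nat_mono)
    have "real n \<le> B * real q ^ k"
    proof -
      have "n \<le> r * 2 ^ k * q ^ k" using mS by (simp add: q_def power_mult_distrib)
      then have "real n \<le> real (r * 2 ^ k * q ^ k)" by (rule of_nat_mono)
      then show ?thesis by (simp add: B_def)
    qed
    then have "real n powr (1 + 1 / real k) \<le> (B * real q ^ k) powr (1 + 1 / real k)"
      by (intro powr_mono2) auto
    also have "\<dots> = B powr (1 + 1 / real k) * (real q ^ k) powr (1 + 1 / real k)"
      using B by (simp add: powr_mult)
    also have "(real q ^ k) powr (1 + 1 / real k) = real (q ^ k * q)"
    proof -
      have q: "real q > 0" by (simp add: q_def)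
      then have "(real q ^ k) powr (1 + 1 / real k) = real q powr (real k * (1 + 1 / real k))"
        by (simp add: powr_powr flip: powr_realpow)
      also have "real k * (1 + 1 / real k) = real (Suc k)" using k by (simp add: field_simps)
      also have "real q powr real (Suc k) = real q ^ Suc k" using q by (rule powr_realpow)
      finally show ?thesis by (simp add: mult.commute)
    qed
    finally have "c * real n powr (1 + 1 / real k) \<le> c * (B powr (1 + 1 / real k) * real (q ^ k * q))"
      by (intro mult_left_mono) (simp_all add: c_def)
    also have "\<dots> = real (q ^ k * q)"
    proof -
      have "c * B powr (1 + 1 / real k) = 1" unfolding c_def powr_minus using B by simp
      then show ?thesis by (simp only: mult.assoc[symmetric] mult_1_left)
    qed
    finally show ?thesis using ex by simp
  qed
  moreover have "c > 0" using B by (simp add: c_def)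
  moreover have "1 \<le> t" by (simp add: t_def)
  ultimately show "\<exists>t::nat\<ge>1. \<exists>c::real>0. \<exists>n0::nat. \<forall>n\<ge>n0.
           real (ex_num r n (berge_family r (theta_graph k t))) \<ge> c * real n powr (1 + 1 / real k)"
    by blast
qed

end
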